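(* Let $S$ be an inverse semigroup with zero such that for every $s\in S$ the set $\mathcal{J}_s=\{e\in E(S): e\leqslant s\}$ has a finite cover, and suppose that for every $s\in S$ the set $\mathcal{W}_s$ of idempotents weakly fixed by $s$ has a finite cover. Then there is a faithful conditional expectation $\mathcal{E}: C^*_r(\mathcal{G}_{\mathrm{tight}}(S))\to C^*_r(\mathcal{G}_{\mathrm{tight}}(S^{\mathrm{Iso}}))$ given on the generators by $$\mathcal{E}(T_s)=T_s1_{Z_s}\qquad (s\in S),$$ where $Z_s=\bigcup_{c\in C}D_c$ for any finite cover $C$ of $\mathcal{W}_s$.
   Context: An inverse semigroup is a semigroup $S$ in which every $s$ has a unique $s^*$ with $ss^*s=s$, $s^*ss^*=s^*$; $E(S)$ is its set of idempotents. $s\leqslant t$ iff $s=te$ for some $e\in E(S)$. For $C\subseteq D\subseteq E(S)$, $C$ is a cover of $D$ if for each nonzero $d\in D$ there is $c\in C$ with $dc\neq0$. A filter is a nonempty proper subset of $E(S)$ that is upwards closed and closed under products; filters carry the topology from $\{0,1\}^{E(S)}$. $\widehat E_{\mathrm{tight}}(S)$ is the closure of the set of ultrafilters (maximal filters) in the space of filters; $D_e=\{\xi\in\widehat E_{\mathrm{tight}}(S): e\in\xi\}$; $\theta_s:D_{s^*s}\to D_{ss^*}$, $\theta_s(\xi)=\{f\in E(S): f\geqslant ses^*\text{ for some }e\in\xi\}$. The tight groupoid is $\mathcal{G}_{\mathrm{tight}}(S)=\{[s,\xi]: s\in S, \xi\in D_{s^*s}\}$, where $[s,\xi]=[t,\eta]$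 iff $\xi=\eta$ and $se=te$ for some $e\in\xi$, with $d[s,\xi]=\xi$, $r[s,\xi]=\theta_s(\xi)$, $[s,\xi]^{-1}=[s^*,\theta_s(\xi)]$, $[s,\theta_t(\xi)][t,\xi]=[st,\xi]$, unit space identified with $\widehat E_{\mathrm{tight}}(S)$, and topology with basis $\Theta(s,U)=\{[s,\xi]:\xi\in U\}$, $U\subseteq D_{s^*s}$ compact open. It is étale, and Hausdorff iff every $\mathcal{J}_s$ has a finite cover. $C^*_r$ denotes the reduced groupoid C*-algebra, and $T_s=1_{\Theta(s,D_{s^*s})}\in C_c(\mathcal{G}_{\mathrm{tight}}(S))$. An idempotent $e\leqslant s^*s$ is weakly fixed by $s$ if $sfs^*f\neq0$ for all $f\in E(S)$ with $0<f\leqslant e$; $\mathcal{W}_s$ is the set of such $e$. $S^{\mathrm{Iso}}=\{s\in S: s^*s\text{ is weakly fixed by }s\}$, an inverse subsemigroup containing $E(S)$; $\mathcal{G}_{\mathrm{tight}}(S^{\mathrm{Iso}})$ is identified with the open subgroupoid $\{[s,\xi]: s\in S^{\mathrm{Iso}},\xi\in D_{s^*s}\}$ of $\mathcal{G}_{\mathrm{tight}}(S)$, and its reduced C*-algebra with the corresponding C*-subalgebra of $C^*_r(\mathcal{G}_{\mathrm{tight}}(S))$. The set $Z_s$ does not depend on the finite cover $C$ and is a compact open subset of $\widehat E_{\mathrm{tight}}(S)$ (with $Z_s=\emptyset$ if $\mathcal{W}_s$ is empty), and $1_{Z_s}$ is its characteristic function, viewed in $C_c(\mathcal{G}_{\mathrm{tight}}(S))$.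 *)

theory Defs
  imports "HOL-Analysis.Analysis"
begin

section \<open>Inverse semigroups\<close>

class inverse_semigroup = semigroup_mult +
  assumes ex1_star: "\<exists>!t. s * t * s = s \<and> t * s * t = t"

class inverse_semigroup_0 = inverse_semigroup + mult_zero

definition star :: "'s::inverse_semigroup \<Rightarrow> 's"
  where "star s = (THE t. s * t * s = s \<and> t * s * t = t)"

definition idems :: "'s::inverse_semigroup set"
  where "idems = {e. e * e = e}"

definition nat_le :: "'s::inverse_semigroup \<Rightarrow> 's \<Rightarrow> bool"  (infix \<open>\<preceq>\<close> 50)
  where "s \<preceq> t \<longleftrightarrow> (\<exists>e\<in>idems. s = t * e)"

definition is_cover :: "'s::inverse_semigroup_0 set \<Rightarrow> 's set \<Rightarrow> bool"
  where "is_cover C D \<longleftrightarrow> C \<subseteq> D \<and> (\<forall>d\<in>D. d \<noteq> 0 \<longrightarrow> (\<exists>c\<in>C. d * c \<noteq> 0))"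

definition JJ :: "'s::inverse_semigroup \<Rightarrow> 's set"
  where "JJ s = {e\<in>idems. e \<preceq> s}"

definition weakly_fixed :: "'s::inverse_semigroup_0 \<Rightarrow> 's \<Rightarrow> bool"
  where "weakly_fixed s e \<longleftrightarrow> e \<in> idems \<and> e \<preceq> star s * s \<and>
    (\<forall>f\<in>idems. f \<noteq> 0 \<and> f \<preceq> e \<longrightarrow> s * f * star s * f \<noteq> 0)"

definition WW :: "'s::inverse_semigroup_0 \<Rightarrow> 's set"
  where "WW s = {e. weakly_fixed s e}"

definition S_Iso :: "'s::inverse_semigroup_0 set"
  where "S_Iso = {s. weakly_fixed s (star s * s)}"


section \<open>Filters and the tight spectrum\<close>

definition filters :: "'s::inverse_semigroup set set"
  where "filters = {\<xi>. \<xi> \<noteq> {} \<and> \<xi> \<subset> idems \<and>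
    (\<forall>e\<in>\<xi>. \<forall>f\<in>idems. e \<preceq> f \<longrightarrow> f \<in> \<xi>) \<and> (\<forall>e\<in>\<xi>. \<forall>f\<in>\<xi>. e * f \<in> \<xi>)}"

definition ultrafilters :: "'s::inverse_semigroup set set"
  where "ultrafilters = {\<xi>\<in>filters. \<forall>\<eta>\<in>filters. \<xi> \<subseteq> \<eta> \<longrightarrow> \<eta> = \<xi>}"

definition filter_top :: "'s::inverse_semigroup set topology"
  where "filter_top = pullback_topology filters (\<lambda>\<xi>. \<lambda>e\<in>idems. e \<in> \<xi>)
    (product_topology (\<lambda>_. discrete_topology (UNIV :: bool set)) idems)"

definition tight_spectrum :: "'s::inverse_semigroup set set"
  where "tight_spectrum = filter_top closure_of ultrafilters"

definition tight_top :: "'s::inverse_semigroup set topology"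
  where "tight_top = subtopology filter_top tight_spectrum"

definition DD :: "'s::inverse_semigroup \<Rightarrow> 's set set"
  where "DD e = {\<xi>\<in>tight_spectrum. e \<in> \<xi>}"

definition theta :: "'s::inverse_semigroup \<Rightarrow> 's set \<Rightarrow> 's set"
  where "theta s \<xi> = {f\<in>idems. \<exists>e\<in>\<xi>. s * e * star s \<preceq> f}"


section \<open>The tight groupoid\<close>

record 'g top_groupoid =
  arrows :: "'g set"
  src :: "'g \<Rightarrow> 'g"
  rng :: "'g \<Rightarrow> 'g"
  ginv :: "'g \<Rightarrow> 'g"
  gmul :: "'g \<Rightarrow> 'g \<Rightarrow> 'g"
  gtop :: "'g topology"

type_synonym 's germ = "('s \<times> 's set) set"

definition germ_dom :: "('s::inverse_semigroup \<times> 's set) set"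
  where "germ_dom = {(s, \<xi>). \<xi> \<in> DD (star s * s)}"

definition germ_rel :: "(('s::inverse_semigroup \<times> 's set) \<times> ('s \<times> 's set)) set"
  where "germ_rel = {((s, \<xi>), (t, \<eta>)). (s, \<xi>) \<in> germ_dom \<and> (t, \<eta>) \<in> germ_dom \<and>
    \<xi> = \<eta> \<and> (\<exists>e\<in>\<xi>. s * e = t * e)}"

definition germ :: "'s::inverse_semigroup \<Rightarrow> 's set \<Rightarrow> 's germ"
  where "germ s \<xi> = germ_rel `` {(s, \<xi>)}"

text \<open>The identification of the tight spectrum with the unit space: a filter \<open>\<xi>\<close> corresponds
  to the germ \<open>[e, \<xi>]\<close> for any \<open>e \<in> \<xi>\<close>.\<close>

definition unit_germ :: "'s::inverse_semigroup set \<Rightarrow> 's germ"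
  where "unit_germ \<xi> = the_elem {germ e \<xi> |e. e \<in> \<xi>}"

definition Theta :: "'s::inverse_semigroup \<Rightarrow> 's set set \<Rightarrow> 's germ set"
  where "Theta s U = {germ s \<xi> |\<xi>. \<xi> \<in> U}"

text \<open>In the following, \<open>the_elem\<close> is applied to the set of all values obtained from the
  representatives of a germ; by well-definedness of the groupoid operations this is a
  singleton whenever the arguments are (composable) elements of the groupoid.\<close>

definition tight_groupoid :: "'s::inverse_semigroup germ top_groupoid"
  where "tight_groupoid = \<lparr>
    arrows = germ_dom // germ_rel,
    src = (\<lambda>\<gamma>. the_elem {unit_germ \<xi> |s \<xi>. (s, \<xi>) \<in> \<gamma>}),
    rng = (\<lambda>\<gamma>. the_elem {unit_germ (theta s \<xi>) |s \<xi>. (s, \<xi>) \<in> \<gamma>}),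
    ginv = (\<lambda>\<gamma>. the_elem {germ (star s) (theta s \<xi>) |s \<xi>. (s, \<xi>) \<in> \<gamma>}),
    gmul = (\<lambda>\<gamma> \<delta>. the_elem {germ (s * t) \<xi> |s t \<xi>. (s, theta t \<xi>) \<in> \<gamma> \<and> (t, \<xi>) \<in> \<delta>}),
    gtop = topology_generated_by {Theta s U |s U. U \<subseteq> DD (star s * s) \<and>
      compactin tight_top U \<and> openin tight_top U} \<rparr>"

definition open_subgroupoid :: "'g top_groupoid \<Rightarrow> 'g set \<Rightarrow> 'g top_groupoid"
  where "open_subgroupoid G H = G\<lparr>arrows := H, gtop := subtopology (gtop G) H\<rparr>"

definition iso_arrows :: "'s::inverse_semigroup_0 germ set"
  where "iso_arrows = {germ s \<xi> |s \<xi>. s \<in> S_Iso \<and> \<xi> \<in> DD (star s * s)}"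


section \<open>The complex Hilbert space of square-summable functions\<close>

typedef 'a ell2 = "{f :: 'a \<Rightarrow> complex. (\<lambda>i. (norm (f i))\<^sup>2) summable_on UNIV}"
  by (rule exI[of _ "\<lambda>_. 0"]) auto

setup_lifting type_definition_ell2

lemma summable_on_norm_mult:
  fixes f g :: "'a \<Rightarrow> complex"
  assumes "(\<lambda>i. (norm (f i))\<^sup>2) summable_on UNIV" "(\<lambda>i. (norm (g i))\<^sup>2) summable_on UNIV"
  shows "(\<lambda>i. norm (f i) * norm (g i)) summable_on UNIV"
proof (rule summable_on_comparison_test)
  show "(\<lambda>i. (norm (f i))\<^sup>2 + (norm (g i))\<^sup>2) summable_on UNIV"
    by (intro summable_on_add assms)
  show "norm (f i) * norm (g i) \<le> (norm (f i))\<^sup>2 + (norm (g i))\<^sup>2" for i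
  proof -
    have "0 \<le> norm (f i) * norm (g i)" by simp
    then show ?thesis
      using sum_squares_bound[of "norm (f i)" "norm (g i)"] by linarith
  qed
qed auto

lemma ell2_add_closed:
  fixes f g :: "'a \<Rightarrow> complex"
  assumes "(\<lambda>i. (norm (f i))\<^sup>2) summable_on UNIV" "(\<lambda>i. (norm (g i))\<^sup>2) summable_on UNIV"
  shows "(\<lambda>i. (norm (f i + g i))\<^sup>2) summable_on UNIV"
proof (rule summable_on_comparison_test)
  show "(\<lambda>i. (norm (f i))\<^sup>2 + (norm (g i))\<^sup>2 + 2 * (norm (f i) * norm (g i))) summable_on UNIV"
    by (intro summable_on_add summable_on_cmult_right summable_on_norm_mult assms)
  show "(norm (f i + g i))\<^sup>2 \<le> (norm (f i))\<^sup>2 + (norm (g i))\<^sup>2 + 2 * (norm (f i) * norm (g i))" for i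
    using power_mono[OF norm_triangle_ineq[of "f i" "g i"], of 2] by (simp add: power2_sum)
qed auto

lemma ell2_scale_closed:
  fixes f :: "'a \<Rightarrow> complex"
  assumes "(\<lambda>i. (norm (f i))\<^sup>2) summable_on UNIV"
  shows "(\<lambda>i. (norm (c * f i))\<^sup>2) summable_on UNIV"
  using assms by (simp add: norm_mult power_mult_distrib summable_on_cmult_right)

lemma summable_on_complex_inner:
  fixes f g :: "'a \<Rightarrow> complex"
  assumes "(\<lambda>i. (norm (f i))\<^sup>2) summable_on UNIV" "(\<lambda>i. (norm (g i))\<^sup>2) summable_on UNIV"
  shows "(\<lambda>i. f i \<bullet> g i) summable_on UNIV"
  by (rule abs_summable_summable, rule summable_on_comparison_test[OF summable_on_norm_mult[OF assms]])
     (auto simp: Cauchy_Schwarz_ineq2)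

lift_definition scaleC_ell2 :: "complex \<Rightarrow> 'a ell2 \<Rightarrow> 'a ell2" is "\<lambda>c f i. c * f i"
  by (simp add: ell2_scale_closed)

instantiation ell2 :: (type) real_inner
begin

lift_definition zero_ell2 :: "'a ell2" is "\<lambda>_. 0" by simp

lift_definition plus_ell2 :: "'a ell2 \<Rightarrow> 'a ell2 \<Rightarrow> 'a ell2" is "\<lambda>f g i. f i + g i"
  by (simp add: ell2_add_closed)

lift_definition uminus_ell2 :: "'a ell2 \<Rightarrow> 'a ell2" is "\<lambda>f i. - f i" by simp

lift_definition minus_ell2 :: "'a ell2 \<Rightarrow> 'a ell2 \<Rightarrow> 'a ell2" is "\<lambda>f g i. f i - g i"
proof -
  fix f g :: "'a \<Rightarrow> complex"
  assume "(\<lambda>i. (norm (f i))\<^sup>2) summable_on UNIV" "(\<lambda>i. (norm (g i))\<^sup>2) summable_on UNIV"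
  then show "(\<lambda>i. (norm (f i - g i))\<^sup>2) summable_on UNIV"
    using ell2_add_closed[of f "\<lambda>i. - g i"] by simp
qed

lift_definition scaleR_ell2 :: "real \<Rightarrow> 'a ell2 \<Rightarrow> 'a ell2" is "\<lambda>r f i. r *\<^sub>R f i"
  by (simp add: power_mult_distrib summable_on_cmult_right)

lift_definition inner_ell2 :: "'a ell2 \<Rightarrow> 'a ell2 \<Rightarrow> real"
  is "\<lambda>f g. \<Sum>\<^sub>\<infinity>i. f i \<bullet> g i" .

definition "norm_ell2 (x :: 'a ell2) = sqrt (x \<bullet> x)"
definition "dist_ell2 (x :: 'a ell2) y = norm (x - y)"
definition "sgn_ell2 (x :: 'a ell2) = scaleR (inverse (norm x)) x"
definition [code del]:
  "(uniformity :: ('a ell2 \<times> 'a ell2) filter) = (INF e\<in>{0<..}. principal {(x, y). dist x y < e})"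
definition [code del]:
  "open (U :: 'a ell2 set) = (\<forall>x\<in>U. \<forall>\<^sub>F (x', y) in uniformity. x' = x \<longrightarrow> y \<in> U)"

instance
proof
  fix x y z :: "'a ell2" and r s :: real
  show "x + y + z = x + (y + z)" by transfer (simp add: add.assoc)
  show "x + y = y + x" by transfer (simp add: add.commute)
  show "0 + x = x" by transfer simp
  show "- x + x = 0" by transfer simp
  show "x - y = x + - y" by transfer simp
  show "r *\<^sub>R (x + y) = r *\<^sub>R x + r *\<^sub>R y" by transfer (simp add: scaleR_add_right)
  show "(r + s) *\<^sub>R x = r *\<^sub>R x + s *\<^sub>R x" by transfer (simp add: scaleR_add_left)
  show "r *\<^sub>R s *\<^sub>R x = (r * s) *\<^sub>R x" by transfer simp
  show "1 *\<^sub>R x = x" by transfer simp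
  show "x \<bullet> y = y \<bullet> x" by transfer (simp add: inner_commute)
  show "(x + y) \<bullet> z = x \<bullet> z + y \<bullet> z"
    by transfer (simp add: inner_add_left infsum_add summable_on_complex_inner)
  show "(r *\<^sub>R x) \<bullet> y = r * (x \<bullet> y)"
    by transfer (simp add: infsum_cmult_right')
  show "0 \<le> x \<bullet> x" by transfer (simp add: infsum_nonneg)
  show "x \<bullet> x = 0 \<longleftrightarrow> x = 0"
  proof
    assume "x \<bullet> x = 0"
    then show "x = 0"
    proof transfer
      fix f :: "'a \<Rightarrow> complex"
      assume sm: "(\<lambda>i. (norm (f i))\<^sup>2) summable_on UNIV" and 0: "(\<Sum>\<^sub>\<infinity>i. f i \<bullet> f i) = 0"
      have "f i \<bullet> f i = 0" for i
        using nonneg_infsum_le_0D[of "\<lambda>i. f i \<bullet> f i" UNIV i] 0 sm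
        by (auto simp: power2_norm_eq_inner)
      then show "f = (\<lambda>_. 0)" by auto
    qed
  next
    assume "x = 0"
    then show "x \<bullet> x = 0" by transfer simp
  qed
qed (simp_all add: norm_ell2_def dist_ell2_def sgn_ell2_def uniformity_ell2_def open_ell2_def)

end

lemma norm_scaleC_ell2: "norm (scaleC_ell2 c x) = cmod c * norm x"
proof -
  have "scaleC_ell2 c x \<bullet> scaleC_ell2 c x = (cmod c)\<^sup>2 * (x \<bullet> x)"
    by transfer (simp add: infsum_cmult_right' flip: power2_norm_eq_inner,
        simp add: norm_mult power_mult_distrib infsum_cmult_right')
  then show ?thesis
    by (simp add: norm_ell2_def real_sqrt_mult)
qed

lemma bounded_linear_scaleC_ell2: "bounded_linear (scaleC_ell2 c)"
proof (rule bounded_linear_intro)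
  show "scaleC_ell2 c (x + y) = scaleC_ell2 c x + scaleC_ell2 c y" for x y :: "'a ell2"
    by transfer (simp add: distrib_left)
  show "scaleC_ell2 c (r *\<^sub>R x) = r *\<^sub>R scaleC_ell2 c x" for r and x :: "'a ell2"
    by transfer simp
  show "norm (scaleC_ell2 c x) \<le> norm x * cmod c" for x :: "'a ell2"
    by (simp add: norm_scaleC_ell2)
qed

text \<open>The complex inner product, linear in the second argument.\<close>

lift_definition cinner :: "'a ell2 \<Rightarrow> 'a ell2 \<Rightarrow> complex"
  is "\<lambda>f g. \<Sum>\<^sub>\<infinity>i. cnj (f i) * g i" .

text \<open>\<open>'a ell2 \<Rightarrow>\<^sub>L 'a ell2\<close> is the space of bounded \<^emph>\<open>real\<close>-linear operators. All operators
  considered below lie in the norm closure of a set of complex-linear operators and hence are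
  complex-linear.\<close>

type_synonym 'a op = "'a ell2 \<Rightarrow>\<^sub>L 'a ell2"

definition scaleC_op :: "complex \<Rightarrow> 'a op \<Rightarrow> 'a op"
  where "scaleC_op c a = Blinfun (scaleC_ell2 c) o\<^sub>L a"

lemma scaleC_op_apply: "blinfun_apply (scaleC_op c a) v = scaleC_ell2 c (blinfun_apply a v)"
  by (simp add: scaleC_op_def bounded_linear_Blinfun_apply[OF bounded_linear_scaleC_ell2])

definition adj :: "'a op \<Rightarrow> 'a op"
  where "adj a = (THE b. \<forall>u v. cinner (blinfun_apply b u) v = cinner u (blinfun_apply a v))"

definition positive_op :: "'a op \<Rightarrow> bool"
  where "positive_op a \<longleftrightarrow> (\<forall>v. cinner v (blinfun_apply a v) \<in> \<real>\<^sub>\<ge>\<^sub>0)"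


section \<open>The reduced C*-algebra of a Hausdorff etale groupoid\<close>

definition Cc :: "'g top_groupoid \<Rightarrow> ('g \<Rightarrow> complex) set"
  where "Cc G = {f. continuous_map (gtop G) euclidean f \<and> (\<forall>\<gamma>. \<gamma> \<notin> arrows G \<longrightarrow> f \<gamma> = 0) \<and>
    compactin (gtop G) (gtop G closure_of {\<gamma>\<in>arrows G. f \<gamma> \<noteq> 0})}"

text \<open>The direct sum, over all units \<open>x\<close>, of the left regular representations
  \<open>\<pi>\<^sub>x(f) \<delta>\<^sub>\<beta> = \<Sum>\<^sub>\<alpha> f(\<alpha>) \<delta>\<^bsub>\<alpha>\<beta>\<^esub>\<close> (\<open>d(\<alpha>) = r(\<beta>)\<close>) on \<open>\<ell>\<^sup>2(d\<^sup>-\<^sup>1(x))\<close>: it acts on \<open>\<ell>\<^sup>2\<close> of the set of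
  arrows, and by zero on its orthogonal complement in \<open>\<ell>\<^sup>2\<close> of the ambient type. The operator
  norm of \<open>reg_rep G f\<close> is therefore the reduced norm of \<open>f\<close>. For \<open>f \<in> Cc G\<close> the sums have
  finitely many nonzero terms and the operator is bounded.\<close>

definition reg_rep :: "'g top_groupoid \<Rightarrow> ('g \<Rightarrow> complex) \<Rightarrow> 'g op"
  where "reg_rep G f = Blinfun (\<lambda>v. Abs_ell2 (\<lambda>\<gamma>. if \<gamma> \<in> arrows G
    then \<Sum>\<^sub>\<infinity>\<beta>\<in>{\<beta>\<in>arrows G. src G \<beta> = src G \<gamma>}. f (gmul G \<gamma> (ginv G \<beta>)) * Rep_ell2 v \<beta>
    else 0))"

definition Cr :: "'g top_groupoid \<Rightarrow> 'g op set"
  where "Cr G = closure (reg_rep G ` Cc G)"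

text \<open>The C*-subalgebra of \<open>Cr G\<close> corresponding to the reduced C*-algebra of an open subgroupoid
  \<open>H\<close>: the closure of \<open>Cc H\<close>, whose elements are already extended by zero to all of \<open>G\<close>.\<close>

definition Cr_sub :: "'g top_groupoid \<Rightarrow> 'g set \<Rightarrow> 'g op set"
  where "Cr_sub G H = closure (reg_rep G ` Cc (open_subgroupoid G H))"

definition conditional_expectation :: "'a op set \<Rightarrow> 'a op set \<Rightarrow> ('a op \<Rightarrow> 'a op) \<Rightarrow> bool"
  where "conditional_expectation A B E \<longleftrightarrow> B \<subseteq> A \<and>
    (\<forall>a\<in>A. E a \<in> B) \<and>
    (\<forall>a\<in>A. \<forall>a'\<in>A. E (a + a') = E a + E a') \<and>
    (\<forall>c. \<forall>a\<in>A. E (scaleC_op c a) = scaleC_op c (E a)) \<and>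
    (\<forall>b\<in>B. E b = b) \<and>
    (\<forall>a\<in>A. norm (E a) \<le> norm a) \<and>
    (\<forall>a\<in>A. positive_op a \<longrightarrow> positive_op (E a)) \<and>
    (\<forall>a\<in>A. \<forall>b\<in>B. E (b o\<^sub>L a) = b o\<^sub>L E a \<and> E (a o\<^sub>L b) = E a o\<^sub>L b)"

definition faithful_on :: "'a op set \<Rightarrow> ('a op \<Rightarrow> 'a op) \<Rightarrow> bool"
  where "faithful_on A E \<longleftrightarrow> (\<forall>a\<in>A. E (adj a o\<^sub>L a) = 0 \<longrightarrow> a = 0)"


section \<open>The generators\<close>

definition TT :: "'s::inverse_semigroup \<Rightarrow> 's germ op"
  where "TT s = reg_rep tight_groupoid (indicator (Theta s (DD (star s * s))))"

text \<open>The characteristic function of a subset of the tight spectrum, viewed as a function on the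
  groupoid supported on units.\<close>

definition unit_indicator :: "'s::inverse_semigroup set set \<Rightarrow> 's germ op"
  where "unit_indicator Z = reg_rep tight_groupoid (indicator (unit_germ ` Z))"

end

(* The expectation is a pinching. On \<ell>\<^sup>2 of the arrows, the regular representation of f has matrix
   entries f(\<gamma> \<beta>\<^sup>-\<^sup>1). The arrows of S^Iso form a subgroupoid H containing all units, so
   "\<gamma> \<beta>\<^sup>-\<^sup>1 \<in> H" is an equivalence relation, and compressing an operator to its diagonal blocks with
   respect to this relation turns the matrix of f into the matrix of the restriction of f to H.
   Block compression of arbitrary operators is linear, contractive, positive, and a bimodule map over
   the block diagonal operators; it keeps the diagonal entries, and those of a*a are the squared
   norms of the columns of a, whence faithfulness. What remains is that restriction to H preserves
   Cc, i.e. that H is clopen: a germ [s, \<xi>] lies in H iff some e \<in> \<xi> is weakly fixed by s, iff \<xi> \<in> Z_s,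
   and the finite cover of W_s makes Z_s compact open. *)

theory Submission
  imports Defs
begin

section \<open>Operators on square-summable functions\<close>

text \<open>The groupoid laws for germs are bypassed. Over a common source filter \<xi>, the
  quotient of [s, \<xi>] by [t, \<xi>] lies in H iff, for some f \<in> \<xi>, the conjugates by s
  and by t of every nonzero idempotent below f meet in a nonzero idempotent
  (\<open>agree_on\<close>). This is symmetric, and its transitivity is a computation with
  idempotents, so the equivalence relation needs no associativity of germs.

  On the operator side, \<open>Blinfun\<close>, \<open>Abs_ell2\<close> and \<open>adj\<close> are
  total and unspecified outside their proper domain. A matrix must be shown bounded before its
  entries can be read off: a function of compact support lives on finitely many bisections, each
  contributing at most one nonzero entry to any row or column, and Schur's test applies. The
  compression is defined on all bounded operators, so that passing to the closure of the image of Cc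
  is mere continuity. Operators are only real-linear by type; complex linearity is carried
  separately for the sake of adjoints.\<close>

lemma ell2_eqI: "(\<And>i. Rep_ell2 v i = Rep_ell2 w i) \<Longrightarrow> v = w"
  by (simp add: Rep_ell2_inject[symmetric] fun_eq_iff)

lemma Rep_ell2_summable: "(\<lambda>i. (cmod (Rep_ell2 v i))\<^sup>2) summable_on UNIV"
  using Rep_ell2[of v] by simp

lemmas Rep_ell2_simps =
  zero_ell2.rep_eq plus_ell2.rep_eq minus_ell2.rep_eq scaleR_ell2.rep_eq scaleC_ell2.rep_eq

lemma norm_ell2_square: "(norm v)\<^sup>2 = (\<Sum>\<^sub>\<infinity>i. (cmod (Rep_ell2 v i))\<^sup>2)"
  by (simp add: power2_norm_eq_inner inner_ell2.rep_eq)

lemma sum_le_norm_ell2: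
  assumes "finite F"
  shows "(\<Sum>i\<in>F. (cmod (Rep_ell2 v i))\<^sup>2) \<le> (norm v)\<^sup>2"
  unfolding norm_ell2_square
  using assms by (intro finite_sum_le_infsum Rep_ell2_summable) auto

lemma norm_ell2_leI:
  assumes "\<And>F. finite F \<Longrightarrow> (\<Sum>i\<in>F. (cmod (Rep_ell2 v i))\<^sup>2) \<le> B\<^sup>2" "0 \<le> B"
  shows "norm v \<le> B"
proof -
  have "(norm v)\<^sup>2 \<le> B\<^sup>2"
    unfolding norm_ell2_square
    by (rule infsum_le_finite_sums[OF Rep_ell2_summable]) (use assms in auto)
  then show ?thesis
    using assms(2) by (rule power2_le_imp_le)
qed

lemma Rep_Abs_ell2:
  assumes "\<And>F. finite F \<Longrightarrow> (\<Sum>i\<in>F. (cmod (f i))\<^sup>2) \<le> B"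
  shows "Rep_ell2 (Abs_ell2 f) = f"
proof -
  have "(\<lambda>i. (cmod (f i))\<^sup>2) summable_on UNIV"
    by (rule nonneg_bdd_above_summable_on) (use assms in \<open>auto intro!: bdd_aboveI2\<close>)
  then show ?thesis
    by (simp add: Abs_ell2_inverse)
qed

text \<open>One estimate on finite partial sums yields both square summability, for
  \<open>Abs_ell2\<close>, and boundedness, for \<open>Blinfun\<close>. The adjoint,
  \<open>pinch\<close> and \<open>kernel_op\<close> are all built this way.\<close>

lemma Blinfun_Abs_ell2:
  fixes T :: "'a ell2 \<Rightarrow> 'a \<Rightarrow> complex"
  assumes add: "\<And>v w i. T (v + w) i = T v i + T w i"
    and scale: "\<And>r v i. T (r *\<^sub>R v) i = r *\<^sub>R T v i"
    and bound: "\<And>v F. finite F \<Longrightarrow> (\<Sum>i\<in>F. (cmod (T v i))\<^sup>2) \<le> (B * norm v)\<^sup>2"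
    and "0 \<le> B"
  shows Rep_Blinfun_Abs_ell2: "Rep_ell2 (blinfun_apply (Blinfun (\<lambda>v. Abs_ell2 (T v))) v) = T v"
    and norm_Blinfun_Abs_ell2: "norm (Blinfun (\<lambda>v. Abs_ell2 (T v))) \<le> B"
proof -
  have rep: "Rep_ell2 (Abs_ell2 (T v)) = T v" for v
    by (rule Rep_Abs_ell2) (rule bound)
  have le: "norm (Abs_ell2 (T v)) \<le> B * norm v" for v
    by (rule norm_ell2_leI) (simp_all add: rep bound \<open>0 \<le> B\<close>)
  have bl: "bounded_linear (\<lambda>v. Abs_ell2 (T v))"
    by (rule bounded_linear_intro[where K = B])
       (auto intro!: ell2_eqI simp: rep Rep_ell2_simps add scale le mult.commute[of _ B])
  show "Rep_ell2 (blinfun_apply (Blinfun (\<lambda>v. Abs_ell2 (T v))) v) = T v"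
    by (simp add: bounded_linear_Blinfun_apply[OF bl] rep)
  show "norm (Blinfun (\<lambda>v. Abs_ell2 (T v))) \<le> B"
    by (rule norm_blinfun_bound) (simp_all add: bounded_linear_Blinfun_apply[OF bl] le \<open>0 \<le> B\<close>)
qed

section \<open>Coordinate projections and unit vectors\<close>

lift_definition restr :: "'a set \<Rightarrow> 'a ell2 \<Rightarrow> 'a ell2" is "\<lambda>A f i. if i \<in> A then f i else 0"
proof -
  fix A and f :: "'a \<Rightarrow> complex"
  assume "(\<lambda>i. (cmod (f i))\<^sup>2) summable_on UNIV"
  then show "(\<lambda>i. (cmod (if i \<in> A then f i else 0))\<^sup>2) summable_on UNIV"
    by (rule summable_on_comparison_test) auto
qed

lift_definition delta :: "'a \<Rightarrow> 'a ell2" is "\<lambda>i j. if j = i then 1 else 0"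
proof -
  fix i :: 'a
  have "(\<lambda>j. (cmod (if j = i then 1 else 0))\<^sup>2) summable_on {i}"
    by simp
  then show "(\<lambda>j. (cmod (if j = i then 1 else 0))\<^sup>2) summable_on UNIV"
    by (rule summable_on_cong_neutral[THEN iffD1, rotated -1]) auto
qed

lemma restr_linear:
  "restr A (v + w) = restr A v + restr A w" "restr A (r *\<^sub>R v) = r *\<^sub>R restr A v"
  "restr A (scaleC_ell2 c v) = scaleC_ell2 c (restr A v)"
  by (auto intro!: ell2_eqI simp: restr.rep_eq Rep_ell2_simps)

lemma restr_restr: "restr A (restr B v) = restr (A \<inter> B) v"
  by (auto intro!: ell2_eqI simp: restr.rep_eq)

text \<open>Induction step for extending identities from the vectors \<open>delta i\<close> to all
  vectors of finite support.\<close>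

lemma restr_insert:
  "i \<notin> F \<Longrightarrow> restr (insert i F) v = restr F v + scaleC_ell2 (Rep_ell2 v i) (delta i)"
  by (auto intro!: ell2_eqI simp: restr.rep_eq Rep_ell2_simps delta.rep_eq)

lemma restr_empty [simp]: "restr {} v = 0"
  by (auto intro!: ell2_eqI simp: restr.rep_eq Rep_ell2_simps)

lemma restr_delta: "i \<in> A \<Longrightarrow> restr A (delta i) = delta i"
  by (auto intro!: ell2_eqI simp: restr.rep_eq delta.rep_eq)

lemma norm_restr_square: "(norm (restr A v))\<^sup>2 = (\<Sum>\<^sub>\<infinity>i\<in>A. (cmod (Rep_ell2 v i))\<^sup>2)"
  unfolding norm_ell2_square by (rule infsum_cong_neutral) (auto simp: restr.rep_eq)

lemma norm_restr_le: "norm (restr A v) \<le> norm v"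
proof -
  have "(norm (restr A v))\<^sup>2 \<le> (norm v)\<^sup>2"
    unfolding norm_restr_square norm_ell2_square[of v]
    by (intro infsum_mono_neutral summable_on_subset_banach[OF Rep_ell2_summable] Rep_ell2_summable) auto
  then show ?thesis
    by (rule power2_le_imp_le) simp
qed

text \<open>By Pythagoras the sum is the squared norm of the restriction to the union. Applied to
  the classes of an equivalence relation, it bounds block diagonal operators.\<close>

lemma sum_norm_restr_le:
  assumes "finite \<C>" "disjoint \<C>"
  shows "(\<Sum>C\<in>\<C>. (norm (restr C v))\<^sup>2) \<le> (norm v)\<^sup>2"
proof -
  have "(\<Sum>C\<in>\<C>. (norm (restr C v))\<^sup>2) = (norm (restr (\<Union>\<C>) v))\<^sup>2"
    using assms
  proof (induction \<C>)
    case (insert C \<C>)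
    then have "C \<inter> \<Union>\<C> = {}"
      by (fastforce simp: pairwise_insert disjnt_def)
    then have "(norm (restr (\<Union>(insert C \<C>)) v))\<^sup>2 = (norm (restr C v))\<^sup>2 + (norm (restr (\<Union>\<C>) v))\<^sup>2"
      unfolding norm_restr_square Union_insert
      by (intro infsum_Un_disjoint summable_on_subset_banach[OF Rep_ell2_summable]) auto
    with insert show ?case
      by (auto simp: pairwise_insert)
  qed auto
  also have "\<dots> \<le> (norm v)\<^sup>2"
    by (simp add: norm_restr_le)
  finally show ?thesis .
qed

text \<open>Density of the vectors with finite support. The error is the restriction to the
  complement, whose squared norm is the tail of a convergent sum.\<close>

lemma restr_tendsto: "((\<lambda>F. restr F v) \<longlongrightarrow> v) (finite_subsets_at_top UNIV)"
proof (rule Lim_transform)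
  have eq: "norm (v - restr F v) = sqrt ((norm v)\<^sup>2 - (\<Sum>i\<in>F. (cmod (Rep_ell2 v i))\<^sup>2))" if "finite F" for F
  proof -
    have "v - restr F v = restr (- F) v"
      by (auto intro!: ell2_eqI simp: restr.rep_eq Rep_ell2_simps)
    moreover have "(norm v)\<^sup>2 = (norm (restr F v))\<^sup>2 + (norm (restr (- F) v))\<^sup>2"
      unfolding norm_restr_square norm_ell2_square[of v]
      by (subst infsum_Un_disjoint[symmetric])
         (auto intro!: summable_on_subset_banach[OF Rep_ell2_summable])
    moreover have "(norm (restr F v))\<^sup>2 = (\<Sum>i\<in>F. (cmod (Rep_ell2 v i))\<^sup>2)"
      using that by (simp add: norm_restr_square)
    ultimately show ?thesis
      by (metis add_diff_cancel_left' norm_ge_zero real_sqrt_abs abs_of_nonneg)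
  qed
  have "((\<lambda>F. \<Sum>i\<in>F. (cmod (Rep_ell2 v i))\<^sup>2) \<longlongrightarrow> (norm v)\<^sup>2) (finite_subsets_at_top UNIV)"
    unfolding norm_ell2_square by (rule infsum_tendsto[OF Rep_ell2_summable])
  then have "((\<lambda>F. sqrt ((norm v)\<^sup>2 - (\<Sum>i\<in>F. (cmod (Rep_ell2 v i))\<^sup>2))) \<longlongrightarrow> sqrt ((norm v)\<^sup>2 - (norm v)\<^sup>2))
      (finite_subsets_at_top UNIV)"
    by (intro tendsto_intros)
  then have "((\<lambda>F. norm (v - restr F v)) \<longlongrightarrow> sqrt ((norm v)\<^sup>2 - (norm v)\<^sup>2)) (finite_subsets_at_top UNIV)"
    by (rule tendsto_cong[THEN iffD1, rotated])
       (auto intro!: eventually_finite_subsets_at_top_weakI simp: eq)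
  then show "((\<lambda>F. restr F v - v) \<longlongrightarrow> 0) (finite_subsets_at_top UNIV)"
    by (simp add: tendsto_norm_zero_iff[of "\<lambda>F. restr F v - v", symmetric] norm_minus_commute)
qed simp

section \<open>The complex inner product\<close>

lemma cinner_summable: "(\<lambda>i. cnj (Rep_ell2 u i) * Rep_ell2 v i) summable_on UNIV"
  by (rule abs_summable_summable)
     (use summable_on_norm_mult[OF Rep_ell2_summable Rep_ell2_summable, of u v] in \<open>simp add: norm_mult\<close>)

text \<open>The imaginary part of \<open>cnj z * w\<close> is the real inner product of
  \<open>\<i> * z\<close> with \<open>w\<close>. Additivity and continuity of \<open>cinner\<close>
  are thereby inherited from the real inner product.\<close>

lemma cinner_eq_Complex: "cinner u v = Complex (u \<bullet> v) (scaleC_ell2 \<i> u \<bullet> v)"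
proof -
  have "Re (cinner u v) = u \<bullet> v"
    unfolding cinner.rep_eq inner_ell2.rep_eq infsum_Re[OF cinner_summable, symmetric]
    by (simp add: inner_complex_def)
  moreover have "Im (cinner u v) = scaleC_ell2 \<i> u \<bullet> v"
    unfolding cinner.rep_eq inner_ell2.rep_eq infsum_Im[OF cinner_summable, symmetric]
    by (rule infsum_cong) (simp add: inner_complex_def scaleC_ell2.rep_eq algebra_simps)
  ultimately show ?thesis
    by (simp add: complex_eq_iff)
qed

lemma cinner_add_right: "cinner u (v + w) = cinner u v + cinner u w"
  by (simp add: cinner_eq_Complex inner_add_right complex_eq_iff)

lemma cinner_zero_right [simp]: "cinner u 0 = 0"
  by (simp add: cinner_eq_Complex complex_eq_iff)

lemma cinner_scaleC_right: "cinner u (scaleC_ell2 c v) = c * cinner u v"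
  by (simp add: cinner.rep_eq scaleC_ell2.rep_eq algebra_simps flip: infsum_cmult_right')

lemma cinner_commute: "cinner v u = cnj (cinner u v)"
  by (simp add: cinner.rep_eq mult.commute flip: infsum_cnj)

lemma cinner_self: "cinner v v = of_real ((norm v)\<^sup>2)"
proof -
  have "cnj (cinner v v) = cinner v v"
    by (rule cinner_commute[symmetric])
  then show ?thesis
    by (simp add: cinner_eq_Complex complex_eq_iff power2_norm_eq_inner)
qed

lemma cinner_delta: "cinner (delta i) v = Rep_ell2 v i"
proof -
  have "cinner (delta i) v = (\<Sum>\<^sub>\<infinity>j\<in>{i}. Rep_ell2 v j)"
    unfolding cinner.rep_eq by (rule infsum_cong_neutral) (auto simp: delta.rep_eq)
  then show ?thesis
    by simp
qed

lemma tendsto_cinner: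
  assumes "(f \<longlongrightarrow> v) F"
  shows "((\<lambda>x. cinner u (f x)) \<longlongrightarrow> cinner u v) F"
  unfolding cinner_eq_Complex by (intro tendsto_Complex tendsto_intros assms)

text \<open>The type \<open>'a op\<close> contains all bounded real-linear operators, but an adjoint
  with respect to \<open>cinner\<close> exists only for complex-linear ones; \<open>adj\<close> is
  meaningful only under this condition.\<close>

definition clinear_op :: "'a op \<Rightarrow> bool"
  where "clinear_op a \<longleftrightarrow> (\<forall>c v. blinfun_apply a (scaleC_ell2 c v) = scaleC_ell2 c (blinfun_apply a v))"

text \<open>Passes complex linearity from the operators \<open>reg_rep G f\<close> to the closure
  \<open>Cr G\<close>.\<close>

lemma closed_clinear_op: "closed {a. clinear_op a}"
proof -
  have "closed {a :: 'a op. blinfun_apply a (scaleC_ell2 c v) = scaleC_ell2 c (blinfun_apply a v)}" for c v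
    by (intro closed_Collect_eq bounded_linear.continuous_on[OF bounded_linear_scaleC_ell2]
        bounded_linear.continuous_on[OF blinfun.bounded_linear_left] continuous_on_id)
  then show ?thesis
    unfolding clinear_op_def by (intro closed_Collect_all)
qed

text \<open>The adjoint \<open>b\<close> is defined by its coordinates \<open>(b u)\<^sub>i = \<langle>a \<delta>\<^sub>i, u\<rangle>\<close>; this avoids the
  completeness of \<open>\<ell>\<^sup>2\<close>.\<close>

lemma adjoint_exists:
  fixes a :: "'a op"
  assumes a: "clinear_op a"
  obtains b where "\<And>u v. cinner (blinfun_apply b u) v = cinner u (blinfun_apply a v)"
proof -
  define T where "T = (\<lambda>u i. cinner (blinfun_apply a (delta i)) u)"
  define b where "b = Blinfun (\<lambda>u. Abs_ell2 (T u))"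
  have bound: "(\<Sum>i\<in>F. (cmod (T u i))\<^sup>2) \<le> (norm a * norm u)\<^sup>2" if F: "finite F" for F u
  proof -
    \<comment> \<open>The truncation of \<open>T u\<close> to \<open>F\<close> serves as test
      vector: pairing \<open>u\<close> with the image of \<open>w\<close> under \<open>a\<close>
      returns the squared norm of \<open>w\<close>, and after Cauchy-Schwarz one factor
      \<open>norm w\<close> cancels.\<close>
    define w where "w = Abs_ell2 (\<lambda>i. if i \<in> F then T u i else 0)"
    have w: "Rep_ell2 w i = (if i \<in> F then T u i else 0)" for i
    proof -
      have "Rep_ell2 w = (\<lambda>i. if i \<in> F then T u i else 0)"
        unfolding w_def
      proof (rule Rep_Abs_ell2)
        fix G :: "'a set" assume "finite G"
        then have "(\<Sum>i\<in>G. (cmod (if i \<in> F then T u i else 0))\<^sup>2) = (\<Sum>i\<in>G \<inter> F. (cmod (T u i))\<^sup>2)"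
          by (intro sum.mono_neutral_cong_right) auto
        also have "\<dots> \<le> (\<Sum>i\<in>F. (cmod (T u i))\<^sup>2)"
          by (intro sum_mono2 F) auto
        finally show "(\<Sum>i\<in>G. (cmod (if i \<in> F then T u i else 0))\<^sup>2) \<le> (\<Sum>i\<in>F. (cmod (T u i))\<^sup>2)" .
      qed
      then show ?thesis by simp
    qed
    have inner: "cinner u (blinfun_apply a (restr G w)) = (\<Sum>i\<in>G. of_real ((cmod (T u i))\<^sup>2))"
      if "finite G" "G \<subseteq> F" for G
      using that
    proof (induction G)
      case (insert i G)
      have "cinner u (blinfun_apply a (delta i)) = cnj (T u i)"
        unfolding T_def by (rule cinner_commute)
      with insert show ?case
        by (simp add: restr_insert blinfun.add_right cinner_add_right w a[unfolded clinear_op_def]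
            cinner_scaleC_right complex_norm_square[symmetric])
    qed (auto simp: blinfun.zero_right)
    have "restr F w = w"
      by (auto intro!: ell2_eqI simp: restr.rep_eq w)
    with inner[OF F] have "cinner u (blinfun_apply a w) = of_real (\<Sum>i\<in>F. (cmod (T u i))\<^sup>2)"
      by simp
    then have "(\<Sum>i\<in>F. (cmod (T u i))\<^sup>2) = u \<bullet> blinfun_apply a w"
      by (simp add: cinner_eq_Complex complex_eq_iff)
    also have "\<dots> \<le> norm u * (norm a * norm w)"
      by (rule order.trans[OF norm_cauchy_schwarz mult_left_mono[OF norm_blinfun]]) simp
    finally have le: "(\<Sum>i\<in>F. (cmod (T u i))\<^sup>2) \<le> norm u * (norm a * norm w)" .
    have "(norm w)\<^sup>2 = (norm (restr F w))\<^sup>2"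
      by (simp add: \<open>restr F w = w\<close>)
    also have "\<dots> = (\<Sum>i\<in>F. (cmod (T u i))\<^sup>2)"
      using F by (simp add: norm_restr_square w)
    finally have w_sq: "(norm w)\<^sup>2 = (\<Sum>i\<in>F. (cmod (T u i))\<^sup>2)" .
    have "norm w \<le> norm a * norm u"
    proof (cases "norm w = 0")
      case False
      then have "0 < norm w" by simp
      moreover have "norm w * norm w \<le> norm w * (norm a * norm u)"
        using le unfolding w_sq[symmetric] by (simp add: power2_eq_square mult_ac)
      ultimately show ?thesis
        by (simp only: mult_le_cancel_left_pos)
    qed simp
    then show ?thesis
      unfolding w_sq[symmetric] by (simp add: power_mono)
  qed
  have rep: "Rep_ell2 (blinfun_apply b u) = T u" for u
    unfolding b_def
  proof (rule Rep_Blinfun_Abs_ell2[OF _ _ bound])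
    show "T (r *\<^sub>R v) i = r *\<^sub>R T v i" for r v i
      by (simp add: T_def cinner_eq_Complex complex_eq_iff)
  qed (auto simp: T_def cinner_add_right)
  \<comment> \<open>On unit vectors the adjoint identity is the definition of \<open>T\<close>;
    induction extends it to finite support, and density to all \<open>v\<close>.\<close>
  have fin: "cinner (blinfun_apply b u) (restr F v) = cinner u (blinfun_apply a (restr F v))"
    if "finite F" for F u v
    using that
  proof induction
    case (insert i F)
    have "cinner (blinfun_apply b u) (delta i) = cinner u (blinfun_apply a (delta i))"
      using cinner_commute[of "blinfun_apply b u" "delta i"]
        cinner_commute[of u "blinfun_apply a (delta i)"]
      by (simp add: cinner_delta rep T_def)
    with insert show ?case
      by (simp add: restr_insert blinfun.add_right cinner_add_right a[unfolded clinear_op_def]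
          cinner_scaleC_right)
  qed (simp add: blinfun.zero_right)
  have "cinner (blinfun_apply b u) v = cinner u (blinfun_apply a v)" for u v
  proof (rule tendsto_unique)
    show "((\<lambda>F. cinner (blinfun_apply b u) (restr F v)) \<longlongrightarrow> cinner (blinfun_apply b u) v)
        (finite_subsets_at_top UNIV)"
      by (intro tendsto_cinner restr_tendsto)
    have "((\<lambda>F. cinner u (blinfun_apply a (restr F v))) \<longlongrightarrow> cinner u (blinfun_apply a v))
        (finite_subsets_at_top UNIV)"
      by (intro tendsto_cinner blinfun.tendsto tendsto_const restr_tendsto)
    then show "((\<lambda>F. cinner (blinfun_apply b u) (restr F v)) \<longlongrightarrow> cinner u (blinfun_apply a v))
        (finite_subsets_at_top UNIV)"
      by (rule tendsto_cong[THEN iffD1, rotated])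
         (auto intro!: eventually_finite_subsets_at_top_weakI simp: fin)
  qed simp
  then show thesis
    by (rule that)
qed

lemma cinner_eqI:
  assumes "\<And>v. cinner u v = cinner w v"
  shows "u = w"
proof (rule ell2_eqI)
  fix i
  show "Rep_ell2 u i = Rep_ell2 w i"
    using cinner_commute[of u "delta i"] cinner_commute[of w "delta i"] assms[of "delta i"]
    by (simp add: cinner_delta)
qed

text \<open>Existence comes from \<open>adjoint_exists\<close>; uniqueness holds because
  \<open>cinner\<close> separates vectors, so the definite description in \<open>adj\<close> denotes
  the constructed operator.\<close>

lemma cinner_adj:
  assumes "clinear_op a"
  shows "cinner (blinfun_apply (adj a) u) v = cinner u (blinfun_apply a v)"
proof -
  obtain b where b: "\<And>u v. cinner (blinfun_apply b u) v = cinner u (blinfun_apply a v)"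
    using adjoint_exists[OF assms] by blast
  have "adj a = b"
    unfolding adj_def
  proof (rule the_equality)
    fix b' assume b': "\<forall>u v. cinner (blinfun_apply b' u) v = cinner u (blinfun_apply a v)"
    show "b' = b"
      by (intro blinfun_eqI cinner_eqI) (simp add: b b')
  qed (simp add: b)
  with b show ?thesis by simp
qed

section \<open>Block compression along an equivalence relation\<close>

text \<open>Row \<open>i\<close> keeps only the columns in the class of \<open>i\<close>. Truncating
  the argument achieves this for an arbitrary bounded operator, with no infinite sum of compressed
  blocks whose convergence would have to be discussed.\<close>

definition pinch :: "('a \<times> 'a) set \<Rightarrow> 'a op \<Rightarrow> 'a op"
  where "pinch R a = Blinfun (\<lambda>v. Abs_ell2 (\<lambda>i. Rep_ell2 (blinfun_apply a (restr (R `` {i}) v)) i))"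

context
  fixes R :: "('a \<times> 'a) set"
  assumes R: "equiv UNIV R"
begin

lemma class_eq: "j \<in> R `` {i} \<Longrightarrow> R `` {j} = R `` {i}"
  using equiv_class_eq[OF R, of i j] by auto

lemma class_self: "i \<in> R `` {i}"
  using equiv_class_self[OF R] by auto

text \<open>Coordinates in the same class see the same truncated vector, so together they contribute
  at most the square of \<open>norm a\<close> times the squared norm of one block of
  \<open>v\<close>; distinct blocks are disjoint.\<close>

lemma pinch_bound:
  assumes "finite F"
  shows "(\<Sum>i\<in>F. (cmod (Rep_ell2 (blinfun_apply a (restr (R `` {i}) v)) i))\<^sup>2) \<le> (norm a * norm v)\<^sup>2"
proof -
  define \<C> where "\<C> = (\<lambda>i. R `` {i}) ` F"
  have "finite \<C>"
    using assms by (simp add: \<C>_def)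
  have "\<C> \<subseteq> UNIV // R"
    by (auto simp: \<C>_def quotient_def)
  then have disj: "disjoint \<C>"
    using quotient_disj[OF R] unfolding pairwise_def disjnt_def by blast
  have "(\<Sum>i\<in>F. (cmod (Rep_ell2 (blinfun_apply a (restr (R `` {i}) v)) i))\<^sup>2)
      = (\<Sum>C\<in>\<C>. \<Sum>i\<in>{i\<in>F. R `` {i} = C}. (cmod (Rep_ell2 (blinfun_apply a (restr (R `` {i}) v)) i))\<^sup>2)"
    unfolding \<C>_def by (rule sum.image_gen[OF assms])
  also have "\<dots> \<le> (\<Sum>C\<in>\<C>. (norm a)\<^sup>2 * (norm (restr C v))\<^sup>2)"
  proof (rule sum_mono)
    fix C
    have "(\<Sum>i\<in>{i\<in>F. R `` {i} = C}. (cmod (Rep_ell2 (blinfun_apply a (restr (R `` {i}) v)) i))\<^sup>2)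
        = (\<Sum>i\<in>{i\<in>F. R `` {i} = C}. (cmod (Rep_ell2 (blinfun_apply a (restr C v)) i))\<^sup>2)"
      by (rule sum.cong) auto
    also have "\<dots> \<le> (norm (blinfun_apply a (restr C v)))\<^sup>2"
      using assms by (intro sum_le_norm_ell2) auto
    also have "\<dots> \<le> (norm a * norm (restr C v))\<^sup>2"
      by (intro power_mono norm_blinfun) auto
    finally show "(\<Sum>i\<in>{i\<in>F. R `` {i} = C}. (cmod (Rep_ell2 (blinfun_apply a (restr (R `` {i}) v)) i))\<^sup>2)
        \<le> (norm a)\<^sup>2 * (norm (restr C v))\<^sup>2"
      by (simp add: power_mult_distrib)
  qed
  also have "\<dots> \<le> (norm a)\<^sup>2 * (norm v)\<^sup>2"
    unfolding sum_distrib_left[symmetric]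
    by (intro mult_left_mono sum_norm_restr_le \<open>finite \<C>\<close> disj) simp
  finally show ?thesis
    by (simp add: power_mult_distrib)
qed

lemma Rep_pinch:
  "Rep_ell2 (blinfun_apply (pinch R a) v) i = Rep_ell2 (blinfun_apply a (restr (R `` {i}) v)) i"
  unfolding pinch_def
  by (subst Rep_Blinfun_Abs_ell2[OF _ _ pinch_bound])
     (auto simp: restr_linear blinfun.add_right blinfun.scaleR_right Rep_ell2_simps)

lemma norm_pinch_le: "norm (pinch R a) \<le> norm a"
  unfolding pinch_def
  by (rule norm_Blinfun_Abs_ell2[OF _ _ pinch_bound])
     (auto simp: restr_linear blinfun.add_right blinfun.scaleR_right Rep_ell2_simps)

lemma pinch_add: "pinch R (a + b) = pinch R a + pinch R b"
  by (intro blinfun_eqI ell2_eqI) (simp add: Rep_pinch blinfun.add_left Rep_ell2_simps)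

lemma pinch_scaleR: "pinch R (r *\<^sub>R a) = r *\<^sub>R pinch R a"
  by (intro blinfun_eqI ell2_eqI) (simp add: Rep_pinch blinfun.scaleR_left Rep_ell2_simps)

lemma pinch_scaleC: "pinch R (scaleC_op c a) = scaleC_op c (pinch R a)"
  by (intro blinfun_eqI ell2_eqI) (simp add: Rep_pinch scaleC_op_apply Rep_ell2_simps)

lemma bounded_linear_pinch: "bounded_linear (pinch R)"
  by (rule bounded_linear_intro[where K = 1]) (auto simp: pinch_add pinch_scaleR norm_pinch_le)

lemma restr_pinch:
  "restr (R `` {i}) (blinfun_apply (pinch R a) v)
    = restr (R `` {i}) (blinfun_apply a (restr (R `` {i}) v))"
proof (rule ell2_eqI)
  fix j
  show "Rep_ell2 (restr (R `` {i}) (blinfun_apply (pinch R a) v)) j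
      = Rep_ell2 (restr (R `` {i}) (blinfun_apply a (restr (R `` {i}) v))) j"
    using class_eq[of j i] by (auto simp: restr.rep_eq Rep_pinch)
qed

text \<open>A row of \<open>pinch R b\<close> sees only its own class. Truncating the argument to
  another class leaves nothing for it, and truncating to the same class changes nothing.\<close>

lemma restr_commute_if_pinch_eq:
  assumes "pinch R b = b"
  shows "blinfun_apply b (restr (R `` {i}) v) = restr (R `` {i}) (blinfun_apply b v)"
proof (rule ell2_eqI)
  fix j
  show "Rep_ell2 (blinfun_apply b (restr (R `` {i}) v)) j = Rep_ell2 (restr (R `` {i}) (blinfun_apply b v)) j"
  proof (cases "j \<in> R `` {i}")
    case True
    then show ?thesis
      using Rep_pinch[of b v j] class_eq[OF True] by (auto simp: assms restr.rep_eq)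
  next
    case False
    have "R `` {j} \<inter> R `` {i} = {}"
      using False class_eq class_self by blast
    then show ?thesis
      using Rep_pinch[of b "restr (R `` {i}) v" j] False
      by (simp add: assms restr.rep_eq restr_restr blinfun.zero_right Rep_ell2_simps)
  qed
qed

text \<open>On the left, row \<open>i\<close> of \<open>b = pinch R b\<close> reads only the class
  of \<open>i\<close>, where \<open>a\<close> applied to the truncated vector agrees with
  \<open>pinch R a\<close> (\<open>restr_pinch\<close>). On the right, \<open>b\<close> commutes
  with the truncation.\<close>

lemma pinch_bimodule:
  assumes "pinch R b = b"
  shows "pinch R (b o\<^sub>L a) = b o\<^sub>L pinch R a" "pinch R (a o\<^sub>L b) = pinch R a o\<^sub>L b"
proof -
  show "pinch R (b o\<^sub>L a) = b o\<^sub>L pinch R a"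
  proof (intro blinfun_eqI ell2_eqI)
    fix v i
    have "Rep_ell2 (blinfun_apply (pinch R (b o\<^sub>L a)) v) i
        = Rep_ell2 (blinfun_apply (pinch R b) (blinfun_apply a (restr (R `` {i}) v))) i"
      by (simp add: Rep_pinch assms)
    also have "\<dots> = Rep_ell2 (blinfun_apply (pinch R b) (blinfun_apply (pinch R a) v)) i"
      unfolding Rep_pinch[of b] by (simp add: restr_pinch)
    finally show "Rep_ell2 (blinfun_apply (pinch R (b o\<^sub>L a)) v) i
        = Rep_ell2 (blinfun_apply (b o\<^sub>L pinch R a) v) i"
      by (simp add: assms)
  qed
  show "pinch R (a o\<^sub>L b) = pinch R a o\<^sub>L b"
    by (intro blinfun_eqI ell2_eqI) (simp add: Rep_pinch restr_commute_if_pinch_eq[OF assms])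
qed

text \<open>The quadratic form of the compression at \<open>v\<close> is the sum, over all classes,
  of the form of \<open>a\<close> at the corresponding block of \<open>v\<close>, and each summand
  is nonnegative.\<close>

lemma positive_pinch:
  assumes "positive_op a"
  shows "positive_op (pinch R a)"
  unfolding positive_op_def
proof
  fix v
  define g where "g = (\<lambda>i. cnj (Rep_ell2 v i) * Rep_ell2 (blinfun_apply (pinch R a) v) i)"
  have *: "(\<Sum>\<^sub>\<infinity>i\<in>R `` {k}. g i)
      = cinner (restr (R `` {k}) v) (blinfun_apply a (restr (R `` {k}) v))" for k
    unfolding cinner.rep_eq
  proof (rule infsum_cong_neutral)
    fix i assume "i \<in> R `` {k} \<inter> UNIV"
    then show "g i = cnj (Rep_ell2 (restr (R `` {k}) v) i)
        * Rep_ell2 (blinfun_apply a (restr (R `` {k}) v)) i"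
      using class_eq[of i k] by (auto simp: g_def Rep_pinch restr.rep_eq)
  qed (auto simp: restr.rep_eq)
  \<comment> \<open>Classes may be infinite in number and in size. The regrouping goes through their
    disjoint union, which \<open>snd\<close> maps bijectively onto the index set.\<close>
  have bij: "bij_betw snd (SIGMA C:UNIV // R. C) UNIV"
  proof (rule bij_betwI')
    fix x y :: "'a set \<times> 'a"
    assume "x \<in> (SIGMA C:UNIV // R. C)" "y \<in> (SIGMA C:UNIV // R. C)"
    then show "(snd x = snd y) = (x = y)"
      using quotient_disj[OF R, of "fst x" "fst y"] by (cases x; cases y) auto
  next
    fix i
    show "\<exists>x\<in>SIGMA C:UNIV // R. C. i = snd x"
      by (rule bexI[of _ "(R `` {i}, i)"]) (use class_self in \<open>auto simp: quotient_def\<close>)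
  qed auto
  have "g summable_on UNIV"
    unfolding g_def by (rule cinner_summable)
  then have "(g \<circ> snd) summable_on (SIGMA C:UNIV // R. C)"
    using summable_on_reindex_bij_betw[OF bij, of g] by (simp add: o_def)
  then have "infsum (g \<circ> snd) (SIGMA C:UNIV // R. C) = (\<Sum>\<^sub>\<infinity>C\<in>UNIV // R. \<Sum>\<^sub>\<infinity>i\<in>C. g i)"
    using infsum_Sigma_banach[of "g \<circ> snd" "UNIV // R" "\<lambda>C. C"] by simp
  moreover have "infsum (g \<circ> snd) (SIGMA C:UNIV // R. C) = infsum g UNIV"
    using infsum_reindex_bij_betw[OF bij, of g] by (simp add: o_def)
  moreover have "cinner v (blinfun_apply (pinch R a) v) = infsum g UNIV"
    by (simp add: cinner.rep_eq g_def)
  moreover have "(\<Sum>\<^sub>\<infinity>C\<in>UNIV // R. \<Sum>\<^sub>\<infinity>i\<in>C. g i) \<ge> 0"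
  proof (rule infsum_nonneg_complex)
    show "(\<lambda>C. \<Sum>\<^sub>\<infinity>i\<in>C. g i) summable_on UNIV // R"
      using summable_on_Sigma_banach[of "\<lambda>C i. g i" "UNIV // R" "\<lambda>C. C"]
        \<open>(g \<circ> snd) summable_on (SIGMA C:UNIV // R. C)\<close>
      by (auto simp: o_def case_prod_unfold)
    fix C assume "C \<in> UNIV // R"
    then obtain k where "C = R `` {k}"
      by (auto simp: quotient_def)
    then show "0 \<le> (\<Sum>\<^sub>\<infinity>i\<in>C. g i)"
      using assms by (simp add: * positive_op_def less_eq_complex_def complex_nonneg_Reals_iff)
  qed
  ultimately show "cinner v (blinfun_apply (pinch R a) v) \<in> \<real>\<^sub>\<ge>\<^sub>0"
    by (simp add: complex_nonneg_Reals_iff less_eq_complex_def)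
qed

lemma conditional_expectation_pinch:
  assumes "B \<subseteq> A" "\<And>a. a \<in> A \<Longrightarrow> pinch R a \<in> B" "\<And>b. b \<in> B \<Longrightarrow> pinch R b = b"
  shows "conditional_expectation A B (pinch R)"
  unfolding conditional_expectation_def
  by (simp add: assms pinch_add pinch_scaleC norm_pinch_le positive_pinch pinch_bimodule)

lemma faithful_pinch:
  assumes "\<And>a. a \<in> A \<Longrightarrow> clinear_op a"
  shows "faithful_on A (pinch R)"
  unfolding faithful_on_def
proof (intro ballI impI)
  fix a assume "a \<in> A" and 0: "pinch R (adj a o\<^sub>L a) = 0"
  note adj = cinner_adj[OF assms[OF \<open>a \<in> A\<close>]]
  have "blinfun_apply a (delta i) = 0" for i
  proof -
    have "0 = Rep_ell2 (blinfun_apply (pinch R (adj a o\<^sub>L a)) (delta i)) i"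
      by (simp add: 0 Rep_ell2_simps)
    also have "\<dots> = cinner (delta i) (blinfun_apply (adj a) (blinfun_apply a (delta i)))"
      using class_self by (simp add: Rep_pinch restr_delta cinner_delta)
    also have "\<dots> = cnj (cinner (blinfun_apply a (delta i)) (blinfun_apply a (delta i)))"
      by (subst cinner_commute) (simp add: adj)
    finally show ?thesis
      by (simp add: cinner_self)
  qed
  \<comment> \<open>All columns of \<open>a\<close> are zero. The coordinates of
    \<open>adj a\<close> applied to a vector are pairings with these columns, so
    \<open>adj a\<close> vanishes and with it \<open>a\<close>; this replaces a density
    argument.\<close>
  then have "Rep_ell2 (blinfun_apply (adj a) u) i = 0" for u i
    using cinner_commute[of "blinfun_apply (adj a) u" "delta i"] adj[of u "delta i"]
    by (simp add: cinner_delta)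
  then have "blinfun_apply (adj a) u = 0" for u
    by (intro ell2_eqI) (simp add: Rep_ell2_simps)
  then have "cinner u (blinfun_apply a v) = 0" for u v
    using adj[of u v, symmetric] cinner_commute[of 0 v] by simp
  then show "a = 0"
    by (intro blinfun_eqI) (metis cinner_self blinfun.zero_left norm_eq_zero of_real_eq_0_iff power_eq_0_iff)
qed

end

section \<open>Operators with finitely supported rows and columns\<close>

definition kernel_op :: "('a \<Rightarrow> 'a \<Rightarrow> complex) \<Rightarrow> 'a op"
  where "kernel_op K = Blinfun (\<lambda>v. Abs_ell2 (\<lambda>i. \<Sum>\<^sub>\<infinity>j. K i j * Rep_ell2 v j))"

text \<open>The hypothesis of a crude Schur test. The bounds are uniform in \<open>i\<close> and
  \<open>j\<close>; rows and columns that are merely finite would not give a bounded operator in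
  general.\<close>

definition finite_kernel :: "('a \<Rightarrow> 'a \<Rightarrow> complex) \<Rightarrow> bool"
  where "finite_kernel K \<longleftrightarrow> (\<exists>n M. (\<forall>i j. cmod (K i j) \<le> M) \<and>
    (\<forall>i. finite {j. K i j \<noteq> 0} \<and> card {j. K i j \<noteq> 0} \<le> n) \<and>
    (\<forall>j. finite {i. K i j \<noteq> 0} \<and> card {i. K i j \<noteq> 0} \<le> n))"

lemma finite_kernel_sum:
  assumes "finite_kernel K"
  shows "(\<Sum>\<^sub>\<infinity>j. K i j * Rep_ell2 v j) = (\<Sum>j\<in>{j. K i j \<noteq> 0}. K i j * Rep_ell2 v j)"
proof -
  have "(\<Sum>\<^sub>\<infinity>j. K i j * Rep_ell2 v j) = (\<Sum>\<^sub>\<infinity>j\<in>{j. K i j \<noteq> 0}. K i j * Rep_ell2 v j)"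
    by (rule infsum_cong_neutral) auto
  also have "\<dots> = (\<Sum>j\<in>{j. K i j \<noteq> 0}. K i j * Rep_ell2 v j)"
    using assms by (intro infsum_finite) (auto simp: finite_kernel_def)
  finally show ?thesis .
qed

text \<open>Schur's test: Cauchy-Schwarz along a row costs a factor \<open>n\<close>, exchanging the
  two sums costs another because each column is met by at most \<open>n\<close> rows, and the
  entries contribute the square of \<open>M\<close>. Hence the bound \<open>n * M\<close>.\<close>

lemma Rep_kernel_op:
  assumes K: "finite_kernel K"
  shows "Rep_ell2 (blinfun_apply (kernel_op K) v) i = (\<Sum>j\<in>{j. K i j \<noteq> 0}. K i j * Rep_ell2 v j)"
proof -
  define row where "row i = {j. K i j \<noteq> 0}" for i
  define col where "col j = {i. K i j \<noteq> 0}" for j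
  obtain n M where M: "\<And>i j. cmod (K i j) \<le> M"
    and row: "\<And>i. finite (row i)" "\<And>i. card (row i) \<le> n"
    and col: "\<And>j. finite (col j)" "\<And>j. card (col j) \<le> n"
    using K unfolding finite_kernel_def row_def col_def by metis
  have "0 \<le> M"
    using M order.trans norm_ge_zero by blast
  have bound: "(\<Sum>i\<in>F. (cmod (\<Sum>j\<in>row i. K i j * Rep_ell2 v j))\<^sup>2) \<le> (real n * M * norm v)\<^sup>2"
    if F: "finite F" for F v
  proof -
    have "(\<Sum>i\<in>F. (cmod (\<Sum>j\<in>row i. K i j * Rep_ell2 v j))\<^sup>2)
        \<le> (\<Sum>i\<in>F. \<Sum>j\<in>row i. real n * M\<^sup>2 * (cmod (Rep_ell2 v j))\<^sup>2)"
    proof (rule sum_mono)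
      fix i
      have "cmod (\<Sum>j\<in>row i. K i j * Rep_ell2 v j) \<le> (\<Sum>j\<in>row i. M * cmod (Rep_ell2 v j))"
        by (rule order.trans[OF norm_sum]) (auto intro!: sum_mono mult_right_mono M simp: norm_mult)
      then have "(cmod (\<Sum>j\<in>row i. K i j * Rep_ell2 v j))\<^sup>2 \<le> (\<Sum>j\<in>row i. M * cmod (Rep_ell2 v j))\<^sup>2"
        by (rule power_mono) simp
      also have "\<dots> \<le> real (card (row i)) * (\<Sum>j\<in>row i. (M * cmod (Rep_ell2 v j))\<^sup>2)"
        using sum_squared_le_sum_of_squares[of "\<lambda>j. M * cmod (Rep_ell2 v j)" "row i"] row
        by (simp add: mult.commute)
      also have "\<dots> \<le> real n * (\<Sum>j\<in>row i. (M * cmod (Rep_ell2 v j))\<^sup>2)"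
        using row by (intro mult_right_mono sum_nonneg) auto
      finally show "(cmod (\<Sum>j\<in>row i. K i j * Rep_ell2 v j))\<^sup>2
          \<le> (\<Sum>j\<in>row i. real n * M\<^sup>2 * (cmod (Rep_ell2 v j))\<^sup>2)"
        by (simp add: sum_distrib_left power_mult_distrib mult_ac)
    qed
    also have "\<dots> = (\<Sum>i\<in>F. \<Sum>j\<in>{j\<in>(\<Union>i\<in>F. row i). j \<in> row i}. real n * M\<^sup>2 * (cmod (Rep_ell2 v j))\<^sup>2)"
      by (intro sum.cong) auto
    also have "\<dots> = (\<Sum>j\<in>(\<Union>i\<in>F. row i). \<Sum>i\<in>{i\<in>F. j \<in> row i}. real n * M\<^sup>2 * (cmod (Rep_ell2 v j))\<^sup>2)"
      by (rule sum.swap_restrict) (use F row in auto)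
    also have "\<dots> \<le> (\<Sum>j\<in>(\<Union>i\<in>F. row i). real n * (real n * M\<^sup>2 * (cmod (Rep_ell2 v j))\<^sup>2))"
    proof (rule sum_mono)
      fix j
      have "card {i\<in>F. j \<in> row i} \<le> card (col j)"
        by (rule card_mono[OF col(1)]) (auto simp: row_def col_def)
      then have "real (card {i\<in>F. j \<in> row i}) \<le> real n"
        using col(2)[of j] by simp
      then show "(\<Sum>i\<in>{i\<in>F. j \<in> row i}. real n * M\<^sup>2 * (cmod (Rep_ell2 v j))\<^sup>2)
          \<le> real n * (real n * M\<^sup>2 * (cmod (Rep_ell2 v j))\<^sup>2)"
        by (simp add: mult_right_mono)
    qed
    also have "\<dots> = (real n * M)\<^sup>2 * (\<Sum>j\<in>(\<Union>i\<in>F. row i). (cmod (Rep_ell2 v j))\<^sup>2)"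
      by (simp add: sum_distrib_left power_mult_distrib power2_eq_square mult_ac)
    also have "\<dots> \<le> (real n * M)\<^sup>2 * (norm v)\<^sup>2"
      by (intro mult_left_mono sum_le_norm_ell2) (use F row in auto)
    finally show ?thesis
      by (simp add: power_mult_distrib)
  qed
  show ?thesis
    unfolding kernel_op_def finite_kernel_sum[OF K] row_def[symmetric]
    by (subst Rep_Blinfun_Abs_ell2[OF _ _ bound])
       (auto simp: Rep_ell2_simps algebra_simps sum.distrib scaleR_sum_right \<open>0 \<le> M\<close>)
qed

lemma clinear_kernel_op:
  assumes "finite_kernel K"
  shows "clinear_op (kernel_op K)"
  unfolding clinear_op_def
  by (intro allI ell2_eqI)
     (simp add: Rep_kernel_op[OF assms] Rep_ell2_simps sum_distrib_left mult_ac)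

lemma finite_kernel_restrict:
  assumes "finite_kernel K"
  shows "finite_kernel (\<lambda>i j. if P i j then K i j else 0)"
proof -
  obtain n M where K: "\<And>i j. cmod (K i j) \<le> M"
    "\<And>i. finite {j. K i j \<noteq> 0}" "\<And>i. card {j. K i j \<noteq> 0} \<le> n"
    "\<And>j. finite {i. K i j \<noteq> 0}" "\<And>j. card {i. K i j \<noteq> 0} \<le> n"
    using assms unfolding finite_kernel_def by metis
  have "0 \<le> M"
    using K(1) order.trans norm_ge_zero by blast
  have sub: "{j. (if P i j then K i j else 0) \<noteq> 0} \<subseteq> {j. K i j \<noteq> 0}"
    "{i. (if P i j then K i j else 0) \<noteq> 0} \<subseteq> {i. K i j \<noteq> 0}" for i j
    by auto
  show ?thesis
    unfolding finite_kernel_def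
  proof (intro exI[of _ n] exI[of _ M] conjI allI)
    show "cmod (if P i j then K i j else 0) \<le> M" for i j
      using K(1) \<open>0 \<le> M\<close> by simp
  qed (rule finite_subset[OF sub(1) K(2)] order.trans[OF card_mono[OF K(2) sub(1)] K(3)]
      finite_subset[OF sub(2) K(4)] order.trans[OF card_mono[OF K(4) sub(2)] K(5)])+
qed

lemma pinch_kernel_op:
  assumes R: "equiv UNIV R" and K: "finite_kernel K"
  shows "pinch R (kernel_op K) = kernel_op (\<lambda>i j. if (i, j) \<in> R then K i j else 0)"
proof (intro blinfun_eqI ell2_eqI)
  fix v i
  have "(\<Sum>j\<in>{j. K i j \<noteq> 0}. K i j * Rep_ell2 (restr (R `` {i}) v) j)
      = (\<Sum>j\<in>{j. (if (i, j) \<in> R then K i j else 0) \<noteq> 0}. (if (i, j) \<in> R then K i j else 0) * Rep_ell2 v j)"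
    by (rule sum.mono_neutral_cong_right) (use K in \<open>auto simp: restr.rep_eq finite_kernel_def\<close>)
  then show "Rep_ell2 (blinfun_apply (pinch R (kernel_op K)) v) i
      = Rep_ell2 (blinfun_apply (kernel_op (\<lambda>i j. if (i, j) \<in> R then K i j else 0)) v) i"
    by (simp add: Rep_pinch[OF R] Rep_kernel_op K finite_kernel_restrict)
qed

lemma finite_kernel_diagonal: "finite_kernel (\<lambda>i j. if i = j \<and> P j then 1 else 0)"
proof -
  have "{j. (if i = j \<and> P j then 1 else 0) \<noteq> (0 :: complex)} = (if P i then {i} else {})"
    "{j. (if j = i \<and> P i then 1 else 0) \<noteq> (0 :: complex)} = (if P i then {i} else {})" for i
    by auto
  then show ?thesis
    unfolding finite_kernel_def by (intro exI[of _ 1] exI[of _ "1 :: real"]) simp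
qed

text \<open>The diagonal kernel is the projection onto the coordinates with \<open>P\<close>, so
  composing with it on the right deletes columns. This is how \<open>unit_indicator\<close>
  acts.\<close>

lemma kernel_op_comp_diagonal:
  assumes K: "finite_kernel K"
  shows "kernel_op K o\<^sub>L kernel_op (\<lambda>i j. if i = j \<and> P j then 1 else 0)
    = kernel_op (\<lambda>i j. if P j then K i j else 0)"
proof (intro blinfun_eqI ell2_eqI)
  fix v i
  have diag: "Rep_ell2 (blinfun_apply (kernel_op (\<lambda>i j. if i = j \<and> P j then 1 else 0)) v) j
      = (if P j then Rep_ell2 v j else 0)" for j
  proof -
    have "{k. (if j = k \<and> P k then 1 else 0) \<noteq> (0 :: complex)} = (if P j then {j} else {})"
      by auto
    then show ?thesis
      by (simp add: Rep_kernel_op[OF finite_kernel_diagonal])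
  qed
  have "(\<Sum>j\<in>{j. K i j \<noteq> 0}. K i j * (if P j then Rep_ell2 v j else 0))
      = (\<Sum>j\<in>{j. (if P j then K i j else 0) \<noteq> 0}. (if P j then K i j else 0) * Rep_ell2 v j)"
    by (rule sum.mono_neutral_cong_right) (use K in \<open>auto simp: finite_kernel_def\<close>)
  then show "Rep_ell2 (blinfun_apply (kernel_op K o\<^sub>L kernel_op (\<lambda>i j. if i = j \<and> P j then 1 else 0)) v) i
      = Rep_ell2 (blinfun_apply (kernel_op (\<lambda>i j. if P j then K i j else 0)) v) i"
    by (simp add: Rep_kernel_op K finite_kernel_restrict diag)
qed

section \<open>Inverse semigroups\<close>

lemma star_props: "s * star s * s = s" "star s * s * star s = star s"
  using theI'[OF ex1_star[of s]] unfolding star_def by auto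

lemma star_unique: "s * t * s = s \<Longrightarrow> t * s * t = t \<Longrightarrow> star s = t"
  using star_props[of s] ex1_star[of s] by auto

lemma star_star [simp]: "star (star s) = s"
  by (rule star_unique) (fact star_props)+

lemma idem_simp: "e \<in> idems \<Longrightarrow> e * e = e"
  by (simp add: idems_def)

lemma star_idem: "e \<in> idems \<Longrightarrow> star e = e"
  by (rule star_unique) (simp_all add: idem_simp)

text \<open>For \<open>x\<close> the inverse of \<open>e * f\<close>, the element
  \<open>f * x * e\<close> is an inverse too. Uniqueness gives \<open>x = f * x * e\<close>, which
  makes \<open>x\<close> idempotent; so \<open>x\<close> is its own inverse, and that inverse is
  \<open>e * f\<close>.\<close>

lemma idem_mult [simp]:
  assumes "e \<in> idems" "f \<in> idems"
  shows "e * f \<in> idems"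
proof -
  define x where "x = star (e * f)"
  have x: "e * f * x * (e * f) = e * f" "x * (e * f) * x = x"
    unfolding x_def by (rule star_props)+
  have ee: "e * (e * y) = e * y" and ff: "f * (f * y) = f * y" for y
    using assms by (simp_all add: idem_simp flip: mult.assoc)
  have "x = f * x * e"
    unfolding x_def
  proof (rule star_unique, fold x_def)
    show "e * f * (f * x * e) * (e * f) = e * f"
      using x(1) by (simp add: mult.assoc ee ff)
    have "f * x * e * (e * f) * (f * x * e) = f * (x * (e * f) * x) * e"
      by (simp add: mult.assoc ee ff)
    then show "f * x * e * (e * f) * (f * x * e) = f * x * e"
      by (simp add: x(2))
  qed
  moreover have "(f * x * e) * (f * x * e) = f * (x * (e * f) * x) * e"
    by (simp add: mult.assoc)
  ultimately have "x * x = x"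
    by (metis x(2))
  then have "star x = x"
    by (intro star_idem) (simp add: idems_def)
  then have "x = e * f"
    by (simp add: x_def)
  with \<open>x * x = x\<close> show ?thesis
    by (simp add: idems_def)
qed

text \<open>Both \<open>e * f\<close> and \<open>f * e\<close> are inverses of the idempotent
  \<open>e * f\<close>.\<close>

lemma idem_commute:
  assumes e: "e \<in> idems" and f: "f \<in> idems"
  shows "e * f = f * e"
proof -
  have ee: "e * (e * y) = e * y" and ff: "f * (f * y) = f * y" for y
    using assms by (simp_all add: idem_simp flip: mult.assoc)
  have "star (e * f) = f * e"
    using idem_simp[OF idem_mult[OF e f]] idem_simp[OF idem_mult[OF f e]]
    by (intro star_unique) (simp_all add: mult.assoc ee ff)
  then show ?thesis
    by (simp add: star_idem[OF idem_mult[OF e f]])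
qed

lemma star_mult_idem [simp]: "star s * s \<in> idems" "s * star s \<in> idems"
  using star_props[of s] by (simp_all add: idems_def mult.assoc)

lemma star_mult: "star (s * t) = star t * star s"
proof (rule star_unique)
  have c: "t * star t * (star s * s) = star s * s * (t * star t)"
    by (rule idem_commute) simp_all
  have "s * t * (star t * star s) * (s * t) = s * (t * star t * (star s * s)) * t"
    by (simp add: mult.assoc)
  also have "\<dots> = (s * star s * s) * (t * star t * t)"
    unfolding c by (simp add: mult.assoc)
  finally show "s * t * (star t * star s) * (s * t) = s * t"
    by (simp add: star_props)
  have "star t * star s * (s * t) * (star t * star s) = star t * (star s * s * (t * star t)) * star s"
    by (simp add: mult.assoc)
  also have "\<dots> = (star t * t * star t) * (star s * s * star s)"
    unfolding c[symmetric] by (simp add: mult.assoc)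
  finally show "star t * star s * (s * t) * (star t * star s) = star t * star s"
    by (simp add: star_props)
qed

section \<open>Conjugating idempotents by an element\<close>

lemma conj_push:
  assumes "e \<in> idems"
  shows "s * e * star s * s = s * e"
proof -
  have "s * e * star s * s = s * (e * (star s * s))"
    by (simp add: mult.assoc)
  also have "\<dots> = s * star s * s * e"
    by (simp add: idem_commute[OF assms] mult.assoc)
  finally show ?thesis
    by (simp add: star_props)
qed

lemma conj_mult:
  assumes "f \<in> idems"
  shows "s * e * star s * (s * f * star s) = s * (e * f) * star s"
proof -
  have "s * e * star s * (s * f * star s) = s * e * (star s * s * f) * star s"
    by (simp add: mult.assoc)
  also have "star s * s * f = f * (star s * s)"
    by (rule idem_commute) (simp_all add: assms)
  also have "s * e * (f * (star s * s)) * star s = s * (e * f) * (star s * s * star s)"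
    by (simp add: mult.assoc)
  finally show ?thesis
    by (simp add: star_props)
qed

lemma conj_idem [simp]: "e \<in> idems \<Longrightarrow> s * e * star s \<in> idems"
  using conj_mult[of e s e] by (simp add: idems_def)

lemma star_conj_idem [simp]: "e \<in> idems \<Longrightarrow> star s * e * s \<in> idems"
  using conj_idem[of e "star s"] by simp

lemma star_conj_mult: "f \<in> idems \<Longrightarrow> star s * e * s * (star s * f * s) = star s * (e * f) * s"
  using conj_mult[of f "star s" e] by simp

lemma star_conj_conj:
  assumes "e \<in> idems"
  shows "star s * (s * e * star s) * s = star s * s * e"
  using conj_push[OF assms, of s] by (simp add: mult.assoc)

lemma conj_star_conj:
  assumes "e \<in> idems"
  shows "s * (star s * e * s) * star s = s * star s * e"
  using star_conj_conj[OF assms, of "star s"] by simp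

text \<open>Replaces the existential quantifier of the order by an equation; comparisons of
  idempotents are handled in this form from here on.\<close>

lemma nat_le_idem:
  assumes "f \<in> idems"
  shows "e \<preceq> f \<longleftrightarrow> e \<in> idems \<and> f * e = e"
proof
  assume "e \<preceq> f"
  then obtain g where g: "g \<in> idems" "e = f * g"
    by (auto simp: nat_le_def)
  then show "e \<in> idems \<and> f * e = e"
    using assms by (simp add: idem_simp flip: mult.assoc)
qed (auto simp: nat_le_def intro!: bexI[of _ e])

lemma zero_idem [simp]: "(0 :: 's::inverse_semigroup_0) \<in> idems"
  by (simp add: idems_def)

section \<open>Weakly fixed idempotents\<close>

lemma weakly_fixed_iff:
  "weakly_fixed s e \<longleftrightarrow> e \<in> idems \<and> star s * s * e = e \<and>
    (\<forall>f\<in>idems. f \<noteq> 0 \<and> e * f = f \<longrightarrow> s * f * star s * f \<noteq> 0)"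
  unfolding weakly_fixed_def by (auto simp: nat_le_idem)

lemma weakly_fixed_down:
  assumes "weakly_fixed s e" "f \<in> idems" "e * f = f"
  shows "weakly_fixed s f"
  unfolding weakly_fixed_iff
proof (intro conjI ballI impI)
  show "star s * s * f = f"
    using assms by (metis mult.assoc weakly_fixed_iff)
  fix g assume g: "g \<in> idems" "g \<noteq> 0 \<and> f * g = g"
  then have "e * g = g"
    using assms(3) by (metis mult.assoc)
  then show "s * g * star s * g \<noteq> 0"
    using assms(1) g by (simp add: weakly_fixed_iff)
qed fact

text \<open>Below \<open>e\<close> the elements \<open>s\<close> and \<open>t\<close> conjugate
  every idempotent alike, and weak fixing is a condition on these conjugates. This makes membership
  in H a property of germs rather than of representatives.\<close>

lemma weakly_fixed_cong:
  assumes "weakly_fixed s e" "s * e = t * e"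
  shows "weakly_fixed t e"
  unfolding weakly_fixed_iff
proof (intro conjI ballI impI)
  have e: "e \<in> idems" and se: "star s * s * e = e"
    using assms(1) by (simp_all add: weakly_fixed_iff)
  have conj_eq: "s * f * star s = t * f * star t" if "f \<in> idems" "e * f = f" for f
  proof -
    have "s * f = t * f"
      using assms(2) that by (metis mult.assoc)
    moreover have "f * star s = f * star t"
      using arg_cong[OF \<open>s * f = t * f\<close>, of star] that by (simp add: star_mult star_idem)
    ultimately show ?thesis
      by (metis mult.assoc)
  qed
  show "e \<in> idems" by fact
  \<comment> \<open>The domain of \<open>s * e\<close> is \<open>e\<close>. Computing the same
    domain from \<open>t * e\<close> places \<open>e\<close> below the domain of
    \<open>t\<close>.\<close>
  have "e = star (s * e) * (s * e)"
    using e se by (simp add: star_mult star_idem mult.assoc idem_simp)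
  also have "\<dots> = e * (star t * t * e)"
    unfolding assms(2) using e by (simp add: star_mult star_idem mult.assoc)
  also have "\<dots> = star t * t * e"
    using e by (metis idem_commute idem_simp mult.assoc star_mult_idem(1))
  finally show "star t * t * e = e" by simp
  fix f assume "f \<in> idems" "f \<noteq> 0 \<and> e * f = f"
  then show "t * f * star t * f \<noteq> 0"
    using assms(1) by (simp add: weakly_fixed_iff flip: conj_eq)
qed

text \<open>Weak fixing by \<open>s * star t\<close>, moved by conjugation with \<open>t\<close> to
  the source side. In this form the two elements play symmetric roles; for a fixed idempotent
  \<open>f\<close> it is an equivalence relation on the elements whose domain lies above
  \<open>f\<close>.\<close>

definition agree_on :: "'s::inverse_semigroup_0 \<Rightarrow> 's \<Rightarrow> 's \<Rightarrow> bool"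
  where "agree_on s t f \<longleftrightarrow>
    (\<forall>h\<in>idems. h \<noteq> 0 \<and> f * h = h \<longrightarrow> s * h * star s * (t * h * star t) \<noteq> 0)"

lemma agree_on_sym: "agree_on s t f \<Longrightarrow> agree_on t s f"
  unfolding agree_on_def by (metis conj_idem idem_commute)

lemma agree_on_down:
  assumes "agree_on s t f" "f * f' = f'"
  shows "agree_on s t f'"
  using assms unfolding agree_on_def by (metis mult.assoc)

lemma agree_on_self:
  assumes "(f :: 's::inverse_semigroup_0) \<in> idems" "star s * s * f = f"
  shows "agree_on s s f"
  unfolding agree_on_def
proof (intro ballI impI notI)
  fix h assume h: "h \<in> idems" "h \<noteq> 0 \<and> f * h = h" and 0: "s * h * star s * (s * h * star s) = 0"
  have "star s * s * h = h"
    using assms h by (metis mult.assoc)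
  moreover have "s * h * star s = 0"
    using 0 h by (simp add: idem_simp)
  ultimately show False
    using star_conj_conj[OF h(1), of s] h(2) by simp
qed

text \<open>For \<open>h\<close> below \<open>f\<close>, the meet \<open>a\<close> of the conjugates
  of \<open>h\<close> by \<open>s\<close> and \<open>t\<close> is pulled back along \<open>t\<close>
  to a nonzero \<open>h'\<close> below \<open>h\<close> whose conjugate by \<open>t\<close> is
  \<open>a\<close>. The second hypothesis at \<open>h'\<close> makes \<open>a\<close> meet the
  conjugate of \<open>h'\<close> by \<open>r\<close>. Enlarging both sides, the conjugates of
  \<open>h\<close> by \<open>s\<close> and \<open>r\<close> meet.\<close>

lemma agree_on_trans:
  assumes st: "agree_on s t f" and tr: "agree_on t r f"
  shows "agree_on s r f"
  unfolding agree_on_def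
proof (intro ballI impI)
  fix h assume h: "h \<in> idems" "h \<noteq> 0 \<and> f * h = h"
  define a where "a = s * h * star s * (t * h * star t)"
  define h' where "h' = star t * a * t"
  have a: "a \<in> idems" "a \<noteq> 0"
    using st h by (simp_all add: a_def agree_on_def)
  have tha: "t * h * star t * a = a"
  proof -
    have "t * h * star t * a = a * (t * h * star t)"
      by (intro idem_commute a) (simp add: h)
    also have "\<dots> = a"
      unfolding a_def using h by (simp only: mult.assoc[of "s * h * star s"] idem_simp conj_idem)
    finally show ?thesis .
  qed
  have "t * h' * star t = t * star t * a"
    unfolding h'_def by (rule conj_star_conj) fact
  also have "\<dots> = t * star t * (t * h * star t) * a"
    by (metis tha mult.assoc)
  also have "\<dots> = t * h * star t * a"
    by (metis mult.assoc star_props(1))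
  finally have th': "t * h' * star t = a"
    by (simp add: tha)
  have h': "h' \<in> idems" "h' \<noteq> 0"
    using a th' by (auto simp: h'_def)
  have hh': "h * h' = h'"
  proof -
    have "h' = star t * (t * h * star t * a) * t"
      by (simp add: tha h'_def)
    also have "\<dots> = (star t * (t * h * star t) * t) * h'"
      unfolding h'_def using h a by (subst star_conj_mult) simp_all
    also have "\<dots> = h * (star t * t * h')"
      unfolding star_conj_conj[OF h(1)] idem_commute[OF star_mult_idem(1) h(1)]
      by (simp add: mult.assoc)
    also have "star t * t * h' = h'"
      unfolding h'_def by (metis mult.assoc star_props(2))
    finally show ?thesis by simp
  qed
  have "f * h' = h'"
    using h hh' by (metis mult.assoc)
  then have ne: "a * (r * h' * star r) \<noteq> 0"
    using tr h' by (auto simp: agree_on_def th')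
  have "r * h' * star r = r * h * star r * (r * h' * star r)"
    using h' by (simp add: conj_mult hh')
  moreover have "a = t * h * star t * (s * h * star s)"
    unfolding a_def by (rule idem_commute) (simp_all add: h)
  ultimately have "a * (r * h' * star r) = t * h * star t * (s * h * star s * (r * h * star r)) * (r * h' * star r)"
    by (metis mult.assoc)
  with ne show "s * h * star s * (r * h * star r) \<noteq> 0"
    by auto
qed

section \<open>Filters and the tight spectrum\<close>

text \<open>Zero lies below every idempotent, so an upward closed set is proper exactly when it
  omits \<open>0\<close>.\<close>

lemma filters_iff:
  fixes \<xi> :: "'s::inverse_semigroup_0 set"
  shows "\<xi> \<in> filters \<longleftrightarrow> \<xi> \<noteq> {} \<and> \<xi> \<subseteq> idems \<and> 0 \<notin> \<xi> \<and>
    (\<forall>e\<in>\<xi>. \<forall>f\<in>idems. f * e = e \<longrightarrow> f \<in> \<xi>) \<and> (\<forall>e\<in>\<xi>. \<forall>f\<in>\<xi>. e * f \<in> \<xi>)"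
proof -
  have up: "(\<forall>e\<in>\<xi>. \<forall>f\<in>idems. e \<preceq> f \<longrightarrow> f \<in> \<xi>) \<longleftrightarrow> (\<forall>e\<in>\<xi>. \<forall>f\<in>idems. f * e = e \<longrightarrow> f \<in> \<xi>)"
    if "\<xi> \<subseteq> idems"
    using that by (auto simp: nat_le_idem)
  have "0 \<notin> \<xi> \<longleftrightarrow> \<xi> \<noteq> idems" if "\<xi> \<subseteq> idems" "\<forall>e\<in>\<xi>. \<forall>f\<in>idems. f * e = e \<longrightarrow> f \<in> \<xi>"
  proof -
    have "f \<in> \<xi>" if "0 \<in> \<xi>" "f \<in> idems" for f
      using that \<open>\<forall>e\<in>\<xi>. \<forall>f\<in>idems. f * e = e \<longrightarrow> f \<in> \<xi>\<close> by (metis mult_zero_right)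
    then show ?thesis
      using \<open>\<xi> \<subseteq> idems\<close> zero_idem by blast
  qed
  then show ?thesis
    unfolding filters_def mem_Collect_eq psubset_eq using up by blast
qed

context
  fixes \<xi> :: "'s::inverse_semigroup_0 set"
  assumes \<xi>: "\<xi> \<in> filters"
begin

lemma filter_idem: "e \<in> \<xi> \<Longrightarrow> e \<in> idems"
  using \<xi> by (auto simp: filters_iff)

lemma filter_up: "e \<in> \<xi> \<Longrightarrow> f \<in> idems \<Longrightarrow> f * e = e \<Longrightarrow> f \<in> \<xi>"
  using \<xi> by (auto simp: filters_iff)

lemma filter_mult: "e \<in> \<xi> \<Longrightarrow> f \<in> \<xi> \<Longrightarrow> e * f \<in> \<xi>"
  using \<xi> by (auto simp: filters_iff)

lemma filter_mult_iff:
  assumes "e \<in> idems" "f \<in> idems"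
  shows "e * f \<in> \<xi> \<longleftrightarrow> e \<in> \<xi> \<and> f \<in> \<xi>"
proof
  assume "e * f \<in> \<xi>"
  then show "e \<in> \<xi> \<and> f \<in> \<xi>"
    using assms by (metis filter_up idem_commute idem_simp mult.assoc)
qed (simp add: filter_mult)

text \<open>Removes the existential quantifier from \<open>theta\<close>. Membership in the image is
  decided by a single coordinate of \<xi>, so filter axioms and finite patterns transfer by
  algebra.\<close>

lemma mem_theta:
  assumes s: "star s * s \<in> \<xi>" and f: "f \<in> idems"
  shows "f \<in> theta s \<xi> \<longleftrightarrow> star s * f * s \<in> \<xi>"
proof
  assume "f \<in> theta s \<xi>"
  then obtain e where e: "e \<in> \<xi>" and le: "f * (s * e * star s) = s * e * star s"
    using f by (auto simp: theta_def nat_le_idem)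
  have "star s * f * s * (star s * s * e) = star s * (f * (s * e * star s)) * s"
    using filter_idem[OF e] by (metis mult.assoc conj_push star_props(1))
  also have "\<dots> = star s * s * e"
    unfolding le by (rule star_conj_conj) (rule filter_idem[OF e])
  finally show "star s * f * s \<in> \<xi>"
    using f by (intro filter_up[OF filter_mult[OF s e]]) simp_all
next
  assume *: "star s * f * s \<in> \<xi>"
  have "s * (star s * f * s) * star s = s * star s * f"
    by (rule conj_star_conj) fact
  also have "\<dots> \<preceq> f"
    using f by (metis idem_commute idem_simp mult.assoc nat_le_idem idem_mult star_mult_idem(2))
  finally show "f \<in> theta s \<xi>"
    using * f by (auto simp: theta_def)
qed

lemma theta_subset: "theta s \<xi> \<subseteq> idems"
  by (auto simp: theta_def)

lemma range_idem_in_theta: "star s * s \<in> \<xi> \<Longrightarrow> s * star s \<in> theta s \<xi>"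
  by (subst mem_theta) (simp_all flip: mult.assoc add: star_props)

lemma theta_filter:
  assumes s: "star s * s \<in> \<xi>"
  shows "theta s \<xi> \<in> filters"
  unfolding filters_iff
proof (intro conjI ballI impI)
  note m = mem_theta[OF s]
  show "theta s \<xi> \<noteq> {}"
    using range_idem_in_theta[OF s] by auto
  show "theta s \<xi> \<subseteq> idems"
    by (rule theta_subset)
  show "0 \<notin> theta s \<xi>"
    using \<xi> m[OF zero_idem] by (simp add: filters_iff)
  show "f \<in> theta s \<xi>" if e: "e \<in> theta s \<xi>" and f: "f \<in> idems" and le: "f * e = e" for e f
  proof -
    have "e \<in> idems" using e theta_subset by auto
    then have "star s * f * s * (star s * e * s) = star s * e * s"
      by (simp add: star_conj_mult le)
    moreover have "star s * e * s \<in> \<xi>"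
      using m[of e] e \<open>e \<in> idems\<close> by simp
    ultimately have "star s * f * s \<in> \<xi>"
      using f filter_up[of "star s * e * s" "star s * f * s"] by simp
    then show ?thesis
      using m[OF f] by simp
  qed
  show "e * f \<in> theta s \<xi>" if "e \<in> theta s \<xi>" "f \<in> theta s \<xi>" for e f
  proof -
    have ef: "e \<in> idems" "f \<in> idems" using that theta_subset by auto
    then have "star s * e * s \<in> \<xi>" "star s * f * s \<in> \<xi>"
      using m[of e] m[of f] that by simp_all
    then have "star s * (e * f) * s \<in> \<xi>"
      using filter_mult[of "star s * e * s" "star s * f * s"] ef by (simp add: star_conj_mult)
    then show ?thesis
      using m ef by simp
  qed
qed

text \<open>Multiplying an idempotent by \<open>e \<in> \<xi>\<close> on both sides does not affect
  its membership in \<xi>, and after this the pullbacks along \<open>s\<close> and \<open>t\<close>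
  coincide. So \<open>theta\<close> depends only on the germ.\<close>

lemma theta_cong:
  assumes "star s * s \<in> \<xi>" "star t * t \<in> \<xi>" "e \<in> \<xi>" "s * e = t * e"
  shows "theta s \<xi> = theta t \<xi>"
proof -
  have e: "e \<in> idems"
    using assms by (simp add: filter_idem)
  have conj: "e * star s = e * star t"
    using arg_cong[OF assms(4), of star] e by (simp add: star_mult star_idem)
  have "star s * f * s \<in> \<xi> \<longleftrightarrow> star t * f * t \<in> \<xi>" if f: "f \<in> idems" for f
  proof -
    have "e * (star s * f * s) * e = e * (star t * f * t) * e"
      using conj assms(4) by (metis mult.assoc)
    moreover have "e * g * e \<in> \<xi> \<longleftrightarrow> g \<in> \<xi>" if "g \<in> idems" for g
      using e that assms(3) by (simp add: filter_mult_iff)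
    ultimately show ?thesis
      using f by (metis star_conj_idem)
  qed
  then show ?thesis
    using mem_theta[OF assms(1)] mem_theta[OF assms(2)] theta_subset by blast
qed

end

lemma theta_star_theta:
  fixes \<xi> :: "'s::inverse_semigroup_0 set"
  assumes \<xi>: "\<xi> \<in> filters" and s: "star s * s \<in> \<xi>"
  shows "theta (star s) (theta s \<xi>) = \<xi>"
proof (rule set_eqI)
  fix f
  have *: "f \<in> theta (star s) (theta s \<xi>) \<longleftrightarrow> f \<in> \<xi>" if f: "f \<in> idems"
  proof -
    have "f \<in> theta (star s) (theta s \<xi>) \<longleftrightarrow> s * f * star s \<in> theta s \<xi>"
      using mem_theta[OF theta_filter[OF \<xi> s] _ f, of "star s"] range_idem_in_theta[OF \<xi> s] by simp
    also have "\<dots> \<longleftrightarrow> star s * s * f \<in> \<xi>"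
      using mem_theta[OF \<xi> s, of "s * f * star s"] f by (simp add: star_conj_conj)
    also have "\<dots> \<longleftrightarrow> f \<in> \<xi>"
      using s f by (simp add: filter_mult_iff[OF \<xi>])
    finally show ?thesis .
  qed
  show "f \<in> theta (star s) (theta s \<xi>) \<longleftrightarrow> f \<in> \<xi>"
    using * filter_idem[OF \<xi>] theta_subset[OF theta_filter[OF \<xi> s]]  by blast
qed

text \<open>The maps \<open>theta s\<close> and \<open>theta (star s)\<close> are monotone and
  mutually inverse, so a filter above the image is carried back to one above \<xi>, where maximality
  applies.\<close>

lemma theta_ultrafilter:
  fixes \<xi> :: "'s::inverse_semigroup_0 set"
  assumes \<xi>: "\<xi> \<in> ultrafilters" and s: "star s * s \<in> \<xi>"
  shows "theta s \<xi> \<in> ultrafilters"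
  unfolding ultrafilters_def
proof (intro CollectI conjI ballI impI)
  have \<xi>f: "\<xi> \<in> filters" and max: "\<And>\<eta>. \<eta> \<in> filters \<Longrightarrow> \<xi> \<subseteq> \<eta> \<Longrightarrow> \<eta> = \<xi>"
    using \<xi> by (auto simp: ultrafilters_def)
  show "theta s \<xi> \<in> filters"
    by (rule theta_filter) fact+
  fix \<eta> :: "'s set" assume \<eta>: "\<eta> \<in> filters" and sub: "theta s \<xi> \<subseteq> \<eta>"
  have ss: "star (star s) * star s \<in> \<eta>"
    using sub range_idem_in_theta[OF \<xi>f s] by auto
  have "\<xi> = theta (star s) (theta s \<xi>)"
    by (rule theta_star_theta[symmetric]) fact+
  also have "\<dots> \<subseteq> theta (star s) \<eta>"
    using sub by (auto simp: theta_def)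
  finally have "theta (star s) \<eta> = \<xi>"
    by (intro max theta_filter \<eta> ss)
  then show "\<eta> = theta s \<xi>"
    using theta_star_theta[OF \<eta> ss] by simp
qed

section \<open>The filter topology and tight filters\<close>

lemma topspace_filter_top: "topspace filter_top = filters"
  by (auto simp: filter_top_def topspace_pullback_topology)

lemma openin_filter_top_coordinate:
  assumes "e \<in> idems"
  shows "openin filter_top {\<xi>\<in>filters. e \<in> \<xi>}" "openin filter_top {\<xi>\<in>filters. e \<notin> \<xi>}"
proof -
  have *: "openin filter_top {\<xi>\<in>filters. (e \<in> \<xi>) = b}" for b
  proof -
    define P where "P = product_topology (\<lambda>_. discrete_topology (UNIV :: bool set)) (idems :: 'a set)"
    have "openin P {g \<in> topspace P. g e \<in> {b}}"
      unfolding P_def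
      by (rule openin_continuous_map_preimage[OF continuous_map_product_projection[OF assms]]) simp
    then show ?thesis
      unfolding filter_top_def openin_pullback_topology P_def[symmetric]
      by (intro exI[of _ "{g \<in> topspace P. g e \<in> {b}}"] conjI) (use assms in \<open>auto simp: P_def\<close>)
  qed
  show "openin filter_top {\<xi>\<in>filters. e \<in> \<xi>}" "openin filter_top {\<xi>\<in>filters. e \<notin> \<xi>}"
    using *[of True] *[of False] by simp_all
qed

text \<open>A basic open set of the cube constrains finitely many coordinates, so lying in the
  closure of the ultrafilters means being matched by an ultrafilter on each finite set of
  idempotents. This finite form replaces the topology in the arguments on \<open>theta\<close> and
  \<open>ZZ\<close>.\<close>

lemma tight_iff:
  "\<xi> \<in> tight_spectrum \<longleftrightarrow> \<xi> \<in> filters \<and>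
    (\<forall>F. finite F \<and> F \<subseteq> idems \<longrightarrow> (\<exists>\<eta>\<in>ultrafilters. \<forall>e\<in>F. e \<in> \<eta> \<longleftrightarrow> e \<in> \<xi>))"
proof (intro iffI conjI allI impI)
  assume \<xi>: "\<xi> \<in> tight_spectrum"
  then show \<xi>f: "\<xi> \<in> filters"
    using closure_of_subset_topspace[of filter_top ultrafilters]
    by (auto simp: tight_spectrum_def topspace_filter_top)
  fix F :: "'a set" assume F: "finite F \<and> F \<subseteq> idems"
  define U where "U = (\<Inter>e\<in>F. {\<eta>\<in>filters. e \<in> \<eta> \<longleftrightarrow> e \<in> \<xi>}) \<inter> filters"
  have coord: "openin filter_top {\<eta>\<in>filters. e \<in> \<eta> \<longleftrightarrow> e \<in> \<xi>}" if "e \<in> F" for e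
    using openin_filter_top_coordinate[of e] that F by (cases "e \<in> \<xi>") auto
  have "openin filter_top U"
  proof (cases "F = {}")
    case True
    then show ?thesis
      using openin_topspace[of filter_top] by (simp add: U_def topspace_filter_top)
  next
    case False
    then show ?thesis
      unfolding U_def using F coord openin_topspace[of filter_top]
      by (intro openin_Int openin_Inter) (auto simp: topspace_filter_top)
  qed
  moreover have "\<xi> \<in> U"
    using \<xi>f by (simp add: U_def)
  ultimately obtain \<eta> where "\<eta> \<in> ultrafilters" "\<eta> \<in> U"
    using \<xi> by (auto simp: tight_spectrum_def in_closure_of)
  then show "\<exists>\<eta>\<in>ultrafilters. \<forall>e\<in>F. e \<in> \<eta> \<longleftrightarrow> e \<in> \<xi>"
    by (auto simp: U_def)
next
  assume \<xi>: "\<xi> \<in> filters \<and>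
    (\<forall>F. finite F \<and> F \<subseteq> idems \<longrightarrow> (\<exists>\<eta>\<in>ultrafilters. \<forall>e\<in>F. e \<in> \<eta> \<longleftrightarrow> e \<in> \<xi>))"
  show "\<xi> \<in> tight_spectrum"
    unfolding tight_spectrum_def in_closure_of topspace_filter_top
  proof (intro conjI allI impI)
    fix T assume T: "\<xi> \<in> T \<and> openin filter_top T"
    then obtain V where V: "openin (product_topology (\<lambda>_. discrete_topology (UNIV :: bool set)) idems) V"
      and T_eq: "T = (\<lambda>\<xi>. \<lambda>e\<in>idems. e \<in> \<xi>) -` V \<inter> filters"
      by (auto simp: filter_top_def openin_pullback_topology)
    have "(\<lambda>e\<in>idems. e \<in> \<xi>) \<in> V"
      using T T_eq by auto
    then obtain X where X: "finite {e \<in> idems. X e \<noteq> (UNIV :: bool set)}"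
      "(\<lambda>e\<in>idems. e \<in> \<xi>) \<in> Pi\<^sub>E idems X" "Pi\<^sub>E idems X \<subseteq> V"
      using V by (auto simp: openin_product_topology_alt)
    then obtain \<eta> where \<eta>: "\<eta> \<in> ultrafilters"
      "\<forall>e\<in>{e \<in> idems. X e \<noteq> UNIV}. e \<in> \<eta> \<longleftrightarrow> e \<in> \<xi>"
      using \<xi>[THEN conjunct2, rule_format, of "{e \<in> idems. X e \<noteq> UNIV}"] by auto
    have "(\<lambda>e\<in>idems. e \<in> \<eta>) \<in> Pi\<^sub>E idems X"
    proof (rule restrict_PiE_iff[THEN iffD2], rule ballI)
      fix e :: 'a assume e: "e \<in> idems"
      then have "(e \<in> \<xi>) \<in> X e"
        using X(2) by (auto simp: PiE_iff)
      then show "(e \<in> \<eta>) \<in> X e"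
        using \<eta>(2) e by (cases "X e = UNIV") auto
    qed
    then have "\<eta> \<in> T"
      using \<eta>(1) subsetD[OF X(3)] by (simp add: T_eq ultrafilters_def)
    with \<eta>(1) show "\<exists>\<eta>. \<eta> \<in> ultrafilters \<and> \<eta> \<in> T"
      by blast
  qed (use \<xi> in simp)
qed

lemma tight_filter: "\<xi> \<in> tight_spectrum \<Longrightarrow> \<xi> \<in> filters"
  by (simp add: tight_iff)

lemma DD_filter: "\<xi> \<in> DD e \<Longrightarrow> \<xi> \<in> filters" "\<xi> \<in> DD e \<Longrightarrow> e \<in> \<xi>"
  by (simp_all add: DD_def tight_filter)

lemma theta_DD:
  fixes \<xi> :: "'s::inverse_semigroup_0 set"
  assumes "\<xi> \<in> DD (star s * s)"
  shows "theta s \<xi> \<in> DD (s * star s)"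
proof -
  note \<xi> = DD_filter[OF assms]
  have "theta s \<xi> \<in> tight_spectrum"
    unfolding tight_iff
  proof (intro conjI allI impI)
    show "theta s \<xi> \<in> filters"
      by (rule theta_filter) fact+
    fix F :: "'s set" assume F: "finite F \<and> F \<subseteq> idems"
    \<comment> \<open>\<xi> is approximated on the pullback of \<open>F\<close> along
      \<open>s\<close>; the additional \<open>star s * s\<close> puts the approximating ultrafilter
      into the domain of \<open>theta s\<close>.\<close>
    have "finite (insert (star s * s) ((\<lambda>f. star s * f * s) ` F))"
      "insert (star s * s) ((\<lambda>f. star s * f * s) ` F) \<subseteq> idems"
      using F by auto
    then obtain \<eta> where \<eta>: "\<eta> \<in> ultrafilters"
      "\<forall>e\<in>insert (star s * s) ((\<lambda>f. star s * f * s) ` F). e \<in> \<eta> \<longleftrightarrow> e \<in> \<xi>"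
      using assms unfolding DD_def tight_iff by blast
    have s: "star s * s \<in> \<eta>"
      using \<eta> \<xi> by simp
    have "\<eta> \<in> filters"
      using \<eta> by (simp add: ultrafilters_def)
    have "e \<in> theta s \<eta> \<longleftrightarrow> e \<in> theta s \<xi>" if "e \<in> F" for e
      using F that \<eta>(2) mem_theta[OF \<open>\<eta> \<in> filters\<close> s, of e] mem_theta[OF \<xi>, of e] by auto
    then show "\<exists>\<eta>\<in>ultrafilters. \<forall>e\<in>F. e \<in> \<eta> \<longleftrightarrow> e \<in> theta s \<xi>"
      using theta_ultrafilter[OF \<eta>(1) s] by blast
  qed
  then show ?thesis
    using range_idem_in_theta[OF \<xi>] by (simp add: DD_def)
qed

text \<open>If \<open>e * c\<close> were nonzero for all \<open>e \<in> \<xi>\<close>, the filter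
  generated by \<xi> and \<open>c\<close> would be proper and strictly larger than \<xi>.\<close>

lemma ultrafilter_witness:
  fixes \<xi> :: "'s::inverse_semigroup_0 set"
  assumes \<xi>: "\<xi> \<in> ultrafilters" and c: "c \<in> idems" "c \<notin> \<xi>"
  obtains e where "e \<in> \<xi>" "e * c = 0"
proof -
  have f: "\<xi> \<in> filters" and max: "\<And>\<eta>. \<eta> \<in> filters \<Longrightarrow> \<xi> \<subseteq> \<eta> \<Longrightarrow> \<eta> = \<xi>"
    using \<xi> by (auto simp: ultrafilters_def)
  define \<eta> where "\<eta> = {f\<in>idems. \<exists>e\<in>\<xi>. f * (e * c) = e * c}"
  have id: "e * c \<in> idems" if "e \<in> \<xi>" for e
    using filter_idem[OF f that] c by simp
  have "\<xi> \<subseteq> \<eta>"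
    unfolding \<eta>_def using filter_idem[OF f] by (auto intro!: bexI simp: idem_simp simp flip: mult.assoc)
  have "c \<in> \<eta>"
  proof -
    obtain e where "e \<in> \<xi>"
      using f by (auto simp: filters_iff)
    then have "c * (e * c) = e * c"
      using c filter_idem[OF f] by (metis id idem_commute idem_simp mult.assoc)
    with \<open>e \<in> \<xi>\<close> c show ?thesis
      by (auto simp: \<eta>_def)
  qed
  have "\<eta> \<notin> filters"
    using max[of \<eta>] \<open>\<xi> \<subseteq> \<eta>\<close> \<open>c \<in> \<eta>\<close> c by blast
  moreover have "\<eta> \<in> filters" if ne: "\<And>e. e \<in> \<xi> \<Longrightarrow> e * c \<noteq> 0"
    unfolding filters_iff
  proof (intro conjI ballI impI)
    show "\<eta> \<noteq> {}" "\<eta> \<subseteq> idems"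
      using \<open>c \<in> \<eta>\<close> by (auto simp: \<eta>_def)
    show "0 \<notin> \<eta>"
    proof
      assume "0 \<in> \<eta>"
      then obtain e where "e \<in> \<xi>" "0 * (e * c) = e * c"
        by (auto simp: \<eta>_def)
      with ne[of e] show False by simp
    qed
    show "g \<in> \<eta>" if "f \<in> \<eta>" "g \<in> idems" "g * f = f" for f g
      using that unfolding \<eta>_def by (auto simp: mult.assoc) (metis mult.assoc)
    show "a * b \<in> \<eta>" if mem: "a \<in> \<eta>" "b \<in> \<eta>" for a b
    proof -
      obtain e e' where e: "e \<in> \<xi>" "a * (e * c) = e * c" and e': "e' \<in> \<xi>" "b * (e' * c) = e' * c"
        and ab: "a \<in> idems" "b \<in> idems"
        using mem unfolding \<eta>_def by blast
      have i: "e \<in> idems" "e' \<in> idems"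
        using e e' filter_idem[OF f] by auto
      have "a * b * (e * e' * c) = a * (b * e) * (e' * c)"
        by (simp add: mult.assoc)
      also have "\<dots> = a * (e * (b * (e' * c)))"
        unfolding idem_commute[OF ab(2) i(1)] by (simp add: mult.assoc)
      also have "\<dots> = a * (e * c) * e'"
        unfolding e'(2) by (simp add: idem_commute[OF i(2) c(1)] mult.assoc)
      also have "\<dots> = e * (c * e')"
        unfolding e(2) by (simp add: mult.assoc)
      also have "\<dots> = e * e' * c"
        unfolding idem_commute[OF c(1) i(2)] by (simp add: mult.assoc)
      finally show ?thesis
        using filter_mult[OF f e(1) e'(1)] ab by (auto simp: \<eta>_def)
    qed
  qed
  ultimately show thesis
    using that by blast
qed

text \<open>A description of Z_s free of covers; by \<open>ZZ_eq_cover\<close> every finite cover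
  gives this set.\<close>

definition ZZ :: "'s::inverse_semigroup_0 \<Rightarrow> 's set set"
  where "ZZ s = {\<xi>\<in>tight_spectrum. \<exists>e\<in>\<xi>. e \<in> WW s}"

text \<open>Approximate \<xi> by an ultrafilter with the same members among \<open>e\<close> and the
  finitely many \<open>c\<close>. If it contained no \<open>c\<close>, it would contain an
  annihilator of each, and the product of these with \<open>e\<close> would be a nonzero weakly
  fixed idempotent orthogonal to the whole cover.\<close>

lemma ZZ_eq_cover:
  fixes s :: "'s::inverse_semigroup_0"
  assumes C: "finite C" "is_cover C (WW s)"
  shows "ZZ s = (\<Union>c\<in>C. DD c)"
proof
  show "(\<Union>c\<in>C. DD c) \<subseteq> ZZ s"
    using C by (auto simp: ZZ_def DD_def is_cover_def)
  show "ZZ s \<subseteq> (\<Union>c\<in>C. DD c)"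
  proof
    fix \<xi> assume "\<xi> \<in> ZZ s"
    then obtain e where \<xi>: "\<xi> \<in> tight_spectrum" and e: "e \<in> \<xi>" "e \<in> WW s"
      by (auto simp: ZZ_def)
    have Ci: "C \<subseteq> idems"
      using C by (auto simp: is_cover_def WW_def weakly_fixed_def)
    have "e \<in> idems"
      using e by (simp add: WW_def weakly_fixed_def)
    then obtain \<eta> where \<eta>: "\<eta> \<in> ultrafilters" "\<forall>c\<in>insert e C. c \<in> \<eta> \<longleftrightarrow> c \<in> \<xi>"
      using \<xi> C Ci unfolding tight_iff by (metis finite_insert insert_subset)
    have f: "\<eta> \<in> filters"
      using \<eta> by (simp add: ultrafilters_def)
    have "\<exists>c\<in>C. c \<in> \<eta>"
    proof (rule ccontr)
      assume none: "\<not> (\<exists>c\<in>C. c \<in> \<eta>)"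
      have "\<exists>g\<in>\<eta>. e * g = g \<and> (\<forall>c\<in>C. g * c = 0)"
        using C(1) none Ci
      proof (induction C)
        case empty
        then show ?case
          using \<eta>(2) e \<open>e \<in> idems\<close> by (auto intro!: bexI[of _ e] simp: idem_simp)
      next
        case (insert c C)
        then obtain g where g: "g \<in> \<eta>" "e * g = g" "\<forall>c\<in>C. g * c = 0"
          by auto
        obtain h where h: "h \<in> \<eta>" "h * c = 0"
          using ultrafilter_witness[OF \<eta>(1), of c] insert.prems by auto
        have "g * h * d = 0" if "d \<in> insert c C" for d
        proof (cases "d = c")
          case True
          then show ?thesis by (simp add: mult.assoc h)
        next
          case False
          then have "g * d = 0" using g that by auto
          moreover have "g * h * d = h * (g * d)"
            unfolding idem_commute[OF filter_idem[OF f g(1)] filter_idem[OF f h(1)]]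
            by (simp add: mult.assoc)
          ultimately show ?thesis by simp
        qed
        moreover have "e * (g * h) = g * h"
          using g by (simp flip: mult.assoc)
        ultimately show ?case
          using filter_mult[OF f g(1) h(1)] by blast
      qed
      then obtain g where g: "g \<in> \<eta>" "e * g = g" "\<forall>c\<in>C. g * c = 0"
        by blast
      have "g \<in> WW s"
        using weakly_fixed_down[of s e g] e g filter_idem[OF f] by (simp add: WW_def)
      moreover have "g \<noteq> 0"
        using g f by (auto simp: filters_iff)
      ultimately show False
        using C(2) g(3) by (auto simp: is_cover_def)
    qed
    then show "\<xi> \<in> (\<Union>c\<in>C. DD c)"
      using \<eta>(2) \<xi> by (auto simp: DD_def)
  qed
qed

lemma ZZ_subset: "ZZ s \<subseteq> DD (star s * s)"
proof
  fix \<xi> assume "\<xi> \<in> ZZ s"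
  then obtain e where \<xi>: "\<xi> \<in> tight_spectrum" and e: "e \<in> \<xi>" "weakly_fixed s e"
    by (auto simp: ZZ_def WW_def)
  then show "\<xi> \<in> DD (star s * s)"
    using filter_up[OF tight_filter, of \<xi> e "star s * s"] by (auto simp: DD_def weakly_fixed_iff)
qed

section \<open>Germs\<close>

abbreviation (input) tG :: "'s::inverse_semigroup_0 germ top_groupoid"
  where "tG \<equiv> tight_groupoid"

lemma equiv_germ_rel: "equiv (germ_dom :: ('s::inverse_semigroup_0 \<times> 's set) set) germ_rel"
proof (rule equivI)
  show "germ_rel \<subseteq> (germ_dom :: ('s \<times> 's set) set) \<times> germ_dom"
    by (auto simp: germ_rel_def)
  show "refl_on (germ_dom :: ('s \<times> 's set) set) germ_rel"
    by (rule refl_onI) (auto simp: germ_rel_def germ_dom_def dest: DD_filter(2))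
  show "sym (germ_rel :: (('s \<times> 's set) \<times> _) set)"
    by (rule symI) (auto simp: germ_rel_def, metis)
  show "trans (germ_rel :: (('s \<times> 's set) \<times> _) set)"
  proof (rule transI)
    fix x y z :: "'s \<times> 's set"
    assume "(x, y) \<in> germ_rel" "(y, z) \<in> germ_rel"
    then obtain s t r \<xi> e f where *: "x = (s, \<xi>)" "y = (t, \<xi>)" "z = (r, \<xi>)"
      "(s, \<xi>) \<in> germ_dom" "(r, \<xi>) \<in> germ_dom" "e \<in> \<xi>" "f \<in> \<xi>" "s * e = t * e" "t * f = r * f"
      by (auto simp: germ_rel_def)
    have \<xi>: "\<xi> \<in> filters"
      using *(4) DD_filter by (auto simp: germ_dom_def)
    have "s * (e * f) = t * f * e"
      using * filter_idem[OF \<xi>] by (metis idem_commute mult.assoc)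
    also have "\<dots> = r * (e * f)"
      using * filter_idem[OF \<xi>] by (metis idem_commute mult.assoc)
    finally show "(x, z) \<in> germ_rel"
      using * filter_mult[OF \<xi>] by (auto simp: germ_rel_def)
  qed
qed

lemma germ_eq_iff:
  fixes \<xi> :: "'s::inverse_semigroup_0 set"
  assumes "\<xi> \<in> DD (star s * s)" "\<eta> \<in> DD (star t * t)"
  shows "germ s \<xi> = germ t \<eta> \<longleftrightarrow> \<xi> = \<eta> \<and> (\<exists>e\<in>\<xi>. s * e = t * e)"
  unfolding germ_def
  by (subst eq_equiv_class_iff[OF equiv_germ_rel]) (use assms in \<open>auto simp: germ_rel_def germ_dom_def\<close>)

lemma mem_germ_iff:
  fixes \<xi> :: "'s::inverse_semigroup_0 set"
  assumes "\<xi> \<in> DD (star s * s)"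
  shows "(t, \<eta>) \<in> germ s \<xi> \<longleftrightarrow> \<eta> = \<xi> \<and> \<xi> \<in> DD (star t * t) \<and> (\<exists>e\<in>\<xi>. s * e = t * e)"
  using assms by (auto simp: germ_def germ_rel_def germ_dom_def)

lemma arrows_tG: "arrows tG = {germ s \<xi> |s \<xi>. \<xi> \<in> DD (star s * s)}"
  by (auto simp: tight_groupoid_def quotient_def germ_def germ_dom_def)

lemma DD_mono:
  fixes \<xi> :: "'s::inverse_semigroup_0 set"
  assumes "\<xi> \<in> DD e" "f \<in> idems" "f * e = e"
  shows "\<xi> \<in> DD f"
  using assms filter_up[OF DD_filter(1)[OF assms(1)] DD_filter(2)[OF assms(1)]] by (simp add: DD_def)

text \<open>The operations of \<open>tight_groupoid\<close> take \<open>the_elem\<close> over all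
  representatives; each evaluation becomes the choice of one representative plus
  well-definedness.\<close>

lemma the_elem_eqI: "x \<in> A \<Longrightarrow> (\<And>y. y \<in> A \<Longrightarrow> y = x) \<Longrightarrow> the_elem A = x"
  by (metis empty_iff insertI1 is_singletonI' is_singleton_the_elem singletonD)

lemma DD_idem:
  fixes \<xi> :: "'s::inverse_semigroup_0 set"
  assumes "\<xi> \<in> DD e"
  shows "\<xi> \<in> DD (star e * e)"
  using assms filter_idem[OF DD_filter(1)[OF assms] DD_filter(2)[OF assms]]
  by (simp add: star_idem idem_simp)

lemma unit_germ_eq:
  fixes \<xi> :: "'s::inverse_semigroup_0 set"
  assumes "\<xi> \<in> DD e"
  shows "unit_germ \<xi> = germ e \<xi>"
  unfolding unit_germ_def
proof (rule the_elem_eqI)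
  note \<xi> = DD_filter[OF assms]
  show "germ e \<xi> \<in> {germ e \<xi> |e. e \<in> \<xi>}"
    using \<xi> by blast
  fix \<gamma> assume "\<gamma> \<in> {germ e \<xi> |e. e \<in> \<xi>}"
  then obtain f where f: "f \<in> \<xi>" "\<gamma> = germ f \<xi>"
    by blast
  have "\<xi> \<in> DD f"
    using f assms by (simp add: DD_def)
  have "f * (e * f) = e * (e * f)"
    using filter_idem[OF \<xi>(1)] f \<xi>(2) by (metis idem_commute idem_simp mult.assoc)
  then show "\<gamma> = germ e \<xi>"
    unfolding f(2) germ_eq_iff[OF DD_idem[OF \<open>\<xi> \<in> DD f\<close>] DD_idem[OF assms]]
    using filter_mult[OF \<xi>(1) \<xi>(2) f(1)] by blast
qed

lemma unit_germ_inj: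
  fixes \<xi> \<eta> :: "'s::inverse_semigroup_0 set"
  assumes "\<xi> \<in> DD e" "\<eta> \<in> DD f" "unit_germ \<xi> = unit_germ \<eta>"
  shows "\<xi> = \<eta>"
  using assms germ_eq_iff[OF DD_idem[OF assms(1)] DD_idem[OF assms(2)]] by (simp add: unit_germ_eq)

lemma germ_self:
  fixes \<xi> :: "'s::inverse_semigroup_0 set"
  assumes "\<xi> \<in> DD (star s * s)"
  shows "(s, \<xi>) \<in> germ s \<xi>"
  using assms DD_filter[OF assms] by (auto simp: mem_germ_iff)

lemma src_germ:
  fixes \<xi> :: "'s::inverse_semigroup_0 set"
  assumes "\<xi> \<in> DD (star s * s)"
  shows "src tG (germ s \<xi>) = unit_germ \<xi>"
  using germ_self[OF assms] unfolding tight_groupoid_def top_groupoid.simps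
  by (intro the_elem_eqI) (use assms in \<open>auto simp: mem_germ_iff\<close>)

lemma src_germ_eq_iff:
  fixes \<xi> \<eta> :: "'s::inverse_semigroup_0 set"
  assumes "\<xi> \<in> DD (star s * s)" "\<eta> \<in> DD (star t * t)"
  shows "src tG (germ s \<xi>) = src tG (germ t \<eta>) \<longleftrightarrow> \<xi> = \<eta>"
  using assms unit_germ_inj[OF assms] by (auto simp: src_germ)

section \<open>Inverses and quotients of germs\<close>

lemma theta_DD_star:
  fixes \<xi> :: "'s::inverse_semigroup_0 set"
  assumes "\<xi> \<in> DD (star s * s)"
  shows "theta s \<xi> \<in> DD (star (star s) * star s)"
  using theta_DD[OF assms] by simp

lemma conj_in_theta:
  fixes \<xi> :: "'s::inverse_semigroup_0 set"
  assumes "\<xi> \<in> DD (star s * s)" "e \<in> \<xi>"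
  shows "s * e * star s \<in> theta s \<xi>"
proof -
  note \<xi> = DD_filter[OF assms(1)]
  have "e \<in> idems"
    using \<xi>(1) assms(2) by (rule filter_idem)
  then show ?thesis
    using filter_mult[OF \<xi> assms(2)] by (simp add: mem_theta[OF \<xi>] star_conj_conj)
qed

lemma ginv_germ:
  fixes \<xi> :: "'s::inverse_semigroup_0 set"
  assumes "\<xi> \<in> DD (star s * s)"
  shows "ginv tG (germ s \<xi>) = germ (star s) (theta s \<xi>)"
  unfolding tight_groupoid_def top_groupoid.simps
proof (rule the_elem_eqI)
  note \<xi> = DD_filter[OF assms]
  show "germ (star s) (theta s \<xi>) \<in> {germ (star s') (theta s' \<xi>') |s' \<xi>'. (s', \<xi>') \<in> germ s \<xi>}"
    using germ_self[OF assms] by blast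
  fix \<gamma> assume "\<gamma> \<in> {germ (star s') (theta s' \<xi>') |s' \<xi>'. (s', \<xi>') \<in> germ s \<xi>}"
  then obtain t e where t: "\<xi> \<in> DD (star t * t)" "e \<in> \<xi>" "s * e = t * e"
    and \<gamma>: "\<gamma> = germ (star t) (theta t \<xi>)"
    using assms by (auto simp: mem_germ_iff)
  have \<theta>: "theta t \<xi> = theta s \<xi>"
    using t \<xi> DD_filter[OF t(1)] by (intro theta_cong[symmetric]) auto
  have e: "e \<in> idems"
    using t \<xi> by (simp add: filter_idem)
  have eq: "e * star s = e * star t"
    using arg_cong[OF t(3), of star] e by (simp add: star_mult star_idem)
  have c: "s * e * star s = t * e * star t"
    using eq t(3) by (metis mult.assoc e idem_simp)
  \<comment> \<open>The conjugate of \<open>e\<close>, common to \<open>s\<close> and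
    \<open>t\<close>, is the idempotent on which their inverses agree: both sides reduce to
    \<open>e * star s = e * star t\<close>.\<close>
  have "star t * (s * e * star s) = star s * (s * e * star s)"
  proof -
    have "star r * (r * e * star r) = e * star r" for r
      using conj_push[OF e, of r] e idem_commute[OF star_mult_idem(1)[of r] e]
      by (metis mult.assoc star_props(2))
    then show ?thesis
      using eq c by metis
  qed
  then show "\<gamma> = germ (star s) (theta s \<xi>)"
    unfolding \<gamma> \<theta>
    using theta_DD_star[OF assms] theta_DD_star[OF t(1)] conj_in_theta[OF assms t(2)]
    by (subst germ_eq_iff) (auto simp: \<theta>)
qed

lemma theta_DD_mult_star:
  fixes \<xi> :: "'s::inverse_semigroup_0 set"
  assumes \<xi>: "\<xi> \<in> DD (star s * s)" "\<xi> \<in> DD (star t * t)"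
  shows "theta t \<xi> \<in> DD (star (s * star t) * (s * star t))"
proof -
  note f = DD_filter[OF \<xi>(2)]
  have "star t * (t * (star s * s) * star t) * t = star t * t * (star s * s)"
    by (rule star_conj_conj) simp
  then have "t * (star s * s) * star t \<in> theta t \<xi>"
    using filter_mult[OF f DD_filter(2)[OF \<xi>(1)]] by (simp add: mem_theta[OF f])
  then show ?thesis
    using theta_DD[OF \<xi>(2)] by (simp add: DD_def star_mult mult.assoc)
qed

text \<open>Matrix entries of \<open>reg_rep\<close> involve only quotients \<gamma>\<beta>^{-1} of
  arrows with a common source, so well-definedness of \<open>gmul\<close> is established just for
  these.\<close>

lemma gmul_ginv_germ:
  fixes \<xi> :: "'s::inverse_semigroup_0 set"
  assumes s: "\<xi> \<in> DD (star s * s)" and t: "\<xi> \<in> DD (star t * t)"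
  shows "gmul tG (germ s \<xi>) (ginv tG (germ t \<xi>)) = germ (s * star t) (theta t \<xi>)"
  unfolding ginv_germ[OF t] unfolding tight_groupoid_def top_groupoid.simps
proof (rule the_elem_eqI)
  let ?\<eta> = "theta t \<xi>"
  let ?A = "{germ (s' * u) \<zeta> |s' u \<zeta>. (s', theta u \<zeta>) \<in> germ s \<xi> \<and> (u, \<zeta>) \<in> germ (star t) ?\<eta>}"
  note t' = theta_DD_star[OF t]
  have "theta (star t) ?\<eta> = \<xi>"
    using DD_filter[OF t] by (rule theta_star_theta)
  then have "(s, theta (star t) ?\<eta>) \<in> germ s \<xi>" "(star t, ?\<eta>) \<in> germ (star t) ?\<eta>"
    using germ_self[OF s] germ_self[OF t'] by simp_all
  then show "germ (s * star t) ?\<eta> \<in> ?A"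
    by blast
  fix \<gamma> assume "\<gamma> \<in> ?A"
  then obtain s' u e f where *: "\<gamma> = germ (s' * u) ?\<eta>" "\<xi> = theta u ?\<eta>" "\<xi> \<in> DD (star s' * s')"
    "e \<in> \<xi>" "s * e = s' * e" "?\<eta> \<in> DD (star u * u)" "f \<in> ?\<eta>" "star t * f = u * f"
    using s t' by (auto simp: mem_germ_iff)
  note \<eta> = DD_filter[OF *(6)] and \<xi> = DD_filter[OF s]
  have e: "e \<in> idems" and f: "f \<in> idems"
    using * \<eta> \<xi> filter_idem by blast+
  \<comment> \<open>\<open>e\<close> witnesses the change of the left representative, on the range
    side of \<open>u\<close>. Conjugation moves it to the source side, where
    \<open>u * g = e * u\<close> lets it pass through \<open>u\<close>.\<close>
  define g where "g = star u * e * u"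
  have g: "g \<in> ?\<eta>" "g \<in> idems"
    using *(2,4) mem_theta[OF \<eta> e] e by (simp_all add: g_def)
  have ug: "u * g = e * (u * g)"
  proof -
    have "u * g = u * star u * e * u"
      by (simp add: g_def mult.assoc)
    also have "\<dots> = e * (u * star u) * u"
      by (simp add: idem_commute[OF star_mult_idem(2) e])
    finally have "u * g = e * u"
      by (metis mult.assoc star_props(1))
    then show ?thesis
      using e by (metis mult.assoc idem_simp)
  qed
  have "s * star t * (f * g) = s * (u * g) * f"
    using *(8) f g by (metis idem_commute mult.assoc)
  also have "\<dots> = s' * (u * g) * f"
    using ug *(5) by (metis mult.assoc)
  also have "\<dots> = s' * u * (f * g)"
    using f g by (metis idem_commute mult.assoc)
  finally have eq: "s' * u * (f * g) = s * star t * (f * g)" ..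
  have dom: "?\<eta> \<in> DD (star (s' * u) * (s' * u))"
  proof -
    have "theta (star u) \<xi> = ?\<eta>"
      using *(2) theta_star_theta[OF \<eta>] by simp
    moreover have "\<xi> \<in> DD (star (star u) * star u)"
      using theta_DD_star[OF *(6)] *(2) by simp
    ultimately show ?thesis
      using theta_DD_mult_star[OF *(3), of "star u"] by simp
  qed
  show "\<gamma> = germ (s * star t) ?\<eta>"
    unfolding *(1) using dom theta_DD_mult_star[OF s t] eq filter_mult[OF \<eta>(1) *(7) g(1)]
    by (subst germ_eq_iff) auto
qed

text \<open>If \<open>e \<in> \<xi>\<close> is weakly fixed by \<open>s\<close>, the restriction
  \<open>s * e\<close> has domain \<open>e\<close>, lies in \<open>S_Iso\<close> and represents the
  same germ. Conversely, a representative \<open>r\<close> in \<open>S_Iso\<close> weakly fixes its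
  whole domain, and this passes to a smaller idempotent on which \<open>r\<close> and
  \<open>s\<close> agree.\<close>

lemma germ_mem_iso_arrows_iff:
  fixes \<xi> :: "'s::inverse_semigroup_0 set"
  assumes \<xi>: "\<xi> \<in> DD (star s * s)"
  shows "germ s \<xi> \<in> iso_arrows \<longleftrightarrow> \<xi> \<in> ZZ s"
proof
  assume "germ s \<xi> \<in> iso_arrows"
  then obtain r \<eta> where "r \<in> S_Iso" "\<eta> \<in> DD (star r * r)" "germ s \<xi> = germ r \<eta>"
    by (auto simp: iso_arrows_def)
  then obtain e where r: "r \<in> S_Iso" "\<xi> \<in> DD (star r * r)" "e \<in> \<xi>" "s * e = r * e"
    using germ_eq_iff[OF \<xi>] by blast
  note f = DD_filter[OF r(2)]
  have e: "e \<in> idems"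
    using r f by (simp add: filter_idem)
  have "weakly_fixed r (star r * r * e)"
    by (rule weakly_fixed_down[of r "star r * r"])
       (use r(1) e in \<open>simp_all add: S_Iso_def star_props flip: mult.assoc\<close>)
  moreover have "r * (star r * r * e) = s * (star r * r * e)"
    using r(4) e by (metis idem_commute mult.assoc star_mult_idem(1))
  ultimately have "weakly_fixed s (star r * r * e)"
    by (rule weakly_fixed_cong)
  then show "\<xi> \<in> ZZ s"
    using filter_mult[OF f r(3)] \<xi> by (auto simp: ZZ_def WW_def DD_def)
next
  assume "\<xi> \<in> ZZ s"
  then obtain e where e: "e \<in> \<xi>" "weakly_fixed s e"
    by (auto simp: ZZ_def WW_def)
  then have ei: "e \<in> idems" "star s * s * e = e"
    by (simp_all add: weakly_fixed_iff)
  have d: "star (s * e) * (s * e) = e"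
    using ei by (simp add: star_mult star_idem idem_simp mult.assoc)
  have "weakly_fixed (s * e) e"
    by (rule weakly_fixed_cong[OF e(2)]) (simp add: ei mult.assoc idem_simp)
  then have "s * e \<in> S_Iso"
    by (simp add: S_Iso_def d)
  moreover have dom: "\<xi> \<in> DD (star (s * e) * (s * e))"
    unfolding d using \<xi> e by (simp add: DD_def)
  moreover have "germ s \<xi> = germ (s * e) \<xi>"
    using e(1) ei by (subst germ_eq_iff[OF \<xi> dom]) (auto simp: mult.assoc idem_simp intro!: bexI[of _ e])
  ultimately show "germ s \<xi> \<in> iso_arrows"
    unfolding iso_arrows_def by blast
qed

text \<open>Conjugation by \<open>t\<close> matches nonzero idempotents \<open>h\<close> on its
  source side with \<open>g = t * h * star t\<close> on its range side, and
  \<open>s * star t\<close> conjugates \<open>g\<close> to \<open>s * h * star s\<close>. Weak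
  fixing by the quotient thus becomes \<open>agree_on\<close>.\<close>

lemma gmul_ginv_iso_iff:
  fixes \<xi> :: "'s::inverse_semigroup_0 set"
  assumes s: "\<xi> \<in> DD (star s * s)" and t: "\<xi> \<in> DD (star t * t)"
  shows "gmul tG (germ s \<xi>) (ginv tG (germ t \<xi>)) \<in> iso_arrows \<longleftrightarrow> (\<exists>f\<in>\<xi>. agree_on s t f)"
  unfolding gmul_ginv_germ[OF s t] germ_mem_iso_arrows_iff[OF theta_DD_mult_star[OF s t]]
proof
  note fs = DD_filter[OF s] and ft = DD_filter[OF t]
  {
    assume "theta t \<xi> \<in> ZZ (s * star t)"
    then obtain e where e: "e \<in> theta t \<xi>" "weakly_fixed (s * star t) e"
      by (auto simp: ZZ_def WW_def)
    then have ei: "e \<in> idems"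
      by (simp add: weakly_fixed_iff)
    define f where "f = star t * e * t"
    have "f \<in> \<xi>"
      using e(1) mem_theta[OF ft ei] by (simp add: f_def)
    moreover have "agree_on s t f"
      unfolding agree_on_def
    proof (intro ballI impI)
      fix h assume h: "h \<in> idems" "h \<noteq> 0 \<and> f * h = h"
      define g where "g = t * h * star t"
      have tth: "star t * t * h = h"
        using h unfolding f_def by (metis mult.assoc star_props(2))
      have gh: "star t * g * t = h"
        using star_conj_conj[OF h(1), of t] by (simp add: g_def tth)
      have "e * g = g"
      proof -
        have "t * (f * h) * star t = g"
          using h by (simp add: g_def)
        then have "g = t * f * star t * g"
          using h by (simp add: g_def conj_mult)
        also have "\<dots> = e * (t * star t * g)"
          unfolding f_def conj_star_conj[OF ei] idem_commute[OF star_mult_idem(2) ei]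
          by (simp add: mult.assoc)
        also have "t * star t * g = g"
          unfolding g_def by (metis mult.assoc star_props(1))
        finally show ?thesis by simp
      qed
      moreover have "g \<in> idems" "g \<noteq> 0"
        using h gh by (auto simp: g_def)
      ultimately have "s * star t * g * star (s * star t) * g \<noteq> 0"
        using e(2) by (simp add: weakly_fixed_iff)
      moreover have "s * star t * g * star (s * star t) = s * (star t * g * t) * star s"
        by (simp add: star_mult mult.assoc)
      ultimately show "s * h * star s * (t * h * star t) \<noteq> 0"
        unfolding gh by (simp add: g_def)
    qed
    ultimately show "\<exists>f\<in>\<xi>. agree_on s t f"
      by blast
  next
    assume "\<exists>f\<in>\<xi>. agree_on s t f"
    then obtain f where f: "f \<in> \<xi>" "agree_on s t f"
      by blast
    have fi: "f \<in> idems"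
      using f fs by (simp add: filter_idem)
    \<comment> \<open>\<open>f\<close> is cut down to the domain of \<open>s\<close>, because
      \<open>weakly_fixed\<close> also asks that \<open>e\<close> lie below the domain of
      \<open>s * star t\<close>.\<close>
    define k where "k = f * (star s * s)"
    have k: "k \<in> \<xi>" "k \<in> idems"
      using filter_mult[OF fs(1) f(1) fs(2)] fi by (simp_all add: k_def)
    define e where "e = t * k * star t"
    have ei: "e \<in> idems"
      using k by (simp add: e_def)
    have "weakly_fixed (s * star t) e"
      unfolding weakly_fixed_iff
    proof (intro conjI ballI impI)
      have "star (s * star t) * (s * star t) * e = t * (star s * s) * star t * (t * k * star t)"
        by (simp add: e_def star_mult mult.assoc)
      also have "\<dots> = t * (star s * s * k) * star t"
        using k by (simp add: conj_mult)
      also have "star s * s * k = k"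
        unfolding k_def using fi by (metis idem_commute idem_simp mult.assoc star_mult_idem(1))
      finally show "star (s * star t) * (s * star t) * e = e"
        by (simp add: e_def)
      fix g assume g: "g \<in> idems" "g \<noteq> 0 \<and> e * g = g"
      define h where "h = star t * g * t"
      have ttg: "t * star t * g = g"
        using g unfolding e_def by (metis mult.assoc star_props(1))
      have gh: "t * h * star t = g"
        unfolding h_def conj_star_conj[OF g(1)] by (rule ttg)
      have h: "h \<in> idems" "h \<noteq> 0"
        using g gh by (auto simp: h_def)
      have "h = star t * (e * g) * t"
        using g by (simp add: h_def)
      also have "\<dots> = star t * e * t * h"
        using g by (simp add: h_def star_conj_mult)
      also have "star t * e * t = k * (star t * t)"
        unfolding e_def star_conj_conj[OF k(2)] by (rule idem_commute[OF star_mult_idem(1) k(2)])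
      also have "k * (star t * t) * h = k * h"
        unfolding h_def by (metis mult.assoc star_props(2))
      finally have "k * h = h" ..
      then have "f * h = h"
        unfolding k_def using fi by (metis idem_simp mult.assoc)
      then have "s * h * star s * (t * h * star t) \<noteq> 0"
        using f(2) h by (simp add: agree_on_def)
      then show "s * star t * g * star (s * star t) * g \<noteq> 0"
        unfolding gh by (simp add: h_def star_mult mult.assoc)
    qed (rule ei)
    moreover have "e \<in> theta t \<xi>"
      unfolding e_def by (rule conj_in_theta[OF t k(1)])
    ultimately show "theta t \<xi> \<in> ZZ (s * star t)"
      using theta_DD[OF t] by (auto simp: ZZ_def WW_def DD_def)
  }
qed

text \<open>The relation has to live on the whole ambient type, where \<open>pinch\<close> operates;
  the equality clause makes everything that is not an arrow a singleton class. Between arrows it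
  adds nothing, as the quotient of an arrow by itself is in H
  (\<open>gmul_ginv_self_iso\<close>).\<close>

definition iso_rel :: "('s::inverse_semigroup_0 germ \<times> 's germ) set"
  where "iso_rel = {(\<gamma>, \<beta>). \<gamma> = \<beta> \<or> \<gamma> \<in> arrows tG \<and> \<beta> \<in> arrows tG \<and> src tG \<gamma> = src tG \<beta> \<and>
    gmul tG \<gamma> (ginv tG \<beta>) \<in> iso_arrows}"

lemma arrow_cases:
  assumes "\<gamma> \<in> arrows tG"
  obtains s \<xi> where "\<gamma> = germ s \<xi>" "\<xi> \<in> DD (star s * s)"
  using assms by (auto simp: arrows_tG)

lemma arrow_cases_src:
  assumes "\<beta> \<in> arrows tG" "src tG (germ s \<xi>) = src tG \<beta>" "\<xi> \<in> DD (star s * s)"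
  obtains t where "\<beta> = germ t \<xi>" "\<xi> \<in> DD (star t * t)"
  using assms src_germ_eq_iff by (metis arrow_cases)

text \<open>Arrows with a common source have representatives over one filter, where the relation
  says that \<open>agree_on\<close> holds for some member. In transitivity the two members are
  replaced by their product.\<close>

lemma equiv_iso_rel: "equiv UNIV (iso_rel :: ('s::inverse_semigroup_0 germ \<times> 's germ) set)"
proof (rule equivI)
  show "refl (iso_rel :: ('s germ \<times> 's germ) set)"
    by (rule refl_onI) (auto simp: iso_rel_def)
  show "sym (iso_rel :: ('s germ \<times> 's germ) set)"
  proof (rule symI)
    fix \<gamma> \<beta> :: "'s germ" assume *: "(\<gamma>, \<beta>) \<in> iso_rel"
    show "(\<beta>, \<gamma>) \<in> iso_rel"
    proof (cases "\<gamma> = \<beta>")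
      case False
      with * have \<gamma>\<beta>: "\<gamma> \<in> arrows tG" "\<beta> \<in> arrows tG" "src tG \<gamma> = src tG \<beta>"
        "gmul tG \<gamma> (ginv tG \<beta>) \<in> iso_arrows"
        by (auto simp: iso_rel_def)
      then obtain s \<xi> where s: "\<gamma> = germ s \<xi>" "\<xi> \<in> DD (star s * s)"
        by (metis arrow_cases)
      obtain t where t: "\<beta> = germ t \<xi>" "\<xi> \<in> DD (star t * t)"
        using \<gamma>\<beta>(2,3) s by (metis arrow_cases_src)
      show ?thesis
        using \<gamma>\<beta> agree_on_sym unfolding iso_rel_def s(1) t(1) gmul_ginv_iso_iff[OF s(2) t(2)]
          gmul_ginv_iso_iff[OF t(2) s(2)] mem_Collect_eq prod.case
        by metis
    qed (simp add: iso_rel_def)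
  qed
  show "trans (iso_rel :: ('s germ \<times> 's germ) set)"
  proof (rule transI)
    fix \<gamma> \<beta> \<delta> :: "'s germ" assume *: "(\<gamma>, \<beta>) \<in> iso_rel" "(\<beta>, \<delta>) \<in> iso_rel"
    show "(\<gamma>, \<delta>) \<in> iso_rel"
    proof (cases "\<gamma> = \<beta> \<or> \<beta> = \<delta>")
      case False
      with * have \<gamma>\<beta>: "\<gamma> \<in> arrows tG" "\<beta> \<in> arrows tG" "src tG \<gamma> = src tG \<beta>"
          "gmul tG \<gamma> (ginv tG \<beta>) \<in> iso_arrows"
        and \<beta>\<delta>: "\<delta> \<in> arrows tG" "src tG \<beta> = src tG \<delta>" "gmul tG \<beta> (ginv tG \<delta>) \<in> iso_arrows"
        by (auto simp: iso_rel_def)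
      then obtain s \<xi> where s: "\<gamma> = germ s \<xi>" "\<xi> \<in> DD (star s * s)"
        by (metis arrow_cases)
      obtain t where t: "\<beta> = germ t \<xi>" "\<xi> \<in> DD (star t * t)"
        using \<gamma>\<beta>(2,3) s by (metis arrow_cases_src)
      obtain r where r: "\<delta> = germ r \<xi>" "\<xi> \<in> DD (star r * r)"
        using \<beta>\<delta>(1,2) t by (metis arrow_cases_src)
      obtain f g where f: "f \<in> \<xi>" "agree_on s t f" and g: "g \<in> \<xi>" "agree_on t r g"
        using \<gamma>\<beta>(4) \<beta>\<delta>(3) unfolding s(1) t(1) r(1) gmul_ginv_iso_iff[OF s(2) t(2)]
          gmul_ginv_iso_iff[OF t(2) r(2)] by blast
      note \<xi> = DD_filter(1)[OF s(2)]
      have i: "f \<in> idems" "g \<in> idems"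
        using f g \<xi> by (simp_all add: filter_idem)
      have "agree_on s r (f * g)"
      proof (rule agree_on_trans)
        show "agree_on s t (f * g)"
          using f(2) by (rule agree_on_down) (simp add: i idem_simp flip: mult.assoc)
        show "agree_on t r (f * g)"
          using g(2) by (rule agree_on_down) (metis i idem_commute idem_simp mult.assoc)
      qed
      then have "gmul tG \<gamma> (ginv tG \<delta>) \<in> iso_arrows"
        unfolding s(1) r(1) gmul_ginv_iso_iff[OF s(2) r(2)] using filter_mult[OF \<xi> f(1) g(1)] by blast
      then show ?thesis
        using \<gamma>\<beta> \<beta>\<delta> by (simp add: iso_rel_def)
    qed (use * in auto)
  qed
qed simp

lemma gmul_ginv_self_iso:
  assumes "\<gamma> \<in> arrows tG"
  shows "gmul tG \<gamma> (ginv tG \<gamma>) \<in> iso_arrows"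
proof -
  obtain s \<xi> where s: "\<gamma> = germ s \<xi>" "\<xi> \<in> DD (star s * s)"
    using assms by (rule arrow_cases)
  have "agree_on s s (star s * s)"
    by (rule agree_on_self) (simp_all add: idem_simp)
  then show ?thesis
    unfolding s(1) gmul_ginv_iso_iff[OF s(2) s(2)] using DD_filter[OF s(2)] by blast
qed

lemma iso_rel_iff:
  assumes "\<gamma> \<in> arrows tG" "\<beta> \<in> arrows tG" "src tG \<gamma> = src tG \<beta>"
  shows "(\<gamma>, \<beta>) \<in> iso_rel \<longleftrightarrow> gmul tG \<gamma> (ginv tG \<beta>) \<in> iso_arrows"
  using assms gmul_ginv_self_iso by (auto simp: iso_rel_def)

section \<open>The regular representation\<close>

definition conv_kernel :: "'g top_groupoid \<Rightarrow> ('g \<Rightarrow> complex) \<Rightarrow> 'g \<Rightarrow> 'g \<Rightarrow> complex"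
  where "conv_kernel G f \<gamma> \<beta> =
    (if \<gamma> \<in> arrows G \<and> \<beta> \<in> arrows G \<and> src G \<gamma> = src G \<beta> then f (gmul G \<gamma> (ginv G \<beta>)) else 0)"

lemma reg_rep_eq_kernel_op: "reg_rep G f = kernel_op (conv_kernel G f)"
proof -
  have "(if \<gamma> \<in> arrows G
      then \<Sum>\<^sub>\<infinity>\<beta>\<in>{\<beta>\<in>arrows G. src G \<beta> = src G \<gamma>}. f (gmul G \<gamma> (ginv G \<beta>)) * Rep_ell2 v \<beta> else 0)
      = (\<Sum>\<^sub>\<infinity>\<beta>. conv_kernel G f \<gamma> \<beta> * Rep_ell2 v \<beta>)" for v \<gamma>
  proof (cases "\<gamma> \<in> arrows G")
    case True
    then show ?thesis
      by (simp add: conv_kernel_def) (rule infsum_cong_neutral, auto)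
  qed (simp add: conv_kernel_def)
  then show ?thesis
    by (simp add: reg_rep_def kernel_op_def)
qed

text \<open>If the quotient of \<gamma> by \<beta> is a germ of \<open>s\<close>, then \<gamma> is
  \<beta> multiplied on the left by \<open>s\<close>, and \<beta> is \<gamma> multiplied by
  \<open>star s\<close>. So each \<open>s \<in> I\<close> allows at most one nonzero entry per row
  and per column, and \<open>card I\<close> bounds their number.\<close>

lemma finite_conv_kernel:
  fixes f :: "'s::inverse_semigroup_0 germ \<Rightarrow> complex"
  assumes I: "finite I"
    and f: "\<And>\<gamma>. f \<gamma> \<noteq> 0 \<Longrightarrow> \<exists>s\<in>I. \<gamma> \<in> Theta s (DD (star s * s))"
    and M: "\<And>\<gamma>. cmod (f \<gamma>) \<le> M"
  shows "finite_kernel (conv_kernel tG f)"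
proof -
  have "0 \<le> M"
    using M order.trans norm_ge_zero by blast
  have key: "\<exists>s\<in>I. \<gamma> = germ (s * t) \<xi> \<and> germ t \<xi> = germ (star s * r) \<xi>"
    if asm: "conv_kernel tG f \<gamma> (germ t \<xi>) \<noteq> 0" "\<xi> \<in> DD (star t * t)" "\<gamma> = germ r \<xi>" "\<xi> \<in> DD (star r * r)"
    for \<gamma> r t \<xi>
  proof -
    have "f (gmul tG \<gamma> (ginv tG (germ t \<xi>))) \<noteq> 0"
      using asm(1) by (auto simp: conv_kernel_def split: if_splits)
    then have "f (germ (r * star t) (theta t \<xi>)) \<noteq> 0"
      by (simp add: asm(3) gmul_ginv_germ[OF asm(4,2)])
    then obtain s \<eta> where s: "s \<in> I" "\<eta> \<in> DD (star s * s)"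
      "germ (r * star t) (theta t \<xi>) = germ s \<eta>"
      using f by (fastforce simp: Theta_def)
    then obtain e where s': "theta t \<xi> \<in> DD (star s * s)" "e \<in> theta t \<xi>" "r * star t * e = s * e"
      using germ_eq_iff[OF theta_DD_mult_star[OF asm(4,2)] s(2)] by auto
    note t = DD_filter[OF asm(2)] and \<theta> = DD_filter[OF s'(1)]
    have e: "e \<in> idems"
      using \<theta> s' by (simp add: filter_idem)
    \<comment> \<open>The witness of the germ equality, cut down to the domain of \<open>s\<close>
      and pulled back along \<open>t\<close> to the source filter. On \<open>g\<close>, the element
      \<open>r\<close> agrees with \<open>s * t\<close>, and \<open>t\<close> agrees with
      \<open>star s * r\<close>.\<close>
    define g where "g = star t * (star s * s * e) * t"
    have "star s * s * e \<in> theta t \<xi>"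
      using \<theta> s'(2) by (simp add: filter_mult)
    then have "g \<in> \<xi>"
      using e by (simp add: g_def flip: mem_theta[OF t])
    have i: "star s * s * e \<in> idems"
      using e by simp
    have tg: "t * g = star s * s * e * t"
    proof -
      have "t * g = t * star t * (star s * s * e) * t"
        by (simp add: g_def mult.assoc)
      also have "\<dots> = star s * s * e * (t * star t * t)"
        unfolding idem_commute[OF star_mult_idem(2) i] by (simp add: mult.assoc)
      finally show ?thesis
        by (simp add: star_props)
    qed
    have ei: "star s * s * e = e * (star s * s)"
      using e by (simp add: idem_commute)
    have rg: "r * g = s * e * t"
    proof -
      have "r * g = r * star t * e * (star s * s) * t"
        unfolding g_def ei by (simp add: mult.assoc)
      also have "\<dots> = s * (star s * s * e) * t"
        unfolding s'(3) ei by (simp add: mult.assoc)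
      also have "\<dots> = s * e * t"
        by (metis mult.assoc star_props(1))
      finally show ?thesis .
    qed
    have stg: "s * t * g = s * e * t"
      using tg by (metis mult.assoc star_props(1))
    have srg: "star s * r * g = t * g"
      unfolding tg using rg by (metis mult.assoc)
    have d1: "\<xi> \<in> DD (star (s * t) * (s * t))"
    proof -
      have "theta (star t) (theta t \<xi>) \<in> DD (star (s * star (star t)) * (s * star (star t)))"
        using s'(1) theta_DD_star[OF asm(2)] by (rule theta_DD_mult_star)
      then show ?thesis
        by (simp add: theta_star_theta[OF t])
    qed
    have d2: "\<xi> \<in> DD (star (star s * r) * (star s * r))"
    proof -
      have "g = star (star s * r) * (star s * r) * g"
      proof -
        have gi: "g \<in> idems"
          unfolding g_def by (rule star_conj_idem) (rule i)
        have tt: "star t * t * g = g"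
          unfolding g_def by (metis mult.assoc star_props(2))
        have "g * (star (star s * r) * (star s * r)) * g = star (star s * r * g) * (star s * r * g)"
          using gi by (simp add: star_mult star_idem mult.assoc)
        also have "\<dots> = g"
          unfolding srg using gi tt by (simp add: star_mult star_idem mult.assoc idem_simp)
        finally have "g * (star (star s * r) * (star s * r)) * g = g" .
        then show ?thesis
          using gi by (metis idem_commute idem_simp mult.assoc star_mult_idem(1))
      qed
      then show ?thesis
        using DD_mono[of \<xi> g "star (star s * r) * (star s * r)"] \<open>g \<in> \<xi>\<close> asm(2)
        by (simp add: DD_def)
    qed
    have "\<gamma> = germ (s * t) \<xi>"
      unfolding asm(3) germ_eq_iff[OF asm(4) d1] using \<open>g \<in> \<xi>\<close> rg stg by (auto intro!: bexI[of _ g])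
    moreover have "germ t \<xi> = germ (star s * r) \<xi>"
      unfolding germ_eq_iff[OF asm(2) d2] using \<open>g \<in> \<xi>\<close> srg by (auto intro!: bexI[of _ g])
    ultimately show ?thesis
      using s(1) by blast
  qed
  have row: "finite {\<beta>. conv_kernel tG f \<gamma> \<beta> \<noteq> 0} \<and> card {\<beta>. conv_kernel tG f \<gamma> \<beta> \<noteq> 0} \<le> card I" for \<gamma>
  proof (cases "\<gamma> \<in> arrows tG")
    case True
    then obtain r \<xi> where r: "\<gamma> = germ r \<xi>" "\<xi> \<in> DD (star r * r)"
      by (rule arrow_cases)
    have "{\<beta>. conv_kernel tG f \<gamma> \<beta> \<noteq> 0} \<subseteq> (\<lambda>s. germ (star s * r) \<xi>) ` I"
    proof
      fix \<beta> assume \<beta>: "\<beta> \<in> {\<beta>. conv_kernel tG f \<gamma> \<beta> \<noteq> 0}"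
      then have "\<beta> \<in> arrows tG" "src tG (germ r \<xi>) = src tG \<beta>"
        by (auto simp: conv_kernel_def r(1) split: if_splits)
      then obtain t where "\<beta> = germ t \<xi>" "\<xi> \<in> DD (star t * t)"
        using r(2) by (rule arrow_cases_src)
      then show "\<beta> \<in> (\<lambda>s. germ (star s * r) \<xi>) ` I"
        using key[OF _ _ r] \<beta> by blast
    qed
    then show ?thesis
      using I by (meson card_image_le card_mono finite_imageI finite_subset order.trans)
  qed (simp add: conv_kernel_def)
  have col: "finite {\<gamma>. conv_kernel tG f \<gamma> \<beta> \<noteq> 0} \<and> card {\<gamma>. conv_kernel tG f \<gamma> \<beta> \<noteq> 0} \<le> card I" for \<beta>
  proof (cases "\<beta> \<in> arrows tG")
    case True
    then obtain t \<xi> where t: "\<beta> = germ t \<xi>" "\<xi> \<in> DD (star t * t)"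
      by (rule arrow_cases)
    have "{\<gamma>. conv_kernel tG f \<gamma> \<beta> \<noteq> 0} \<subseteq> (\<lambda>s. germ (s * t) \<xi>) ` I"
    proof
      fix \<gamma> assume \<gamma>: "\<gamma> \<in> {\<gamma>. conv_kernel tG f \<gamma> \<beta> \<noteq> 0}"
      then have "\<gamma> \<in> arrows tG" "src tG (germ t \<xi>) = src tG \<gamma>"
        by (auto simp: conv_kernel_def t(1) split: if_splits)
      then obtain r where "\<gamma> = germ r \<xi>" "\<xi> \<in> DD (star r * r)"
        using t(2) by (rule arrow_cases_src)
      then show "\<gamma> \<in> (\<lambda>s. germ (s * t) \<xi>) ` I"
        using key[OF _ t(2)] \<gamma> t(1) by blast
    qed
    then show ?thesis
      using I by (meson card_image_le card_mono finite_imageI finite_subset order.trans)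
  qed (simp add: conv_kernel_def)
  show ?thesis
    unfolding finite_kernel_def
  proof (intro exI[of _ "card I"] exI[of _ M] conjI allI)
    show "cmod (conv_kernel tG f \<gamma> \<beta>) \<le> M" for \<gamma> \<beta>
      using M \<open>0 \<le> M\<close> by (simp add: conv_kernel_def)
  qed (use row col in blast)+
qed

lemma pinch_reg_rep:
  assumes "finite_kernel (conv_kernel tG f)"
  shows "pinch iso_rel (reg_rep tG f) = reg_rep tG (\<lambda>\<gamma>. if \<gamma> \<in> iso_arrows then f \<gamma> else 0)"
proof -
  have "(\<lambda>\<gamma> \<beta>. if (\<gamma>, \<beta>) \<in> iso_rel then conv_kernel tG f \<gamma> \<beta> else 0)
      = conv_kernel tG (\<lambda>\<gamma>. if \<gamma> \<in> iso_arrows then f \<gamma> else 0)"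
    by (auto simp: conv_kernel_def iso_rel_iff fun_eq_iff)
  then show ?thesis
    by (simp add: reg_rep_eq_kernel_op pinch_kernel_op[OF equiv_iso_rel assms])
qed

section \<open>The topology of the tight groupoid\<close>

lemma topspace_tight_top: "topspace tight_top = tight_spectrum"
  by (auto simp: tight_top_def topspace_subtopology topspace_filter_top tight_filter)

lemma openin_DD:
  fixes e :: "'s::inverse_semigroup_0"
  shows "openin tight_top (DD e)"
proof (cases "e \<in> idems")
  case True
  have "DD e = {\<xi>\<in>filters. e \<in> \<xi>} \<inter> tight_spectrum"
    by (auto simp: DD_def tight_filter)
  then show ?thesis
    using openin_filter_top_coordinate(1)[OF True] by (auto simp: tight_top_def openin_subtopology)
next
  case False
  then have "DD e = {}"
    using filter_idem[OF tight_filter] by (auto simp: DD_def)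
  then show ?thesis by simp
qed

lemma closedin_DD:
  fixes e :: "'s::inverse_semigroup_0"
  shows "closedin tight_top (DD e)"
proof (cases "e \<in> idems")
  case True
  have "topspace tight_top - DD e = {\<xi>\<in>filters. e \<notin> \<xi>} \<inter> tight_spectrum"
    by (auto simp: DD_def tight_filter topspace_tight_top)
  then have "openin tight_top (topspace tight_top - DD e)"
    using openin_filter_top_coordinate(2)[OF True] by (auto simp: tight_top_def openin_subtopology)
  then show ?thesis
    by (auto simp: closedin_def topspace_tight_top DD_def)
next
  case False
  then have "DD e = {}"
    using filter_idem[OF tight_filter] by (auto simp: DD_def)
  then show ?thesis by simp
qed

text \<open>Open sets of the pullback are traces of preimages of open sets, so a cover of
  \<open>K\<close> comes from a cover of its image.\<close>

lemma compactin_pullback_topology: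
  assumes K: "K \<subseteq> A" and "compactin T (f ` K)"
  shows "compactin (pullback_topology A f T) K"
  unfolding compactin_def
proof (intro conjI allI impI)
  show "K \<subseteq> topspace (pullback_topology A f T)"
    using assms compactin_subset_topspace by (fastforce simp: topspace_pullback_topology)
  fix \<U> assume \<U>: "Ball \<U> (openin (pullback_topology A f T)) \<and> K \<subseteq> \<Union>\<U>"
  then have "\<forall>U\<in>\<U>. \<exists>V. openin T V \<and> U = f -` V \<inter> A"
    by (auto simp: openin_pullback_topology)
  then obtain V where V: "\<And>U. U \<in> \<U> \<Longrightarrow> openin T (V U) \<and> U = f -` V U \<inter> A"
    by metis
  have "\<exists>\<F>. finite \<F> \<and> \<F> \<subseteq> V ` \<U> \<and> f ` K \<subseteq> \<Union>\<F>"
  proof (rule compactinD[OF assms(2)])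
    show "openin T W" if "W \<in> V ` \<U>" for W
      using that V by auto
    show "f ` K \<subseteq> \<Union>(V ` \<U>)"
    proof
      fix y assume "y \<in> f ` K"
      then obtain x U where "y = f x" "U \<in> \<U>" "x \<in> U"
        using \<U> by auto
      then show "y \<in> \<Union>(V ` \<U>)"
        using V[of U] by auto
    qed
  qed
  then obtain \<F> where \<F>: "finite \<F>" "\<F> \<subseteq> V ` \<U>" "f ` K \<subseteq> \<Union>\<F>"
    by auto
  obtain \<G> where \<G>: "finite \<G>" "\<G> \<subseteq> \<U>" "\<F> = V ` \<G>"
    using finite_subset_image[OF \<F>(1,2)] by blast
  have "K \<subseteq> \<Union>\<G>"
  proof
    fix x assume x: "x \<in> K"
    then obtain U where "U \<in> \<G>" "f x \<in> V U"
      using \<F>(3) \<G>(3) by blast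
    then show "x \<in> \<Union>\<G>"
      using V[of U] \<G>(2) x K by auto
  qed
  with \<G> show "\<exists>\<F>. finite \<F> \<and> \<F> \<subseteq> \<U> \<and> K \<subseteq> \<Union>\<F>"
    by blast
qed

text \<open>A filter containing \<open>e\<close> is a point of the cube satisfying closed conditions on at most
  three coordinates at a time.\<close>

lemma compactin_filter_top:
  fixes e :: "'s::inverse_semigroup_0"
  assumes e: "e \<in> idems"
  shows "compactin filter_top {\<xi>\<in>filters. e \<in> \<xi>}"
proof -
  define P where "P = product_topology (\<lambda>_. discrete_topology (UNIV :: bool set)) (idems :: 's set)"
  define \<Phi> where "\<Phi> = (\<lambda>\<xi>. \<lambda>e\<in>(idems :: 's set). e \<in> \<xi>)"
  have coord: "closedin P {g \<in> topspace P. g a = b}" if "a \<in> idems" for a b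
  proof -
    have "closedin P {g \<in> topspace P. g a \<in> {b}}"
      unfolding P_def
      by (rule closedin_continuous_map_preimage[OF continuous_map_product_projection[OF that]]) simp
    then show ?thesis by simp
  qed
  \<comment> \<open>Nonemptiness of a filter is in general not a closed condition on the cube;
    prescribing the coordinate \<open>e\<close> enforces it by a closed one.\<close>
  define \<K> where "\<K> = {{g \<in> topspace P. g e}, {g \<in> topspace P. \<not> g 0}} \<union>
    {{g \<in> topspace P. g a \<longrightarrow> g b} |a b. a \<in> idems \<and> b \<in> idems \<and> b * a = a} \<union>
    {{g \<in> topspace P. g a \<and> g b \<longrightarrow> g (a * b)} |a b. a \<in> idems \<and> b \<in> idems}"
  have "closedin P K" if "K \<in> \<K>" for K
  proof -
    have 1: "closedin P {g \<in> topspace P. g a \<longrightarrow> g b}" if "a \<in> idems" "b \<in> idems" for a b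
    proof -
      have "{g \<in> topspace P. g a \<longrightarrow> g b} = {g \<in> topspace P. g a = False} \<union> {g \<in> topspace P. g b = True}"
        by auto
      then show ?thesis
        using that coord by (simp only: closedin_Un)
    qed
    have 2: "closedin P {g \<in> topspace P. g a \<and> g b \<longrightarrow> g (a * b)}" if "a \<in> idems" "b \<in> idems" for a b
    proof -
      have "{g \<in> topspace P. g a \<and> g b \<longrightarrow> g (a * b)} = {g \<in> topspace P. g a = False} \<union>
        {g \<in> topspace P. g b = False} \<union> {g \<in> topspace P. g (a * b) = True}"
        by auto
      then show ?thesis
        using that coord by (simp only: closedin_Un idem_mult)
    qed
    show ?thesis
      using that 1 2 coord[OF e, of True] coord[OF zero_idem, of False] by (auto simp: \<K>_def)
  qed
  then have closed: "closedin P (\<Inter>\<K>)"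
    by (intro closedin_Inter) (auto simp: \<K>_def)
  have "compact_space P"
    by (simp add: P_def compact_space_product_topology compact_space_discrete_topology)
  then have "compactin P (\<Inter>\<K>)"
    using closed by (rule closedin_compact_space)
  moreover have "\<Phi> ` {\<xi>\<in>filters. e \<in> \<xi>} = \<Inter>\<K>"
  proof (intro equalityI subsetI)
    fix g assume "g \<in> \<Phi> ` {\<xi>\<in>filters. e \<in> \<xi>}"
    then obtain \<xi> where "\<xi> \<in> filters" "e \<in> \<xi>" "g = \<Phi> \<xi>"
      by blast
    then show "g \<in> \<Inter>\<K>"
      using e by (auto simp: \<K>_def \<Phi>_def P_def filters_iff)
  next
    fix g assume g: "g \<in> \<Inter>\<K>"
    then have top: "g \<in> topspace P" and ge: "g e" and g0: "\<not> g 0"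
      by (auto simp: \<K>_def)
    have up: "g b" if "g a" "a \<in> idems" "b \<in> idems" "b * a = a" for a b
    proof -
      have "{g \<in> topspace P. g a \<longrightarrow> g b} \<in> \<K>"
        using that by (auto simp: \<K>_def)
      then show ?thesis
        using g that by blast
    qed
    have mult: "g (a * b)" if "g a" "g b" "a \<in> idems" "b \<in> idems" for a b
    proof -
      have "{g \<in> topspace P. g a \<and> g b \<longrightarrow> g (a * b)} \<in> \<K>"
        using that by (auto simp: \<K>_def)
      then show ?thesis
        using g that by blast
    qed
    have "{a \<in> idems. g a} \<in> filters"
      unfolding filters_iff using e ge g0 up mult by auto
    moreover have "g = \<Phi> {a \<in> idems. g a}"
      using top by (auto simp: \<Phi>_def P_def fun_eq_iff PiE_iff extensional_def)
    ultimately show "g \<in> \<Phi> ` {\<xi>\<in>filters. e \<in> \<xi>}"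
      using e ge by blast
  qed
  ultimately have "compactin P (\<Phi> ` {\<xi>\<in>filters. e \<in> \<xi>})"
    by simp
  then show ?thesis
    unfolding filter_top_def P_def \<Phi>_def by (intro compactin_pullback_topology) auto
qed

lemma compactin_DD:
  fixes e :: "'s::inverse_semigroup_0"
  shows "compactin tight_top (DD e)"
proof (cases "e \<in> idems")
  case True
  have "closedin filter_top (tight_spectrum :: 's set set)"
    by (simp add: tight_spectrum_def)
  then have "compactin filter_top (tight_spectrum \<inter> {\<xi>\<in>filters. e \<in> \<xi>})"
    using compactin_filter_top[OF True] by (rule closed_Int_compactin)
  moreover have "tight_spectrum \<inter> {\<xi>\<in>filters. e \<in> \<xi>} = DD e"
    by (auto simp: DD_def tight_filter)
  ultimately show ?thesis
    by (auto simp: tight_top_def compactin_subtopology DD_def)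
next
  case False
  then have "DD e = {}"
    using filter_idem[OF tight_filter] by (auto simp: DD_def)
  then show ?thesis by simp
qed

section \<open>Bisections and the clopen set of arrows of H\<close>

definition bisections :: "'s::inverse_semigroup_0 germ set set"
  where "bisections = {Theta s U |s U. U \<subseteq> DD (star s * s) \<and> compactin tight_top U \<and> openin tight_top U}"

lemma gtop_tG: "gtop tG = topology_generated_by bisections"
  by (simp add: tight_groupoid_def bisections_def)

lemma bisections_DD: "Theta s (DD (star s * s)) \<in> bisections"
  unfolding bisections_def
  by (intro CollectI exI[of _ s] exI[of _ "DD (star s * s)"] conjI refl subset_refl openin_DD compactin_DD)

lemma topspace_gtop: "topspace (gtop tG) = arrows (tG :: 's::inverse_semigroup_0 germ top_groupoid)"
proof -
  have "\<Union>bisections = {germ (s :: 's) \<xi> |s \<xi>. \<xi> \<in> DD (star s * s)}"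
  proof (intro equalityI subsetI)
    fix \<gamma> assume "\<gamma> \<in> {germ (s :: 's) \<xi> |s \<xi>. \<xi> \<in> DD (star s * s)}"
    then obtain s :: 's and \<xi> where "\<gamma> = germ s \<xi>" "\<xi> \<in> DD (star s * s)"
      by auto
    then have "\<gamma> \<in> Theta s (DD (star s * s))"
      by (auto simp: Theta_def)
    then show "\<gamma> \<in> \<Union>bisections"
      using bisections_DD by (rule UnionI[rotated])
  next
    fix \<gamma> :: "'s germ" assume "\<gamma> \<in> \<Union>bisections"
    then obtain s :: 's and U where "U \<subseteq> DD (star s * s)" "\<gamma> \<in> Theta s U"
      by (auto simp: bisections_def)
    then show "\<gamma> \<in> {germ (s :: 's) \<xi> |s \<xi>. \<xi> \<in> DD (star s * s)}"
      by (auto simp: Theta_def)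
  qed
  then show ?thesis
    by (simp add: gtop_tG arrows_tG)
qed

lemma openin_bisection: "B \<in> bisections \<Longrightarrow> openin (gtop tG) B"
  by (simp add: gtop_tG topology_generated_by_Basis)

lemma openin_iso_arrows: "openin (gtop tG) (iso_arrows :: 's::inverse_semigroup_0 germ set)"
proof -
  have "iso_arrows = \<Union>((\<lambda>s :: 's. Theta s (DD (star s * s))) ` S_Iso)"
    by (auto simp: iso_arrows_def Theta_def)
  also have "openin (gtop tG) \<dots>"
    using openin_bisection[OF bisections_DD] by (intro openin_Union) auto
  finally show ?thesis .
qed

lemma iso_arrows_subset: "iso_arrows \<subseteq> arrows tG"
  by (auto simp: iso_arrows_def arrows_tG)

text \<open>The complement of H is the union, over all \<open>s\<close>, of the germs of
  \<open>s\<close> at filters outside Z_s. A finite cover makes Z_s a finite union of clopen sets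
  \<open>DD c\<close>, so \<open>DD (star s * s) - ZZ s\<close> is compact open and its germs form a
  basic open set.\<close>

lemma closedin_iso_arrows:
  assumes W: "\<And>s :: 's::inverse_semigroup_0. \<exists>C. finite C \<and> is_cover C (WW s)"
  shows "closedin (gtop tG) (iso_arrows :: 's germ set)"
proof -
  have bis: "Theta s (DD (star s * s) - ZZ s) \<in> bisections" for s :: 's
  proof -
    obtain C where C: "finite C" "is_cover C (WW s)"
      using W by blast
    have Z: "openin tight_top (ZZ s)" "closedin tight_top (ZZ s)"
      unfolding ZZ_eq_cover[OF C] using C(1) openin_DD closedin_DD by (auto intro: closedin_Union)
    have "openin tight_top (DD (star s * s) - ZZ s)" "closedin tight_top (DD (star s * s) - ZZ s)"
      using Z openin_DD closedin_DD by (auto intro: openin_diff closedin_diff)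
    moreover have "compactin tight_top (DD (star s * s) - ZZ s)"
      using closed_compactin[OF compactin_DD _ calculation(2), of "star s * s"] by blast
    ultimately show ?thesis
      unfolding bisections_def by blast
  qed
  have "topspace (gtop tG) - iso_arrows = (\<Union>s. Theta (s :: 's) (DD (star s * s) - ZZ s))"
  proof (intro equalityI subsetI)
    fix \<gamma> :: "'s germ" assume \<gamma>: "\<gamma> \<in> topspace (gtop tG) - iso_arrows"
    then obtain s \<xi> where "\<gamma> = germ s \<xi>" "\<xi> \<in> DD (star s * s)"
      by (auto simp: topspace_gtop arrows_tG)
    then show "\<gamma> \<in> (\<Union>s. Theta (s :: 's) (DD (star s * s) - ZZ s))"
      using \<gamma> germ_mem_iso_arrows_iff[of \<xi> s] by (auto simp: Theta_def)
  next
    fix \<gamma> assume "\<gamma> \<in> (\<Union>s. Theta (s :: 's) (DD (star s * s) - ZZ s))"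
    then obtain s \<xi> where "\<gamma> = germ s \<xi>" "\<xi> \<in> DD (star s * s)" "\<xi> \<notin> ZZ s"
      by (auto simp: Theta_def)
    then show "\<gamma> \<in> topspace (gtop tG) - iso_arrows"
      using germ_mem_iso_arrows_iff[of \<xi> s] by (auto simp: topspace_gtop arrows_tG)
  qed
  then show ?thesis
    using openin_bisection[OF bis] iso_arrows_subset
    by (auto simp: closedin_def topspace_gtop intro!: openin_Union)
qed

text \<open>Compactness of the support selects finitely many of the open sets
  \<open>Theta s (DD (star s * s))\<close>, and continuity bounds the values.\<close>

lemma Cc_finite_kernel:
  fixes f :: "'s::inverse_semigroup_0 germ \<Rightarrow> complex"
  assumes f: "f \<in> Cc tG"
  shows "finite_kernel (conv_kernel tG f)"
proof -
  define K where "K = gtop tG closure_of {\<gamma>\<in>arrows tG. f \<gamma> \<noteq> 0}"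
  have cont: "continuous_map (gtop tG) euclidean f" and 0: "\<And>\<gamma>. \<gamma> \<notin> arrows tG \<Longrightarrow> f \<gamma> = 0"
    and K: "compactin (gtop tG) K"
    using f by (auto simp: Cc_def K_def)
  have supp: "\<gamma> \<in> K" if "f \<gamma> \<noteq> 0" for \<gamma>
    using that 0 closure_of_subset[of "{\<gamma>\<in>arrows tG. f \<gamma> \<noteq> 0}" "gtop tG"]
    by (auto simp: K_def topspace_gtop)
  have "compact (f ` K)"
    using image_compactin[OF K cont] by simp
  then obtain M where M: "\<And>z. z \<in> f ` K \<Longrightarrow> cmod z \<le> M"
    using compact_imp_bounded bounded_iff by metis
  \<comment> \<open>The maximum with \<open>0\<close> covers vanishing values: for empty
    \<open>K\<close> the number \<open>M\<close> is arbitrary and may be negative.\<close>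
  have bound: "cmod (f \<gamma>) \<le> max M 0" for \<gamma>
    using M[of "f \<gamma>"] supp[of \<gamma>] by (cases "f \<gamma> = 0") (auto intro: max.coboundedI1)
  define B where "B s = Theta s (DD (star s * s))" for s :: 's
  have "K \<subseteq> (\<Union>s. B s)"
    using compactin_subset_topspace[OF K] by (fastforce simp: topspace_gtop arrows_tG B_def Theta_def)
  moreover have "Ball (range B) (openin (gtop tG))"
    using openin_bisection[OF bisections_DD] by (auto simp: B_def)
  ultimately obtain \<F> where "finite \<F>" "\<F> \<subseteq> range B" "K \<subseteq> \<Union>\<F>"
    using compactinD[OF K, of "range B"] by blast
  then obtain I where "finite I" "K \<subseteq> (\<Union>s\<in>I. B s)"
    using finite_subset_image[of \<F> B UNIV] by blast
  then show ?thesis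
    using supp bound
    by (intro finite_conv_kernel[of I f "max M 0"]) (auto simp: B_def dest!: subsetD)
qed

text \<open>Since H is open, preimages that are open in H are open in G. Since H is closed, the
  extension by zero is continuous and the closure of the support is the same in both spaces.\<close>

lemma Cc_open_subgroupoid:
  assumes H: "openin (gtop G) H" "closedin (gtop G) H" "H \<subseteq> arrows G"
  shows "Cc (open_subgroupoid G H) = {f \<in> Cc G. \<forall>\<gamma>. \<gamma> \<notin> H \<longrightarrow> f \<gamma> = 0}"
proof (intro equalityI subsetI)
  have top: "gtop (open_subgroupoid G H) = subtopology (gtop G) H" "arrows (open_subgroupoid G H) = H"
    by (simp_all add: open_subgroupoid_def)
  have cl: "subtopology (gtop G) H closure_of S = gtop G closure_of S" if "S \<subseteq> H" for S
    using that closure_of_minimal[OF that H(2)] by (simp add: closure_of_subtopology Int_absorb1 Int_absorb2)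
  {
    fix f assume f: "f \<in> Cc (open_subgroupoid G H)"
    then have cont: "continuous_map (subtopology (gtop G) H) euclidean f"
      and 0: "\<And>\<gamma>. \<gamma> \<notin> H \<Longrightarrow> f \<gamma> = 0"
      and comp: "compactin (subtopology (gtop G) H) (subtopology (gtop G) H closure_of {\<gamma>\<in>H. f \<gamma> \<noteq> 0})"
      by (auto simp: Cc_def top)
    have eq: "{\<gamma>\<in>arrows G. f \<gamma> \<noteq> 0} = {\<gamma>\<in>H. f \<gamma> \<noteq> 0}"
      using 0 H(3) by auto
    have "compactin (gtop G) (gtop G closure_of {\<gamma>\<in>arrows G. f \<gamma> \<noteq> 0})"
      using comp unfolding eq by (subst (asm) cl) (auto simp: compactin_subtopology)
    moreover have "continuous_map (gtop G) euclidean f"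
      unfolding continuous_map
    proof (intro conjI allI impI)
      fix U :: "complex set" assume "openin euclidean U"
      have "openin (subtopology (gtop G) H) {x \<in> topspace (subtopology (gtop G) H). f x \<in> U}"
        using cont \<open>openin euclidean U\<close> by (auto simp: continuous_map)
      then have 1: "openin (gtop G) {x \<in> topspace (subtopology (gtop G) H). f x \<in> U}"
        using H(1) by (simp add: openin_open_subtopology)
      have 2: "openin (gtop G) (topspace (gtop G) - H)"
        using H(2) by blast
      have "{x \<in> topspace (gtop G). f x \<in> U} = {x \<in> topspace (subtopology (gtop G) H). f x \<in> U} \<union>
          (if 0 \<in> U then topspace (gtop G) - H else {})"
        using 0 by (auto simp: topspace_subtopology) metis
      then show "openin (gtop G) {x \<in> topspace (gtop G). f x \<in> U}"
        using 1 2 by (auto intro: openin_Un)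
    qed auto
    ultimately show "f \<in> {f \<in> Cc G. \<forall>\<gamma>. \<gamma> \<notin> H \<longrightarrow> f \<gamma> = 0}"
      using 0 H(3) by (auto simp: Cc_def)
  next
    fix f assume f: "f \<in> {f \<in> Cc G. \<forall>\<gamma>. \<gamma> \<notin> H \<longrightarrow> f \<gamma> = 0}"
    then have eq: "{\<gamma>\<in>arrows G. f \<gamma> \<noteq> 0} = {\<gamma>\<in>H. f \<gamma> \<noteq> 0}"
      using H(3) by auto
    have "gtop G closure_of {\<gamma>\<in>H. f \<gamma> \<noteq> 0} \<subseteq> H"
      by (rule closure_of_minimal[OF _ H(2)]) auto
    then show "f \<in> Cc (open_subgroupoid G H)"
      using f unfolding Cc_def eq mem_Collect_eq top
      by (subst cl) (auto simp: compactin_subtopology continuous_map_from_subtopology)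
  }
qed

text \<open>Continuity rests on H being clopen; the new support is a closed subset of the old
  compact one. This keeps the compression of a function in \<open>Cc\<close> within
  \<open>Cc\<close>.\<close>

lemma Cc_restrict:
  assumes H: "openin (gtop G) H" "closedin (gtop G) H" and f: "f \<in> Cc G"
  shows "(\<lambda>\<gamma>. if \<gamma> \<in> H then f \<gamma> else 0) \<in> Cc G"
proof -
  let ?g = "\<lambda>\<gamma>. if \<gamma> \<in> H then f \<gamma> else 0"
  have cont: "continuous_map (gtop G) euclidean f" and 0: "\<And>\<gamma>. \<gamma> \<notin> arrows G \<Longrightarrow> f \<gamma> = 0"
    and K: "compactin (gtop G) (gtop G closure_of {\<gamma>\<in>arrows G. f \<gamma> \<noteq> 0})"
    using f by (auto simp: Cc_def)
  have "continuous_map (gtop G) euclidean ?g"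
    unfolding continuous_map
  proof (intro conjI allI impI)
    fix U :: "complex set" assume "openin euclidean U"
    then have 1: "openin (gtop G) {x \<in> topspace (gtop G). f x \<in> U}"
      using cont by (auto simp: continuous_map)
    have 2: "openin (gtop G) (topspace (gtop G) - H)"
      using H(2) by blast
    have "{x \<in> topspace (gtop G). ?g x \<in> U} = ({x \<in> topspace (gtop G). f x \<in> U} \<inter> H) \<union>
        (if 0 \<in> U then topspace (gtop G) - H else {})"
      by auto
    then show "openin (gtop G) {x \<in> topspace (gtop G). ?g x \<in> U}"
      using 1 2 H(1) by (auto intro: openin_Un openin_Int)
  qed auto
  moreover have "compactin (gtop G) (gtop G closure_of {\<gamma>\<in>arrows G. ?g \<gamma> \<noteq> 0})"
    by (rule closed_compactin[OF K closure_of_mono closedin_closure_of]) auto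
  ultimately show ?thesis
    using 0 by (simp add: Cc_def)
qed

section \<open>The compression on the generators\<close>

lemma indicator_Theta_finite_kernel:
  "finite_kernel (conv_kernel tG (indicator (Theta s (DD (star s * s)))))"
  by (rule finite_conv_kernel[of "{s}" _ 1]) (auto simp: indicator_def)

text \<open>Right multiplication by the indicator of Z_s keeps the columns \<beta> with range in
  Z_s; the compression keeps the entries with \<gamma>\<beta>^{-1} in H. On the support of
  \<open>TT s\<close> this quotient is the germ of \<open>s\<close> at the range of \<beta>, so
  \<open>germ_mem_iso_arrows_iff\<close> identifies the two conditions.\<close>

lemma pinch_TT:
  fixes s :: "'s::inverse_semigroup_0"
  assumes C: "finite C" "is_cover C (WW s)"
  shows "pinch iso_rel (TT s) = TT s o\<^sub>L unit_indicator (\<Union>c\<in>C. DD c)"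
proof -
  define Z where "Z = ZZ s"
  have Z_eq: "(\<Union>c\<in>C. DD c) = Z"
    by (simp add: Z_def ZZ_eq_cover[OF C])
  \<comment> \<open>The range of \<beta> lies in \<open>Z\<close>; \<open>P_germ\<close> shows
    independence of the representative.\<close>
  define P where "P \<beta> \<longleftrightarrow> (\<exists>t \<xi>. \<beta> = germ t \<xi> \<and> \<xi> \<in> DD (star t * t) \<and> theta t \<xi> \<in> Z)" for \<beta>
  have Z_tight: "\<eta> \<in> tight_spectrum" if "\<eta> \<in> Z" for \<eta>
    using that by (simp add: Z_def ZZ_def)
  have P_germ: "P (germ t \<xi>) \<longleftrightarrow> theta t \<xi> \<in> Z" if t: "\<xi> \<in> DD (star t * t)" for t \<xi>
  proof
    assume "P (germ t \<xi>)"
    then obtain r \<eta> where r: "germ t \<xi> = germ r \<eta>" "\<eta> \<in> DD (star r * r)" "theta r \<eta> \<in> Z"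
      by (auto simp: P_def)
    then obtain e where "\<eta> = \<xi>" "e \<in> \<xi>" "t * e = r * e"
      using germ_eq_iff[OF t r(2)] by blast
    then show "theta t \<xi> \<in> Z"
      using r theta_cong[of \<xi> t r e] DD_filter[OF t] DD_filter[OF r(2)] by simp
  qed (use that in \<open>auto simp: P_def\<close>)
  have unit_kernel: "conv_kernel tG (indicator (unit_germ ` Z)) = (\<lambda>\<gamma> \<beta>. if \<gamma> = \<beta> \<and> P \<beta> then 1 else 0)"
  proof (intro ext)
    fix \<gamma> \<beta> :: "'s germ"
    show "conv_kernel tG (indicator (unit_germ ` Z)) \<gamma> \<beta> = (if \<gamma> = \<beta> \<and> P \<beta> then 1 else 0)"
    proof (cases "\<gamma> \<in> arrows tG \<and> \<beta> \<in> arrows tG \<and> src tG \<gamma> = src tG \<beta>")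
      case True
      then obtain r \<xi> where r: "\<gamma> = germ r \<xi>" "\<xi> \<in> DD (star r * r)"
        by (metis arrow_cases)
      obtain t where t: "\<beta> = germ t \<xi>" "\<xi> \<in> DD (star t * t)"
        using True r by (metis arrow_cases_src)
      have tt: "theta t \<xi> \<in> DD (t * star t)"
        by (rule theta_DD[OF t(2)])
      have "germ (r * star t) (theta t \<xi>) \<in> unit_germ ` Z \<longleftrightarrow> \<gamma> = \<beta> \<and> P \<beta>"
      proof
        assume "germ (r * star t) (theta t \<xi>) \<in> unit_germ ` Z"
        then obtain \<eta> where \<eta>: "\<eta> \<in> Z" "germ (r * star t) (theta t \<xi>) = unit_germ \<eta>"
          by blast
        then have "\<eta> \<in> DD (star s * s)"
          using ZZ_subset by (auto simp: Z_def)
        then have u: "germ (r * star t) (theta t \<xi>) = germ (star s * s) \<eta>"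
          using \<eta>(2) by (simp add: unit_germ_eq)
        then obtain e where e: "\<eta> = theta t \<xi>" "e \<in> theta t \<xi>" "r * star t * e = star s * s * e"
          using germ_eq_iff[OF theta_DD_mult_star[OF r(2) t(2)] DD_idem[OF \<open>\<eta> \<in> DD (star s * s)\<close>]] by auto
        note \<theta> = DD_filter[OF tt] and \<xi> = DD_filter[OF t(2)]
        have ei: "e \<in> idems"
          using e(2) \<theta> by (simp add: filter_idem)
        have ss: "star s * s \<in> theta t \<xi>"
          using \<open>\<eta> \<in> DD (star s * s)\<close> e(1) by (simp add: DD_def)
        \<comment> \<open>Cutting \<open>e\<close> down by \<open>star s * s\<close> turns the
          equation for \<open>e\<close> into \<open>r * star t * k = k\<close>, from which
          \<open>r\<close> and \<open>t\<close> agree on the pullback \<open>g\<close>.\<close>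
        define k where "k = star s * s * e"
        have k: "k \<in> theta t \<xi>" "k \<in> idems"
          using filter_mult[OF \<theta>(1) ss e(2)] ei by (simp_all add: k_def)
        define g where "g = star t * k * t"
        have "g \<in> \<xi>"
          using k by (simp add: g_def flip: mem_theta[OF \<xi>])
        have rk: "r * star t * k = k"
        proof -
          have "k = e * (star s * s)"
            unfolding k_def by (rule idem_commute) (simp_all add: ei)
          then have "r * star t * k = r * star t * e * (star s * s)"
            by (simp add: mult.assoc)
          also have "\<dots> = k * (star s * s)"
            unfolding e(3) k_def ..
          also have "\<dots> = e * (star s * s * (star s * s))"
            unfolding \<open>k = e * (star s * s)\<close> by (simp only: mult.assoc)
          also have "\<dots> = k"
            unfolding \<open>k = e * (star s * s)\<close> by (simp only: idem_simp[OF star_mult_idem(1)])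
          finally show ?thesis .
        qed
        have "r * g = k * t"
          unfolding g_def by (metis rk mult.assoc)
        moreover have "t * g = k * t"
        proof -
          have "t * g = (t * star t * k) * t"
            by (simp add: g_def mult.assoc)
          also have "\<dots> = k * (t * star t * t)"
            unfolding idem_commute[OF star_mult_idem(2) k(2)] by (simp add: mult.assoc)
          finally show ?thesis by (simp add: star_props)
        qed
        ultimately have "r * g = t * g" by simp
        then have "\<gamma> = \<beta>"
          unfolding r(1) t(1) germ_eq_iff[OF r(2) t(2)] using \<open>g \<in> \<xi>\<close> by blast
        then show "\<gamma> = \<beta> \<and> P \<beta>"
          using \<eta>(1) e(1) by (simp add: t(1) P_germ[OF t(2)])
      next
        assume *: "\<gamma> = \<beta> \<and> P \<beta>"
        have "germ (r * star t) (theta t \<xi>) = gmul tG \<beta> (ginv tG \<beta>)"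
          using gmul_ginv_germ[OF r(2) t(2)] * r t by simp
        also have "\<dots> = unit_germ (theta t \<xi>)"
          by (simp add: t gmul_ginv_germ[OF t(2) t(2)] unit_germ_eq[OF tt])
        finally show "germ (r * star t) (theta t \<xi>) \<in> unit_germ ` Z"
          using * by (simp add: t(1) P_germ[OF t(2)])
      qed
      then show ?thesis
        using True by (simp add: conv_kernel_def r(1) t(1) gmul_ginv_germ[OF r(2) t(2)])
    next
      case False
      then have "\<not> (\<gamma> = \<beta> \<and> P \<beta>)"
        by (auto simp: P_def arrows_tG)
      with False show ?thesis
        by (auto simp: conv_kernel_def)
    qed
  qed
  have kernel: "(\<lambda>\<gamma> \<beta>. if P \<beta> then conv_kernel tG (indicator (Theta s (DD (star s * s)))) \<gamma> \<beta> else 0)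
      = conv_kernel tG (\<lambda>\<gamma>. if \<gamma> \<in> iso_arrows then indicator (Theta s (DD (star s * s))) \<gamma> else 0)"
  proof (intro ext)
    fix \<gamma> \<beta> :: "'s germ"
    show "(if P \<beta> then conv_kernel tG (indicator (Theta s (DD (star s * s)))) \<gamma> \<beta> else 0)
      = conv_kernel tG (\<lambda>\<gamma>. if \<gamma> \<in> iso_arrows then indicator (Theta s (DD (star s * s))) \<gamma> else 0) \<gamma> \<beta>"
    proof (cases "\<gamma> \<in> arrows tG \<and> \<beta> \<in> arrows tG \<and> src tG \<gamma> = src tG \<beta>")
      case True
      then obtain r \<xi> where r: "\<gamma> = germ r \<xi>" "\<xi> \<in> DD (star r * r)"
        by (metis arrow_cases)
      obtain t where t: "\<beta> = germ t \<xi>" "\<xi> \<in> DD (star t * t)"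
        using True r by (metis arrow_cases_src)
      have "P \<beta> \<longleftrightarrow> gmul tG \<gamma> (ginv tG \<beta>) \<in> iso_arrows"
        if "gmul tG \<gamma> (ginv tG \<beta>) \<in> Theta s (DD (star s * s))"
      proof -
        obtain \<eta> where \<eta>: "\<eta> \<in> DD (star s * s)" "germ (r * star t) (theta t \<xi>) = germ s \<eta>"
          using \<open>gmul tG \<gamma> (ginv tG \<beta>) \<in> Theta s (DD (star s * s))\<close>
          by (auto simp: r(1) t(1) gmul_ginv_germ[OF r(2) t(2)] Theta_def)
        then have "\<eta> = theta t \<xi>"
          using germ_eq_iff[OF theta_DD_mult_star[OF r(2) t(2)] \<eta>(1)] by simp
        then show ?thesis
          using \<eta> germ_mem_iso_arrows_iff[OF \<eta>(1)]
          by (simp add: r(1) t(1) gmul_ginv_germ[OF r(2) t(2)] P_germ[OF t(2)] Z_def)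
      qed
      then show ?thesis
        using True by (auto simp: conv_kernel_def indicator_def)
    qed (auto simp: conv_kernel_def)
  qed
  have "TT s o\<^sub>L unit_indicator Z
      = kernel_op (conv_kernel tG (indicator (Theta s (DD (star s * s)))))
        o\<^sub>L kernel_op (\<lambda>\<gamma> \<beta>. if \<gamma> = \<beta> \<and> P \<beta> then 1 else 0)"
    by (simp add: TT_def unit_indicator_def reg_rep_eq_kernel_op unit_kernel)
  also have "\<dots> = pinch iso_rel (TT s)"
    unfolding kernel_op_comp_diagonal[OF indicator_Theta_finite_kernel] kernel TT_def
      pinch_reg_rep[OF indicator_Theta_finite_kernel] unfolding reg_rep_eq_kernel_op ..
  finally show ?thesis
    by (simp add: Z_eq)
qed

theorem proposition3p7:
  assumes J_cover: "\<And>s :: 's::inverse_semigroup_0. \<exists>C. finite C \<and> is_cover C (JJ s)"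
    and W_cover: "\<And>s :: 's. \<exists>C. finite C \<and> is_cover C (WW s)"
  shows "\<exists>\<E>. conditional_expectation (Cr (tight_groupoid :: 's germ top_groupoid))
          (Cr_sub tight_groupoid iso_arrows) \<E> \<and>
        faithful_on (Cr (tight_groupoid :: 's germ top_groupoid)) \<E> \<and>
        (\<forall>(s :: 's) C. finite C \<and> is_cover C (WW s) \<longrightarrow>
          \<E> (TT s) = TT s o\<^sub>L unit_indicator (\<Union>c\<in>C. DD c))"
proof (intro exI[of _ "pinch iso_rel"] conjI allI impI)
  let ?G = "tight_groupoid :: 's germ top_groupoid"
  note iso = openin_iso_arrows closedin_iso_arrows[OF W_cover]
  have Cc_iso: "Cc (open_subgroupoid ?G iso_arrows) = {f \<in> Cc ?G. \<forall>\<gamma>. \<gamma> \<notin> iso_arrows \<longrightarrow> f \<gamma> = 0}"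
    by (rule Cc_open_subgroupoid[OF iso iso_arrows_subset])
  note pinch_linear = bounded_linear_pinch[OF equiv_iso_rel]
  show "conditional_expectation (Cr ?G) (Cr_sub ?G iso_arrows) (pinch iso_rel)"
  proof (rule conditional_expectation_pinch[OF equiv_iso_rel])
    show "Cr_sub ?G iso_arrows \<subseteq> Cr ?G"
      unfolding Cr_def Cr_sub_def Cc_iso by (intro closure_mono image_mono) auto
    have "pinch iso_rel ` reg_rep ?G ` Cc ?G \<subseteq> reg_rep ?G ` Cc (open_subgroupoid ?G iso_arrows)"
      unfolding Cc_iso using Cc_restrict[OF iso] by (auto simp: pinch_reg_rep[OF Cc_finite_kernel])
    \<comment> \<open>A bounded linear map carries the closure of a set into the closure of its
      image, so the inclusion on \<open>Cc\<close> suffices.\<close>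
    then have "pinch iso_rel ` Cr ?G \<subseteq> Cr_sub ?G iso_arrows"
      unfolding Cr_def Cr_sub_def
      by (intro order.trans[OF closure_bounded_linear_image_subset[OF pinch_linear] closure_mono])
    then show "pinch iso_rel a \<in> Cr_sub ?G iso_arrows" if "a \<in> Cr ?G" for a
      using that by blast
    \<comment> \<open>The fixed points form a closed set, so it suffices that it contains the
      operators of functions supported in H.\<close>
    have "closed {b. pinch iso_rel b = b}"
      by (intro closed_Collect_eq linear_continuous_on[OF pinch_linear] continuous_on_id)
    moreover have "pinch iso_rel (reg_rep ?G f) = reg_rep ?G f"
      if "f \<in> Cc (open_subgroupoid ?G iso_arrows)" for f
    proof -
      have f: "f \<in> Cc ?G" "\<And>\<gamma>. \<gamma> \<notin> iso_arrows \<Longrightarrow> f \<gamma> = 0"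
        using that by (auto simp: Cc_iso)
      then have "(\<lambda>\<gamma>. if \<gamma> \<in> iso_arrows then f \<gamma> else 0) = f"
        by auto
      then show ?thesis
        by (simp add: pinch_reg_rep[OF Cc_finite_kernel[OF f(1)]])
    qed
    ultimately have "Cr_sub ?G iso_arrows \<subseteq> {b. pinch iso_rel b = b}"
      unfolding Cr_sub_def by (intro closure_minimal) auto
    then show "pinch iso_rel b = b" if "b \<in> Cr_sub ?G iso_arrows" for b
      using that by blast
  qed
  show "faithful_on (Cr ?G) (pinch iso_rel)"
  proof (rule faithful_pinch[OF equiv_iso_rel])
    have "Cr ?G \<subseteq> {a. clinear_op a}"
      unfolding Cr_def
      by (intro closure_minimal closed_clinear_op)
         (auto simp: reg_rep_eq_kernel_op clinear_kernel_op Cc_finite_kernel)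
    then show "clinear_op a" if "a \<in> Cr ?G" for a
      using that by blast
  qed
  show "pinch iso_rel (TT s) = TT s o\<^sub>L unit_indicator (\<Union>c\<in>C. DD c)"
    if "finite C \<and> is_cover C (WW s)" for s :: 's and C
    using that by (intro pinch_TT) auto
qed

end
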